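(* Let $N\ge1$. For any $a,b,c\in(\mathbb{Z}/N\mathbb{Z})^2$ with $a+b+c=0$, $$\{g_a,g_b\}+\{g_b,g_c\}+\{g_c,g_a\}=0\quad\text{in } K_2(Y(N))\otimes\mathbb{Z}\bigl[\tfrac{1}{6N}\bigr].$$
   Context: $Y(N)$ is the modular curve of full level $N$ viewed as an algebraic curve over $\mathbb{Q}$. For $x\in(\mathbb{Z}/N\mathbb{Z})^2\setminus\{0\}$, $g_x$ is the Siegel unit: writing $x=\overline{(x_1,x_2)}$ with $0\le x_1<N$, $g_x(\tau)=q^{B_2(x_1/N)/2}\prod_{n\ge0}(1-q^n e(\tfrac{x_1\tau+x_2}{N}))\prod_{n\ge1}(1-q^n e(-\tfrac{x_1\tau+x_2}{N}))$, where $e(z)=e^{2\pi i z}$, $q^\alpha=e(\alpha\tau)$, $B_2(t)=t^2-t+\frac16$; $g_x^{12N}\in\mathcal{O}(Y(N))^\times$, so $g_x$ defines an element of $\mathcal{O}(Y(N))^\times\otimes\mathbb{Z}[\frac1{6N}]$. By convention $g_{0,0}=1$. $\{u,v\}$ denotes the Milnor symbol in $K_2$. *)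

theory Defs
  imports
    "HOL-Complex_Analysis.Complex_Analysis"
    "HOL-Number_Theory.Cong"
    "HOL-Algebra.Free_Abelian_Groups"
    "HOL-Algebra.Generated_Groups"
    "HOL-Algebra.Generated_Fields"
    "HOL-Algebra.Algebraic_Closure_Type"
begin

section \<open>Groups given by generators and relations\<close>

text \<open>
  A word is a list of letters \<open>(g, True)\<close>, standing for \<open>g\<close>, and \<open>(g, False)\<close>, standing for the
  formal inverse of \<open>g\<close>. A relation is a pair of words that are to become equal.
\<close>

type_synonym 'g word = "('g \<times> bool) list"

inductive word_eq :: "'g set \<Rightarrow> ('g word \<times> 'g word) set \<Rightarrow> 'g word \<Rightarrow> 'g word \<Rightarrow> bool"
  for S :: "'g set" and Rel :: "('g word \<times> 'g word) set"
where
  word_refl: "w \<in> lists (S \<times> UNIV) \<Longrightarrow> word_eq S Rel w w"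
| word_sym: "word_eq S Rel v w \<Longrightarrow> word_eq S Rel w v"
| word_trans: "word_eq S Rel u v \<Longrightarrow> word_eq S Rel v w \<Longrightarrow> word_eq S Rel u w"
| word_append: "word_eq S Rel u u' \<Longrightarrow> word_eq S Rel v v' \<Longrightarrow> word_eq S Rel (u @ v) (u' @ v')"
| word_cancel: "g \<in> S \<Longrightarrow> word_eq S Rel [(g, b), (g, \<not> b)] []"
| word_rel: "(v, w) \<in> Rel \<Longrightarrow> v \<in> lists (S \<times> UNIV) \<Longrightarrow> w \<in> lists (S \<times> UNIV) \<Longrightarrow> word_eq S Rel v w"

definition word_class :: "'g set \<Rightarrow> ('g word \<times> 'g word) set \<Rightarrow> 'g word \<Rightarrow> 'g word set" where
  "word_class S Rel w = {v. word_eq S Rel w v}"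

definition presented_group :: "'g set \<Rightarrow> ('g word \<times> 'g word) set \<Rightarrow> 'g word set monoid" where
  "presented_group S Rel =
    \<lparr> carrier = word_class S Rel ` lists (S \<times> UNIV),
      monoid.mult = (\<lambda>U V. \<Union>u\<in>U. \<Union>v\<in>V. word_class S Rel (u @ v)),
      one = word_class S Rel [] \<rparr>"

section \<open>The group $K_2$ of a commutative ring\<close>

text \<open>
  \<open>K\<^sub>2(R)\<close> is the kernel of the canonical map from the (stable) Steinberg group \<open>St(R)\<close> to \<open>GL(R)\<close>.
  The generator \<open>x\<^sub>i\<^sub>j(r)\<close>, where \<open>i \<noteq> j\<close>, is the triple \<open>(i, j, r)\<close>; row and column indices
  range over all natural numbers.
\<close>

definition steinberg_gens :: "('a, 'm) ring_scheme \<Rightarrow> (nat \<times> nat \<times> 'a) set" where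
  "steinberg_gens R = {(i, j, r). i \<noteq> j \<and> r \<in> carrier R}"

abbreviation stx :: "nat \<Rightarrow> nat \<Rightarrow> 'a \<Rightarrow> (nat \<times> nat \<times> 'a) word" where
  "stx i j r \<equiv> [((i, j, r), True)]"

abbreviation stx_inv :: "nat \<Rightarrow> nat \<Rightarrow> 'a \<Rightarrow> (nat \<times> nat \<times> 'a) word" where
  "stx_inv i j r \<equiv> [((i, j, r), False)]"

definition steinberg_rels ::
    "('a, 'm) ring_scheme \<Rightarrow> ((nat \<times> nat \<times> 'a) word \<times> (nat \<times> nat \<times> 'a) word) set" where
  "steinberg_rels R =
     {(stx i j r @ stx i j s, stx i j (r \<oplus>\<^bsub>R\<^esub> s)) | i j r s.
        i \<noteq> j \<and> r \<in> carrier R \<and> s \<in> carrier R}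
   \<union> {(stx i j r @ stx j l s @ stx_inv i j r @ stx_inv j l s, stx i l (r \<otimes>\<^bsub>R\<^esub> s)) | i j l r s.
        i \<noteq> j \<and> j \<noteq> l \<and> i \<noteq> l \<and> r \<in> carrier R \<and> s \<in> carrier R}
   \<union> {(stx i j r @ stx k l s @ stx_inv i j r @ stx_inv k l s, []) | i j k l r s.
        i \<noteq> j \<and> k \<noteq> l \<and> j \<noteq> k \<and> i \<noteq> l \<and> r \<in> carrier R \<and> s \<in> carrier R}"

definition steinberg_class ::
    "('a, 'm) ring_scheme \<Rightarrow> (nat \<times> nat \<times> 'a) word \<Rightarrow> (nat \<times> nat \<times> 'a) word set" where
  "steinberg_class R = word_class (steinberg_gens R) (steinberg_rels R)"

definition steinberg_group :: "('a, 'm) ring_scheme \<Rightarrow> (nat \<times> nat \<times> 'a) word set monoid" where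
  "steinberg_group R = presented_group (steinberg_gens R) (steinberg_rels R)"

text \<open>
  Left multiplication of a matrix \<open>M\<close> by the elementary matrix \<open>e\<^sub>i\<^sub>j(r)\<close> adds \<open>r\<close> times row \<open>j\<close>
  of \<open>M\<close> to row \<open>i\<close>. Hence \<open>steinberg_matrix R w\<close> is the product of the elementary matrices
  attached to the letters of \<open>w\<close>, i.e. the image of \<open>w\<close> in \<open>GL(R)\<close>. Elements of \<open>GL(R)\<close>
  are viewed as infinite matrices.
\<close>

definition elem_mult ::
    "('a, 'm) ring_scheme \<Rightarrow> nat \<Rightarrow> nat \<Rightarrow> 'a \<Rightarrow> (nat \<Rightarrow> nat \<Rightarrow> 'a) \<Rightarrow> (nat \<Rightarrow> nat \<Rightarrow> 'a)" where
  "elem_mult R i j r M = M(i := (\<lambda>k. M i k \<oplus>\<^bsub>R\<^esub> r \<otimes>\<^bsub>R\<^esub> M j k))"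

definition unit_matrix :: "('a, 'm) ring_scheme \<Rightarrow> nat \<Rightarrow> nat \<Rightarrow> 'a" where
  "unit_matrix R i j = (if i = j then \<one>\<^bsub>R\<^esub> else \<zero>\<^bsub>R\<^esub>)"

definition steinberg_matrix :: "('a, 'm) ring_scheme \<Rightarrow> (nat \<times> nat \<times> 'a) word \<Rightarrow> nat \<Rightarrow> nat \<Rightarrow> 'a" where
  "steinberg_matrix R w =
     foldr (\<lambda>((i, j, r), b) M. elem_mult R i j (if b then r else \<ominus>\<^bsub>R\<^esub> r) M) w (unit_matrix R)"

definition K2 :: "('a, 'm) ring_scheme \<Rightarrow> (nat \<times> nat \<times> 'a) word set monoid" where
  "K2 R = steinberg_group R
     \<lparr> carrier := {U \<in> carrier (steinberg_group R). \<forall>w\<in>U. steinberg_matrix R w = unit_matrix R} \<rparr>"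

text \<open>
  Milnor's symbol of two units \<open>u, v\<close> of a commutative ring is the commutator
  \<open>[h\<^sub>1\<^sub>2(u), h\<^sub>1\<^sub>3(v)]\<close>, where \<open>h\<^sub>i\<^sub>j(u) = w\<^sub>i\<^sub>j(u) w\<^sub>i\<^sub>j(-1)\<close> and
  \<open>w\<^sub>i\<^sub>j(u) = x\<^sub>i\<^sub>j(u) x\<^sub>j\<^sub>i(-u\<^sup>-\<^sup>1) x\<^sub>i\<^sub>j(u)\<close>.
\<close>

definition steinberg_w :: "('a, 'm) ring_scheme \<Rightarrow> nat \<Rightarrow> nat \<Rightarrow> 'a \<Rightarrow> (nat \<times> nat \<times> 'a) word set" where
  "steinberg_w R i j u =
     steinberg_class R (stx i j u @ stx j i (\<ominus>\<^bsub>R\<^esub> (inv\<^bsub>R\<^esub> u)) @ stx i j u)"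

definition steinberg_h :: "('a, 'm) ring_scheme \<Rightarrow> nat \<Rightarrow> nat \<Rightarrow> 'a \<Rightarrow> (nat \<times> nat \<times> 'a) word set" where
  "steinberg_h R i j u =
     steinberg_w R i j u \<otimes>\<^bsub>steinberg_group R\<^esub> steinberg_w R i j (\<ominus>\<^bsub>R\<^esub> \<one>\<^bsub>R\<^esub>)"

definition milnor_symbol :: "('a, 'm) ring_scheme \<Rightarrow> 'a \<Rightarrow> 'a \<Rightarrow> (nat \<times> nat \<times> 'a) word set" where
  "milnor_symbol R u v =
     (let G = steinberg_group R; h = steinberg_h R 1 2 u; k = steinberg_h R 1 3 v
      in h \<otimes>\<^bsub>G\<^esub> k \<otimes>\<^bsub>G\<^esub> inv\<^bsub>G\<^esub> h \<otimes>\<^bsub>G\<^esub> inv\<^bsub>G\<^esub> k)"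

section \<open>Tensor products of abelian groups\<close>

text \<open>
  \<open>A \<otimes> B\<close> is the free abelian group on \<open>carrier A \<times> carrier B\<close> modulo the biadditivity relations.
  All groups are written multiplicatively in the sense of HOL-Algebra, so the zero of a tensor
  product is its \<open>one\<close> and its addition is its \<open>mult\<close>.
\<close>

definition tensor_rels :: "('a, 'm) monoid_scheme \<Rightarrow> ('b, 'n) monoid_scheme \<Rightarrow> ('a \<times> 'b \<Rightarrow>\<^sub>0 int) set" where
  "tensor_rels A B =
     {frag_of (x \<otimes>\<^bsub>A\<^esub> y, b) - frag_of (x, b) - frag_of (y, b) | x y b.
        x \<in> carrier A \<and> y \<in> carrier A \<and> b \<in> carrier B}
   \<union> {frag_of (a, x \<otimes>\<^bsub>B\<^esub> y) - frag_of (a, x) - frag_of (a, y) | a x y.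
        a \<in> carrier A \<and> x \<in> carrier B \<and> y \<in> carrier B}"

definition tensor_free :: "('a, 'm) monoid_scheme \<Rightarrow> ('b, 'n) monoid_scheme \<Rightarrow> ('a \<times> 'b \<Rightarrow>\<^sub>0 int) monoid" where
  "tensor_free A B = free_Abelian_group (carrier A \<times> carrier B)"

definition tensor_subgroup :: "('a, 'm) monoid_scheme \<Rightarrow> ('b, 'n) monoid_scheme \<Rightarrow> ('a \<times> 'b \<Rightarrow>\<^sub>0 int) set" where
  "tensor_subgroup A B = generate (tensor_free A B) (tensor_rels A B)"

definition tensor_product ::
    "('a, 'm) monoid_scheme \<Rightarrow> ('b, 'n) monoid_scheme \<Rightarrow> ('a \<times> 'b \<Rightarrow>\<^sub>0 int) set monoid" where
  "tensor_product A B = tensor_free A B Mod tensor_subgroup A B"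

definition tensor_class ::
    "('a, 'm) monoid_scheme \<Rightarrow> ('b, 'n) monoid_scheme \<Rightarrow> ('a \<times> 'b \<Rightarrow>\<^sub>0 int) \<Rightarrow> ('a \<times> 'b \<Rightarrow>\<^sub>0 int) set" where
  "tensor_class A B f = tensor_subgroup A B #>\<^bsub>tensor_free A B\<^esub> f"

definition pure_tensor ::
    "('a, 'm) monoid_scheme \<Rightarrow> ('b, 'n) monoid_scheme \<Rightarrow> 'a \<Rightarrow> 'b \<Rightarrow> ('a \<times> 'b \<Rightarrow>\<^sub>0 int) set" where
  "pure_tensor A B a b = tensor_class A B (frag_of (a, b))"

text \<open>The additive group of $\mathbb{Z}[1/m]$.\<close>

definition Z_inv :: "nat \<Rightarrow> rat monoid" where
  "Z_inv m = \<lparr> carrier = {of_int a / of_nat m ^ k | a k. True}, monoid.mult = (+), one = 0 \<rparr>"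

text \<open>
  The symbol \<open>{\<sigma>, \<tau>} \<in> K\<^sub>2(R) \<otimes> \<int>[1/m]\<close> of \<open>\<sigma>, \<tau> \<in> R\<^sup>\<times> \<otimes> \<int>[1/m]\<close>: the biadditive map given by
  \<open>{u \<otimes> r, v \<otimes> s} = {u, v} \<otimes> r s\<close>, evaluated on representatives of the cosets.
\<close>

definition milnor_frag ::
    "('a, 'm) ring_scheme \<Rightarrow> ('a \<times> rat \<Rightarrow>\<^sub>0 int) \<Rightarrow> ('a \<times> rat \<Rightarrow>\<^sub>0 int) \<Rightarrow>
     ((nat \<times> nat \<times> 'a) word set \<times> rat \<Rightarrow>\<^sub>0 int)" where
  "milnor_frag R f g =
     frag_extend (\<lambda>(u, r). frag_extend (\<lambda>(v, s). frag_of (milnor_symbol R u v, r * s)) g) f"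

definition milnor_symbol_inv ::
    "nat \<Rightarrow> ('a, 'm) ring_scheme \<Rightarrow> ('a \<times> rat \<Rightarrow>\<^sub>0 int) set \<Rightarrow> ('a \<times> rat \<Rightarrow>\<^sub>0 int) set \<Rightarrow>
     ((nat \<times> nat \<times> 'a) word set \<times> rat \<Rightarrow>\<^sub>0 int) set" where
  "milnor_symbol_inv m R U V = (\<Union>f\<in>U. \<Union>g\<in>V. tensor_class (K2 R) (Z_inv m) (milnor_frag R f g))"

section \<open>The modular curve $Y(N)$ over $\mathbb{Q}$\<close>

definition e2pi :: "complex \<Rightarrow> complex" where
  "e2pi z = exp (2 * of_real pi * \<i> * z)"

definition upper_half_plane :: "complex set" where
  "upper_half_plane = {\<tau>. Im \<tau> > 0}"

definition SL2Z :: "(int \<times> int \<times> int \<times> int) set" where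
  "SL2Z = {(a, b, c, d). a * d - b * c = 1}"

definition Gamma_full :: "nat \<Rightarrow> (int \<times> int \<times> int \<times> int) set" where
  "Gamma_full N = {(a, b, c, d) \<in> SL2Z.
     [a = 1] (mod int N) \<and> [b = 0] (mod int N) \<and> [c = 0] (mod int N) \<and> [d = 1] (mod int N)}"

fun moebius :: "int \<times> int \<times> int \<times> int \<Rightarrow> complex \<Rightarrow> complex" where
  "moebius (a, b, c, d) \<tau> = (of_int a * \<tau> + of_int b) / (of_int c * \<tau> + of_int d)"

text \<open>
  \<open>F\<close> is the expansion of \<open>f\<close> in powers of \<open>q\<^sup>1\<^sup>/\<^sup>N = e2pi (\<tau>/N)\<close>, with finite principal part.
  The condition on the radius of convergence says that the series converges on the whole upper
  half-plane.
\<close>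

definition has_q_expansion :: "nat \<Rightarrow> (complex \<Rightarrow> complex) \<Rightarrow> complex fls \<Rightarrow> bool" where
  "has_q_expansion N f F \<longleftrightarrow>
     fls_conv_radius F \<ge> 1 \<and> (\<forall>\<tau>\<in>upper_half_plane. f \<tau> = eval_fls F (e2pi (\<tau> / of_nat N)))"

definition cyclotomic_field :: "nat \<Rightarrow> complex set" where
  "cyclotomic_field N = generate_field ring_of_type_algebra {e2pi (1 / of_nat N)}"

text \<open>
  The affine curve \<open>Y(N)\<close> over $\mathbb{Q}$ is represented by its coordinate ring. Its field of
  constants is $\mathbb{Q}(\zeta_N)$, and restricting a function to the component of
  $Y(N)(\mathbb{C})$ that contains the elliptic curves $\mathbb{C}/(\mathbb{Z}+\tau\mathbb{Z})$ with
  the basis $(\tau/N, 1/N)$ of the $N$-torsion identifies \<open>\<O>(Y(N))\<close> with the ring of the functions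
  on the upper half-plane that are holomorphic, invariant under \<open>\<Gamma>(N)\<close>, meromorphic at all cusps,
  and whose \<open>q\<close>-expansion at infinity has coefficients in $\mathbb{Q}(\zeta_N)$. For \<open>N \<le> 2\<close> this
  is the coordinate ring of the coarse moduli space.
\<close>

definition Y_carrier :: "nat \<Rightarrow> (complex \<Rightarrow> complex) set" where
  "Y_carrier N = {f \<in> extensional upper_half_plane.
     f holomorphic_on upper_half_plane \<and>
     (\<forall>\<gamma>\<in>Gamma_full N. \<forall>\<tau>\<in>upper_half_plane. f (moebius \<gamma> \<tau>) = f \<tau>) \<and>
     (\<forall>\<gamma>\<in>SL2Z. \<exists>F. has_q_expansion N (\<lambda>\<tau>. f (moebius \<gamma> \<tau>)) F) \<and>
     (\<exists>F. has_q_expansion N f F \<and> (\<forall>k. fls_nth F k \<in> cyclotomic_field N))}"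

definition Y_ring :: "nat \<Rightarrow> (complex \<Rightarrow> complex) ring" where
  "Y_ring N =
    \<lparr> carrier = Y_carrier N,
      monoid.mult = (\<lambda>f g. \<lambda>\<tau>\<in>upper_half_plane. f \<tau> * g \<tau>),
      one = (\<lambda>\<tau>\<in>upper_half_plane. 1),
      zero = (\<lambda>\<tau>\<in>upper_half_plane. 0),
      add = (\<lambda>f g. \<lambda>\<tau>\<in>upper_half_plane. f \<tau> + g \<tau>) \<rparr>"

section \<open>Siegel units\<close>

definition bernoulli2 :: "real \<Rightarrow> real" where
  "bernoulli2 t = t\<^sup>2 - t + 1 / 6"

text \<open>
  Elements of $(\mathbb{Z}/N\mathbb{Z})^2$ are given by arbitrary pairs of integers; the definition
  reduces them modulo \<open>N\<close>.
\<close>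

definition siegel_function :: "nat \<Rightarrow> int \<times> int \<Rightarrow> complex \<Rightarrow> complex" where
  "siegel_function N x \<tau> =
     (let x1 = fst x mod int N; x2 = snd x mod int N; z = (of_int x1 * \<tau> + of_int x2) / of_nat N
      in if x1 = 0 \<and> x2 = 0 then 1
         else e2pi (of_real (bernoulli2 (of_int x1 / of_nat N) / 2) * \<tau>)
              * prodinf (\<lambda>n. 1 - e2pi (of_nat n * \<tau>) * e2pi z)
              * prodinf (\<lambda>n. 1 - e2pi (of_nat (Suc n) * \<tau>) * e2pi (- z)))"

text \<open>
  \<open>g\<^sub>x\<close> as an element of \<open>\<O>(Y(N))\<^sup>\<times> \<otimes> \<int>[1/6N]\<close>: only the \<open>12N\<close>-th power of the Siegel function lies
  in \<open>\<O>(Y(N))\<^sup>\<times>\<close>, so \<open>g\<^sub>x\<close> is \<open>g\<^sub>x\<^sup>1\<^sup>2\<^sup>N \<otimes> 1/(12N)\<close>.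
\<close>

definition siegel_unit :: "nat \<Rightarrow> int \<times> int \<Rightarrow> ((complex \<Rightarrow> complex) \<times> rat \<Rightarrow>\<^sub>0 int) set" where
  "siegel_unit N x =
     pure_tensor (units_of (Y_ring N)) (Z_inv (6 * N))
       (\<lambda>\<tau>\<in>upper_half_plane. siegel_function N x \<tau> ^ (12 * N)) (1 / of_nat (12 * N))"

definition siegel_symbol ::
    "nat \<Rightarrow> int \<times> int \<Rightarrow> int \<times> int \<Rightarrow>
     ((nat \<times> nat \<times> (complex \<Rightarrow> complex)) word set \<times> rat \<Rightarrow>\<^sub>0 int) set" where
  "siegel_symbol N x y =
     milnor_symbol_inv (6 * N) (Y_ring N) (siegel_unit N x) (siegel_unit N y)"

text \<open>
  $K_2(Y(N)) \otimes \mathbb{Z}[1/6N]$. Since \<open>Y(N)\<close> is affine, $K_2(Y(N))$ is $K_2$ of its coordinate ring.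
\<close>

definition K2_Y_inv :: "nat \<Rightarrow> ((nat \<times> nat \<times> (complex \<Rightarrow> complex)) word set \<times> rat \<Rightarrow>\<^sub>0 int) set monoid" where
  "K2_Y_inv N = tensor_product (K2 (Y_ring N)) (Z_inv (6 * N))"

end

theory Submission
  imports Defs
begin

text \<open>
  For torsion points \<open>a, b\<close> the difference \<open>\<wp>(a) - \<wp>(b)\<close> equals
  \<open>f\<^sub>a\<^sub>b = g\<^sub>a\<^sub>+\<^sub>b g\<^sub>a\<^sub>-\<^sub>b g\<^sub>a\<^sup>-\<^sup>2 g\<^sub>b\<^sup>-\<^sup>2\<close> up to a factor that does not depend on \<open>a, b\<close>, so
  \<open>f\<^sub>a\<^sub>b + f\<^sub>b\<^sub>c + f\<^sub>c\<^sub>a = 0\<close>, and the Steinberg relation for the units \<open>- f\<^sub>a\<^sub>b / f\<^sub>c\<^sub>a\<close> and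
  \<open>- f\<^sub>b\<^sub>c / f\<^sub>c\<^sub>a\<close> gives \<open>T(a, b, c) = {f\<^sub>a\<^sub>b, f\<^sub>b\<^sub>c} + {f\<^sub>b\<^sub>c, f\<^sub>c\<^sub>a} + {f\<^sub>c\<^sub>a, f\<^sub>a\<^sub>b} = 0\<close>.
  Expanding by bilinearity, \<open>T\<close> is a combination of three-term sums
  \<open>S(x, y) = {g\<^sub>x, g\<^sub>y} + {g\<^sub>y, g\<^sub>x\<^sub>+\<^sub>y} + {g\<^sub>x\<^sub>+\<^sub>y, g\<^sub>x}\<close>. Summing \<open>T(a, b, c)\<close> over all \<open>c\<close>
  gives \<open>2 N\<^sup>2 (S(a, b) + S(a, -b)) = 0\<close>. With this, \<open>T(u - t, t, v - t) = 0\<close> reads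
  \<open>S(u, v) - S(u, v - 2t) - S(u - 2t, v) + S(u - 2t, v - 2t) = 0\<close>, and summing over all \<open>t\<close>
  gives \<open>N\<^sup>2 S(u, v) = 0\<close>.

  The three-term identity for \<open>f\<close> and the modular behaviour of the Siegel functions both follow from
  Liouville's theorem for quotients of theta functions. The multiplier in the modular transformation is a
  12th root of unity because the product of the Siegel functions at the three points of order 2 is constant.
\<close>

section \<open>The Steinberg group and the centre\<close>

text \<open>The Steinberg relation asks for units of the ring itself with u + v = 1, whereas Siegel
  functions enter the ring only through powers with exponent 12N. The way out: quotients of two
  differences of values of the Weierstrass function at torsion points are functions on Y(N) without
  any power, because the multipliers of the Siegel functions cancel by the parallelogram law. Up to
  sign they are 12N-th roots of the quotients f_ab / f_ca formed from the powers, and biadditivity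
  carries the vanishing symbol over to these.

  The sums over c and t run through all of (Z/N)^2, so T = 0 is needed for degenerate triples too;
  there it holds formally, given g_0 = 1.

  Inverting 6N serves three purposes: 2 for the antisymmetrisation and the doubled sums, N for the
  sums over torsion points and for the roots of unity between different normalisations of g_x, and
  12N for the scalar in the definition of g_x.

  As K_2 is a kernel in the Steinberg group, bilinearity of symbols has to be derived; it rests on
  the centrality of that kernel. Identities in tensor products are handled as membership in the
  subgroup \<open>H\<close> of relations.\<close>

lemma word_eq_lists:
  "word_eq S Rel v w \<Longrightarrow> v \<in> lists (S \<times> UNIV) \<and> w \<in> lists (S \<times> UNIV)"
  by (induction rule: word_eq.induct) auto

lemma word_class_eq:
  assumes "word_eq S Rel v w" shows "word_class S Rel v = word_class S Rel w"
  using assms word_trans word_sym unfolding word_class_def by blast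

lemma word_class_mem: "w \<in> lists (S \<times> UNIV) \<Longrightarrow> w \<in> word_class S Rel w"
  by (simp add: word_class_def word_refl)

lemma presented_group_mult:
  assumes "v \<in> lists (S \<times> UNIV)" "w \<in> lists (S \<times> UNIV)"
  shows "word_class S Rel v \<otimes>\<^bsub>presented_group S Rel\<^esub> word_class S Rel w = word_class S Rel (v @ w)"
proof -
  have "word_class S Rel (v' @ w') = word_class S Rel (v @ w)"
    if "v' \<in> word_class S Rel v" "w' \<in> word_class S Rel w" for v' w'
    using that word_append[of S Rel v v' w w'] word_class_eq
    unfolding word_class_def by (metis mem_Collect_eq)
  hence "(\<Union>v'\<in>word_class S Rel v. \<Union>w'\<in>word_class S Rel w. word_class S Rel (v' @ w')) =
      (\<Union>v'\<in>word_class S Rel v. \<Union>w'\<in>word_class S Rel w. word_class S Rel (v @ w))"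
    by (intro SUP_cong refl)
  moreover have "v \<in> word_class S Rel v" "w \<in> word_class S Rel w"
    using assms by (auto intro: word_class_mem)
  ultimately show ?thesis
    unfolding presented_group_def by auto
qed

lemma presented_group_one: "\<one>\<^bsub>presented_group S Rel\<^esub> = word_class S Rel []"
  by (simp add: presented_group_def)

lemma presented_group_carrier:
  "carrier (presented_group S Rel) = word_class S Rel ` lists (S \<times> UNIV)"
  by (simp add: presented_group_def)

definition word_inv :: "'g word \<Rightarrow> 'g word" where
  "word_inv w = rev (map (\<lambda>(g, b). (g, \<not> b)) w)"

lemma word_inv_lists: "w \<in> lists (S \<times> UNIV) \<Longrightarrow> word_inv w \<in> lists (S \<times> UNIV)"
  by (induction w) (auto simp: word_inv_def)

lemma word_inv_left:
  "w \<in> lists (S \<times> UNIV) \<Longrightarrow> word_eq S Rel (word_inv w @ w) []"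
proof (induction w)
  case (Cons l w)
  obtain g b where l: "l = (g, b)" by force
  have g: "g \<in> S" and w: "w \<in> lists (S \<times> UNIV)" using Cons.prems l by auto
  have "word_eq S Rel [(g, \<not> b), (g, b)] []"
    using word_cancel[OF g, of Rel "\<not> b"] by simp
  hence "word_eq S Rel ([(g, \<not> b), (g, b)] @ w) ([] @ w)"
    by (rule word_append) (rule word_refl[OF w])
  hence "word_eq S Rel (word_inv w @ ([(g, \<not> b), (g, b)] @ w)) (word_inv w @ ([] @ w))"
    by (rule word_append[OF word_refl[OF word_inv_lists[OF w]]])
  moreover have "word_eq S Rel (word_inv w @ w) []"
    by (rule Cons.IH[OF w])
  ultimately show ?case
    unfolding word_inv_def l by (auto intro: word_trans)
qed (auto simp: word_inv_def intro: word_refl)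

lemma group_presented_group: "group (presented_group S Rel)"
proof (rule groupI)
  fix x assume "x \<in> carrier (presented_group S Rel)"
  then obtain w where w: "w \<in> lists (S \<times> UNIV)" "x = word_class S Rel w"
    by (auto simp: presented_group_carrier)
  show "\<exists>y\<in>carrier (presented_group S Rel). y \<otimes>\<^bsub>presented_group S Rel\<^esub> x = \<one>\<^bsub>presented_group S Rel\<^esub>"
    using w word_inv_lists[OF w(1)] word_class_eq[OF word_inv_left[OF w(1)]]
    by (auto simp: presented_group_mult presented_group_carrier presented_group_one
             intro!: bexI[of _ "word_class S Rel (word_inv w)"])
next
  fix x y assume "x \<in> carrier (presented_group S Rel)" "y \<in> carrier (presented_group S Rel)"
  then obtain v w where "v \<in> lists (S \<times> UNIV)" "x = word_class S Rel v"
    "w \<in> lists (S \<times> UNIV)" "y = word_class S Rel w"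
    by (auto simp: presented_group_carrier)
  thus "x \<otimes>\<^bsub>presented_group S Rel\<^esub> y \<in> carrier (presented_group S Rel)"
    by (simp only: presented_group_mult append_in_lists_conv simp_thms presented_group_carrier imageI)
next
  fix x y z assume "x \<in> carrier (presented_group S Rel)" "y \<in> carrier (presented_group S Rel)"
    "z \<in> carrier (presented_group S Rel)"
  then obtain u v w where "u \<in> lists (S \<times> UNIV)" "x = word_class S Rel u"
    "v \<in> lists (S \<times> UNIV)" "y = word_class S Rel v"
    "w \<in> lists (S \<times> UNIV)" "z = word_class S Rel w"
    by (auto simp: presented_group_carrier)
  thus "x \<otimes>\<^bsub>presented_group S Rel\<^esub> y \<otimes>\<^bsub>presented_group S Rel\<^esub> z =
      x \<otimes>\<^bsub>presented_group S Rel\<^esub> (y \<otimes>\<^bsub>presented_group S Rel\<^esub> z)"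
    by (simp only: presented_group_mult append_in_lists_conv append_assoc simp_thms)
next
  show "\<one>\<^bsub>presented_group S Rel\<^esub> \<in> carrier (presented_group S Rel)"
    by (auto simp: presented_group_carrier presented_group_one)
next
  fix x assume "x \<in> carrier (presented_group S Rel)"
  then obtain v where "v \<in> lists (S \<times> UNIV)" "x = word_class S Rel v"
    by (auto simp: presented_group_carrier)
  thus "\<one>\<^bsub>presented_group S Rel\<^esub> \<otimes>\<^bsub>presented_group S Rel\<^esub> x = x"
    by (simp only: presented_group_one presented_group_mult append_Nil lists.Nil)
qed

lemma group_steinberg_group: "group (steinberg_group R)"
  by (simp add: steinberg_group_def group_presented_group)

section \<open>Generators of the Steinberg group and their commutators\<close>

locale steinberg = cring R for R (structure)

sublocale steinberg \<subseteq> St: group "steinberg_group R"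
  by (rule group_steinberg_group)

context steinberg begin

abbreviation St where "St \<equiv> steinberg_group R"
abbreviation st_mult (infixl "\<bullet>\<^sub>S" 70) where "a \<bullet>\<^sub>S b \<equiv> a \<otimes>\<^bsub>St\<^esub> b"
abbreviation st_inv where "st_inv a \<equiv> inv\<^bsub>St\<^esub> a"
abbreviation st_words where "st_words \<equiv> lists (steinberg_gens R \<times> (UNIV :: bool set))"
abbreviation cls where "cls \<equiv> steinberg_class R"

definition x_gen where "x_gen i j r = cls (stx i j r)"

lemma cls_mult: "v \<in> st_words \<Longrightarrow> w \<in> st_words \<Longrightarrow> cls v \<bullet>\<^sub>S cls w = cls (v @ w)"
  by (simp add: steinberg_class_def steinberg_group_def presented_group_mult)

lemma cls_closed: "w \<in> st_words \<Longrightarrow> cls w \<in> carrier St"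
  by (simp add: steinberg_class_def steinberg_group_def presented_group_carrier)

lemma cls_Nil: "cls [] = \<one>\<^bsub>St\<^esub>"
  by (simp add: steinberg_class_def steinberg_group_def presented_group_one)

lemma carrier_St: "carrier St = cls ` st_words"
  by (simp add: steinberg_class_def steinberg_group_def presented_group_carrier image_image)

lemma gens_iff: "(i, j, r) \<in> steinberg_gens R \<longleftrightarrow> i \<noteq> j \<and> r \<in> carrier R"
  by (simp add: steinberg_gens_def)

lemma cls_inv:
  assumes "i \<noteq> j" "r \<in> carrier R" shows "cls (stx_inv i j r) = st_inv (x_gen i j r)"
proof (rule St.inv_equality[symmetric])
  have "word_eq (steinberg_gens R) (steinberg_rels R) [((i, j, r), False), ((i, j, r), \<not> False)] []"
    by (rule word_cancel) (use assms gens_iff in auto)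
  thus "cls (stx_inv i j r) \<bullet>\<^sub>S x_gen i j r = \<one>\<^bsub>St\<^esub>"
    using assms unfolding x_gen_def
    by (subst cls_mult) (auto simp: gens_iff cls_Nil[symmetric] steinberg_class_def dest: word_class_eq)
qed (use assms in \<open>auto simp: gens_iff x_gen_def intro!: cls_closed\<close>)

lemma x_gen_closed [simp]: "i \<noteq> j \<Longrightarrow> r \<in> carrier R \<Longrightarrow> x_gen i j r \<in> carrier St"
  by (auto simp: x_gen_def gens_iff intro!: cls_closed)

lemma cls_rel:
  assumes "(v, w) \<in> steinberg_rels R" "v \<in> st_words" "w \<in> st_words"
  shows "cls v = cls w"
  unfolding steinberg_class_def by (intro word_class_eq word_rel assms)

lemma x_gen_add:
  assumes "i \<noteq> j" "r \<in> carrier R" "s \<in> carrier R"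
  shows "x_gen i j r \<bullet>\<^sub>S x_gen i j s = x_gen i j (r \<oplus> s)"
proof -
  have "(stx i j r @ stx i j s, stx i j (r \<oplus> s)) \<in> steinberg_rels R"
    unfolding steinberg_rels_def using assms by blast
  from cls_rel[OF this] show ?thesis
    unfolding x_gen_def using assms by (subst cls_mult) (auto simp: gens_iff)
qed

lemma x_gen_zero [simp]: "i \<noteq> j \<Longrightarrow> x_gen i j \<zero> = \<one>\<^bsub>St\<^esub>"
  using x_gen_add[of i j \<zero> \<zero>] by (metis St.l_cancel_one x_gen_closed l_zero zero_closed)

lemma x_gen_inv:
  assumes "i \<noteq> j" "r \<in> carrier R"
  shows "st_inv (x_gen i j r) = x_gen i j (\<ominus> r)"
  using assms x_gen_add[of i j "\<ominus> r" r] by (intro St.inv_equality) (auto simp: l_neg)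

lemma x_gen_comm_aux:
  assumes "i \<noteq> j" "k \<noteq> l" "r \<in> carrier R" "s \<in> carrier R"
  shows "cls (stx i j r @ stx k l s @ stx_inv i j r @ stx_inv k l s) =
    x_gen i j r \<bullet>\<^sub>S x_gen k l s \<bullet>\<^sub>S st_inv (x_gen i j r) \<bullet>\<^sub>S st_inv (x_gen k l s)"
proof -
  have "x_gen i j r \<bullet>\<^sub>S x_gen k l s \<bullet>\<^sub>S st_inv (x_gen i j r) \<bullet>\<^sub>S st_inv (x_gen k l s) =
     cls (((stx i j r @ stx k l s) @ stx_inv i j r) @ stx_inv k l s)"
    using assms unfolding x_gen_def
    by (subst (1 2) cls_inv[symmetric, unfolded x_gen_def])
       (auto simp: gens_iff cls_mult simp del: append.simps append_assoc)
  thus ?thesis by simp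
qed

lemma x_gen_comm1:
  assumes "i \<noteq> j" "j \<noteq> l" "i \<noteq> l" "r \<in> carrier R" "s \<in> carrier R"
  shows "x_gen i j r \<bullet>\<^sub>S x_gen j l s \<bullet>\<^sub>S st_inv (x_gen i j r) \<bullet>\<^sub>S st_inv (x_gen j l s) = x_gen i l (r \<otimes> s)"
proof -
  have "(stx i j r @ stx j l s @ stx_inv i j r @ stx_inv j l s, stx i l (r \<otimes> s)) \<in> steinberg_rels R"
    unfolding steinberg_rels_def using assms by blast
  from cls_rel[OF this] show ?thesis
    unfolding x_gen_comm_aux[OF assms(1,2,4,5), symmetric] using assms by (auto simp: gens_iff x_gen_def)
qed

lemma x_gen_comm2:
  assumes "i \<noteq> j" "k \<noteq> l" "j \<noteq> k" "i \<noteq> l" "r \<in> carrier R" "s \<in> carrier R"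
  shows "x_gen i j r \<bullet>\<^sub>S x_gen k l s \<bullet>\<^sub>S st_inv (x_gen i j r) \<bullet>\<^sub>S st_inv (x_gen k l s) = \<one>\<^bsub>St\<^esub>"
proof -
  have "(stx i j r @ stx k l s @ stx_inv i j r @ stx_inv k l s, []) \<in> steinberg_rels R"
    unfolding steinberg_rels_def using assms by blast
  from cls_rel[OF this] show ?thesis
    unfolding x_gen_comm_aux[OF assms(1,2,5,6), symmetric] using assms by (auto simp: gens_iff cls_Nil)
qed

definition conj_by where "conj_by g a = g \<bullet>\<^sub>S a \<bullet>\<^sub>S st_inv g"

lemma conj_by_closed [simp]: "g \<in> carrier St \<Longrightarrow> a \<in> carrier St \<Longrightarrow> conj_by g a \<in> carrier St"
  by (simp add: conj_by_def)

lemma St_cancel [simp]: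
  assumes "g \<in> carrier St" "a \<in> carrier St"
  shows "st_inv g \<bullet>\<^sub>S (g \<bullet>\<^sub>S a) = a" "g \<bullet>\<^sub>S (st_inv g \<bullet>\<^sub>S a) = a"
  using assms by (auto simp: St.m_assoc[symmetric])

lemma conj_by_mult: "g \<in> carrier St \<Longrightarrow> a \<in> carrier St \<Longrightarrow> b \<in> carrier St \<Longrightarrow>
   conj_by g (a \<bullet>\<^sub>S b) = conj_by g a \<bullet>\<^sub>S conj_by g b"
  by (simp add: conj_by_def St.m_assoc)

lemma conj_by_inv: "g \<in> carrier St \<Longrightarrow> a \<in> carrier St \<Longrightarrow> conj_by g (st_inv a) = st_inv (conj_by g a)"
  by (simp add: conj_by_def St.m_assoc St.inv_mult_group)

lemma conj_by_conj_by: "g \<in> carrier St \<Longrightarrow> h \<in> carrier St \<Longrightarrow> a \<in> carrier St \<Longrightarrow>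
   conj_by (g \<bullet>\<^sub>S h) a = conj_by g (conj_by h a)"
  by (simp add: conj_by_def St.m_assoc St.inv_mult_group)

lemma conj_by_swap: "g \<in> carrier St \<Longrightarrow> a \<in> carrier St \<Longrightarrow> conj_by g a \<bullet>\<^sub>S g = g \<bullet>\<^sub>S a"
  by (simp add: conj_by_def St.m_assoc)

lemma conj_by_x_gen_disjoint:
  assumes "i \<noteq> j" "k \<noteq> l" "j \<noteq> k" "i \<noteq> l" "r \<in> carrier R" "s \<in> carrier R"
  shows "conj_by (x_gen i j r) (x_gen k l s) = x_gen k l s"
  using x_gen_comm2[OF assms] assms unfolding conj_by_def
  by (metis St.inv_closed St.m_closed St.inv_equality St.inv_inv x_gen_closed)

lemma conj_by_x_gen_left:
  assumes "i \<noteq> j" "j \<noteq> l" "i \<noteq> l" "r \<in> carrier R" "s \<in> carrier R"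
  shows "conj_by (x_gen i j r) (x_gen j l s) = x_gen i l (r \<otimes> s) \<bullet>\<^sub>S x_gen j l s"
  using x_gen_comm1[OF assms] assms unfolding conj_by_def
  by (metis St.inv_closed St.m_closed St.inv_solve_right x_gen_closed m_closed)

lemma conj_by_x_gen_right:
  assumes "i \<noteq> j" "k \<noteq> i" "k \<noteq> j" "r \<in> carrier R" "s \<in> carrier R"
  shows "conj_by (x_gen i j r) (x_gen k i s) = x_gen k j (\<ominus> (s \<otimes> r)) \<bullet>\<^sub>S x_gen k i s"
proof -
  have "x_gen k j (\<ominus> (s \<otimes> r)) = st_inv (x_gen k i s \<bullet>\<^sub>S x_gen i j r \<bullet>\<^sub>S st_inv (x_gen k i s) \<bullet>\<^sub>S st_inv (x_gen i j r))"
    using x_gen_comm1[of k i j s r] assms x_gen_inv[of k j "s \<otimes> r"] by simp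
  thus ?thesis using assms unfolding conj_by_def by (simp add: St.inv_mult_group St.m_assoc)
qed

lemma x_gen_commute:
  assumes "i \<noteq> j" "k \<noteq> l" "j \<noteq> k" "i \<noteq> l" "r \<in> carrier R" "s \<in> carrier R"
  shows "x_gen i j r \<bullet>\<^sub>S x_gen k l s = x_gen k l s \<bullet>\<^sub>S x_gen i j r"
  using conj_by_swap[of "x_gen i j r" "x_gen k l s"] conj_by_x_gen_disjoint[OF assms] assms by simp

definition st_act where
  "st_act w M = foldr (\<lambda>((i, j, r), b) M. elem_mult R i j (if b then r else \<ominus> r) M) w M"

definition mats where "mats = {M :: nat \<Rightarrow> nat \<Rightarrow> 'a. \<forall>i j. M i j \<in> carrier R}"

text \<open>Acting on an arbitrary matrix rather than on the unit matrix turns concatenation of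
  words into composition; \<open>steinberg_matrix\<close> is the value at
  \<open>unit_matrix R\<close>.\<close>

lemma st_act_append: "st_act (v @ w) M = st_act v (st_act w M)"
  by (simp add: st_act_def)

lemma st_act_Nil [simp]: "st_act [] M = M" by (simp add: st_act_def)

lemma st_act_Cons [simp]: "st_act (((i, j, r), b) # w) M = elem_mult R i j (if b then r else \<ominus> r) (st_act w M)"
  by (simp add: st_act_def)

lemma steinberg_matrix_eq: "steinberg_matrix R w = st_act w (unit_matrix R)"
  by (simp add: steinberg_matrix_def st_act_def)

lemma unit_matrix_mats: "unit_matrix R \<in> mats"
  by (auto simp: mats_def unit_matrix_def)

lemma elem_mult_mats: "r \<in> carrier R \<Longrightarrow> M \<in> mats \<Longrightarrow> elem_mult R i j r M \<in> mats"
  by (auto simp: mats_def elem_mult_def)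

lemma st_act_mats: "w \<in> st_words \<Longrightarrow> M \<in> mats \<Longrightarrow> st_act w M \<in> mats"
proof (induction w)
  case (Cons l w)
  obtain i j r b where l: "l = ((i, j, r), b)" by (metis prod.exhaust)
  show ?case using Cons l by (auto simp: gens_iff intro!: elem_mult_mats)
qed auto

lemma elem_mult_cancel:
  assumes "i \<noteq> j" "r \<in> carrier R" "M \<in> mats"
  shows "elem_mult R i j r (elem_mult R i j (\<ominus> r) M) = M" "elem_mult R i j (\<ominus> r) (elem_mult R i j r M) = M"
  using assms by (auto simp: elem_mult_def mats_def fun_eq_iff a_assoc l_distr[symmetric] r_neg l_neg)

lemma st_act_rel:
  assumes "(v, w) \<in> steinberg_rels R" "M \<in> mats"
  shows "st_act v M = st_act w M"
proof -
  have M: "M i j \<in> carrier R" for i j using assms(2) by (auto simp: mats_def)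
  have 0: "a \<oplus> (b \<oplus> (\<ominus> a \<oplus> \<ominus> b)) = \<zero>" if "a \<in> carrier R" "b \<in> carrier R" for a b
    using that r_neg[of "a \<oplus> b"] by (simp add: minus_add a_assoc)
  have 1: "elem_mult R i j r (elem_mult R i j s M) = elem_mult R i j (r \<oplus> s) M"
    if "i \<noteq> j" "r \<in> carrier R" "s \<in> carrier R" for i j r s
    using that M by (auto simp: elem_mult_def fun_eq_iff l_distr a_ac)
  have 2: "elem_mult R i j r (elem_mult R j l s (elem_mult R i j (\<ominus> r) (elem_mult R j l (\<ominus> s) M))) =
     elem_mult R i l (r \<otimes> s) M"
    if "i \<noteq> j" "j \<noteq> l" "i \<noteq> l" "r \<in> carrier R" "s \<in> carrier R" for i j l r s
    using that M
    by (auto simp: elem_mult_def fun_eq_iff l_distr r_distr a_ac l_minus r_minus m_ac minus_equality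
          l_neg r_neg r_neg1 r_neg2)
  have 3: "elem_mult R i j r (elem_mult R k l s (elem_mult R i j (\<ominus> r) (elem_mult R k l (\<ominus> s) M))) = M"
    if "i \<noteq> j" "k \<noteq> l" "j \<noteq> k" "i \<noteq> l" "r \<in> carrier R" "s \<in> carrier R" for i j k l r s
    using that M
    by (auto simp: elem_mult_def fun_eq_iff l_distr r_distr a_ac l_minus r_minus m_ac
          l_neg r_neg r_neg1 r_neg2 0)
  show ?thesis using assms(1) unfolding steinberg_rels_def by (auto simp: 1 2 3)
qed

text \<open>The defining relations hold for elementary row operations, so the action factors through
  St(R); in particular the matrix of a word depends only on its class.\<close>

lemma st_act_word_eq:
  assumes "word_eq (steinberg_gens R) (steinberg_rels R) v w"
  shows "M \<in> mats \<Longrightarrow> st_act v M = st_act w M"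
  using assms
proof (induction arbitrary: M rule: word_eq.induct)
  case (word_append u u' v v')
  show ?case using word_append.IH(1)[of "st_act v' M"] word_append st_act_mats word_eq_lists
    by (metis st_act_append)
next
  case (word_cancel g b)
  obtain i j r where g: "g = (i, j, r)" by (metis prod.exhaust)
  show ?case using word_cancel g by (auto simp: gens_iff elem_mult_cancel)
next
  case (word_rel v w)
  then show ?case using st_act_rel by blast
qed auto


text \<open>Centrality of the kernel of \<open>St(R) \<rightarrow> GL(R)\<close>: conjugation by a word \<open>w\<close> with indices
  below \<open>n\<close> acts on the abelian subgroup generated by the \<open>x\<^sub>k\<^sub>n\<close> (\<open>k < n\<close>)
  through the matrix of \<open>w\<close>, and similarly for the \<open>x\<^sub>n\<^sub>k\<close>.\<close>

definition abelian_family :: "nat \<Rightarrow> (nat \<Rightarrow> 'a \<Rightarrow> (nat \<times> nat \<times> 'a) word set) \<Rightarrow> bool" where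
  "abelian_family n y \<longleftrightarrow> (\<forall>i<n. \<forall>k<n. \<forall>r\<in>carrier R. \<forall>s\<in>carrier R. y i r \<in> carrier St \<and>
     y i r \<bullet>\<^sub>S y i s = y i (r \<oplus> s) \<and> y i r \<bullet>\<^sub>S y k s = y k s \<bullet>\<^sub>S y i r)"

text \<open>For an abelian family this is the image of the vector (v 0, ..., v (m-1)) under the
  homomorphism from R^m that the family defines, written as an ordered product.\<close>

primrec st_vec :: "(nat \<Rightarrow> 'a \<Rightarrow> (nat \<times> nat \<times> 'a) word set) \<Rightarrow> nat \<Rightarrow> (nat \<Rightarrow> 'a) \<Rightarrow> (nat \<times> nat \<times> 'a) word set" where
  "st_vec y 0 v = \<one>\<^bsub>St\<^esub>"
| "st_vec y (Suc m) v = st_vec y m v \<bullet>\<^sub>S y m (v m)"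

lemma family_closed: "abelian_family n y \<Longrightarrow> k < n \<Longrightarrow> r \<in> carrier R \<Longrightarrow> y k r \<in> carrier St"
  unfolding abelian_family_def by blast

lemma vec_closed:
  "abelian_family n y \<Longrightarrow> m \<le> n \<Longrightarrow> (\<And>k. v k \<in> carrier R) \<Longrightarrow> st_vec y m v \<in> carrier St"
  by (induction m) (auto simp: Suc_le_eq intro: family_closed)

lemma vec_comm:
  assumes y: "abelian_family n y"
  shows "m \<le> n \<Longrightarrow> i < n \<Longrightarrow> (\<And>k. v k \<in> carrier R) \<Longrightarrow> r \<in> carrier R \<Longrightarrow>
    st_vec y m v \<bullet>\<^sub>S y i r = y i r \<bullet>\<^sub>S st_vec y m v"
proof (induction m)
  case 0
  then show ?case using y by (simp add: abelian_family_def)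
next
  case (Suc m)
  have c: "y m (v m) \<bullet>\<^sub>S y i r = y i r \<bullet>\<^sub>S y m (v m)" "y m (v m) \<in> carrier St" "y i r \<in> carrier St"
    using Suc y by (auto simp: abelian_family_def)
  have "st_vec y m v \<in> carrier St" using Suc by (intro vec_closed[OF y]) auto
  then show ?case using Suc c by (simp add: St.m_assoc) (simp add: St.m_assoc[symmetric])
qed

lemma vec_cong: "(\<And>k. k < m \<Longrightarrow> v k = w k) \<Longrightarrow> st_vec y m v = st_vec y m w"
  by (induction m) auto

lemma vec_upd:
  assumes y: "abelian_family n y" and "m \<le> n" "i < n" "\<And>k. v k \<in> carrier R" "r \<in> carrier R"
  shows "y i r \<bullet>\<^sub>S st_vec y m v = (if i < m then st_vec y m (v(i := v i \<oplus> r)) else y i r \<bullet>\<^sub>S st_vec y m v)"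
  using assms(2-)
proof (induction m)
  case (Suc m)
  have c: "st_vec y m v \<in> carrier St" "y m (v m) \<in> carrier St" "y i r \<in> carrier St"
    using Suc y by (auto simp: abelian_family_def intro!: vec_closed[OF y])
  show ?case
  proof (cases "i = m")
    case True
    have "y i r \<bullet>\<^sub>S st_vec y (Suc m) v = y i r \<bullet>\<^sub>S st_vec y m v \<bullet>\<^sub>S y m (v m)"
      using c by (simp add: St.m_assoc)
    also have "\<dots> = st_vec y m v \<bullet>\<^sub>S y i r \<bullet>\<^sub>S y m (v m)"
      using vec_comm[OF y, of m i v r] Suc by simp
    also have "\<dots> = st_vec y m v \<bullet>\<^sub>S y m (v m \<oplus> r)"
    proof -
      have "y m r \<bullet>\<^sub>S y m (v m) = y m (v m \<oplus> r)"
        using y Suc True a_comm[of r "v m"] by (simp add: abelian_family_def)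
      thus ?thesis using c True by (simp add: St.m_assoc)
    qed
    also have "st_vec y m v = st_vec y m (v(i := v i \<oplus> r))"
      using True by (intro vec_cong) auto
    finally show ?thesis using True by simp
  next
    case False
    show ?thesis using False Suc c by (auto simp: St.m_assoc[symmetric] fun_upd_def)
  qed
qed auto

abbreviation "st_col n \<equiv> st_vec (\<lambda>k. x_gen k n)"
abbreviation "st_row n \<equiv> st_vec (x_gen n)"

lemma col_family: "abelian_family n (\<lambda>k. x_gen k n)" and row_family: "abelian_family n (x_gen n)"
  unfolding abelian_family_def by ((intro allI impI ballI conjI; rule x_gen_add x_gen_commute x_gen_closed; simp)+)

lemmas col_closed = vec_closed[OF col_family] and col_comm = vec_comm[OF col_family]
  and col_upd = vec_upd[OF col_family]
lemmas row_closed = vec_closed[OF row_family] and row_comm = vec_comm[OF row_family]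
  and row_upd = vec_upd[OF row_family]

lemma conj_by_one [simp]: "g \<in> carrier St \<Longrightarrow> conj_by g \<one>\<^bsub>St\<^esub> = \<one>\<^bsub>St\<^esub>"
  by (simp add: conj_by_def)

text \<open>Only the factor x_jn(v_j) fails to commute with x_ij(r), and it contributes x_in(r v_j):
  this is left multiplication of the column by e_ij(r).\<close>

lemma conj_by_col:
  assumes "m \<le> n" "i < n" "j < n" "i \<noteq> j" "\<And>k. v k \<in> carrier R" "r \<in> carrier R"
  shows "conj_by (x_gen i j r) (st_col n m v) = (if j < m then x_gen i n (r \<otimes> v j) \<bullet>\<^sub>S st_col n m v else st_col n m v)"
  using assms
proof (induction m)
  case (Suc m)
  have c: "st_col n m v \<in> carrier St" using Suc by (intro col_closed) auto
  have e: "conj_by (x_gen i j r) (st_col n (Suc m) v) = conj_by (x_gen i j r) (st_col n m v) \<bullet>\<^sub>S conj_by (x_gen i j r) (x_gen m n (v m))"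
    using Suc c by (simp add: conj_by_mult)
  show ?case
  proof (cases "j = m")
    case True
    have "conj_by (x_gen i j r) (st_col n (Suc m) v) = st_col n m v \<bullet>\<^sub>S (x_gen i n (r \<otimes> v m) \<bullet>\<^sub>S x_gen m n (v m))"
      unfolding e using Suc True by (simp add: conj_by_x_gen_left)
    also have "\<dots> = x_gen i n (r \<otimes> v m) \<bullet>\<^sub>S st_col n (Suc m) v"
      using Suc c col_comm[of m n i v "r \<otimes> v m"] by (simp add: St.m_assoc[symmetric])
    finally show ?thesis using True by simp
  next
    case False
    have "conj_by (x_gen i j r) (x_gen m n (v m)) = x_gen m n (v m)"
      using Suc False by (intro conj_by_x_gen_disjoint) auto
    then show ?thesis using e False Suc c by (auto simp: St.m_assoc)
  qed
qed auto

text \<open>Here only x_ni(v_i) contributes, namely x_nj(- v_i r): the row is multiplied on the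
  right by the inverse of e_ij(r).\<close>

lemma conj_by_row:
  assumes "m \<le> n" "i < n" "j < n" "i \<noteq> j" "\<And>k. v k \<in> carrier R" "r \<in> carrier R"
  shows "conj_by (x_gen i j r) (st_row n m v) = (if i < m then x_gen n j (\<ominus> (v i \<otimes> r)) \<bullet>\<^sub>S st_row n m v else st_row n m v)"
  using assms
proof (induction m)
  case (Suc m)
  have c: "st_row n m v \<in> carrier St" using Suc by (intro row_closed) auto
  have e: "conj_by (x_gen i j r) (st_row n (Suc m) v) = conj_by (x_gen i j r) (st_row n m v) \<bullet>\<^sub>S conj_by (x_gen i j r) (x_gen n m (v m))"
    using Suc c by (simp add: conj_by_mult)
  show ?case
  proof (cases "i = m")
    case True
    have "conj_by (x_gen i j r) (st_row n (Suc m) v) = st_row n m v \<bullet>\<^sub>S (x_gen n j (\<ominus> (v m \<otimes> r)) \<bullet>\<^sub>S x_gen n m (v m))"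
      unfolding e using Suc True by (simp add: conj_by_x_gen_right)
    also have "\<dots> = x_gen n j (\<ominus> (v m \<otimes> r)) \<bullet>\<^sub>S st_row n (Suc m) v"
      using Suc c row_comm[of m n j v "\<ominus> (v m \<otimes> r)"] by (simp add: St.m_assoc[symmetric])
    finally show ?thesis using True by simp
  next
    case False
    have "conj_by (x_gen i j r) (x_gen n m (v m)) = x_gen n m (v m)"
      using Suc False by (intro conj_by_x_gen_disjoint) auto
    then show ?thesis using e False Suc c by (auto simp: St.m_assoc)
  qed
qed auto

definition bounded_word :: "nat \<Rightarrow> (nat \<times> nat \<times> 'a) word \<Rightarrow> bool" where
  "bounded_word n w \<longleftrightarrow> (\<forall>((i, j, r), b)\<in>set w. i < n \<and> j < n)"

text \<open>A word has finitely many indices, so a fresh index n always exists; this is where the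
  unbounded index range of the stable group enters.\<close>

lemma ex_bounded_word: "\<exists>n>k. bounded_word n w"
proof (induction w)
  case Nil
  show ?case by (auto simp: bounded_word_def)
next
  case (Cons l w)
  obtain i j r b where l: "l = ((i, j, r), b)" by (metis prod.exhaust)
  from Cons obtain n where n: "n > k" "bounded_word n w" by blast
  hence "bounded_word (max n (Suc (max i j))) (l # w)"
    by (fastforce simp: bounded_word_def l)
  with n(1) show ?case by (meson less_max_iff_disj)
qed

lemma cls_Cons:
  assumes "i \<noteq> j" "r \<in> carrier R" "w \<in> st_words"
  shows "cls (((i, j, r), b) # w) = x_gen i j (if b then r else \<ominus> r) \<bullet>\<^sub>S cls w"
proof -
  have "cls (((i, j, r), b) # w) = cls [((i, j, r), b)] \<bullet>\<^sub>S cls w"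
    using assms by (subst cls_mult) (auto simp: gens_iff)
  also have "cls [((i, j, r), b)] = x_gen i j (if b then r else \<ominus> r)"
    using assms cls_inv[of i j r] x_gen_inv[of i j r] by (cases b) (auto simp: x_gen_def)
  finally show ?thesis .
qed

lemma conj_by_cls_col:
  assumes "w \<in> st_words" "bounded_word n w" "M \<in> mats"
  shows "conj_by (cls w) (st_col n n (\<lambda>k. M k c)) = st_col n n (\<lambda>k. st_act w M k c)"
  using assms
proof (induction w rule: list.induct)
  case Nil
  have "st_col n n (\<lambda>k. M k c) \<in> carrier St" using Nil by (intro col_closed) (auto simp: mats_def)
  thus ?case by (simp add: cls_Nil conj_by_def)
next
  case (Cons l w)
  obtain i j r b where l: "l = ((i, j, r), b)" by (metis prod.exhaust)
  define s where "s = (if b then r else \<ominus> r)"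
  have ij: "i \<noteq> j" "i < n" "j < n" "r \<in> carrier R" "s \<in> carrier R" and w: "w \<in> st_words" "bounded_word n w"
    using Cons.prems by (auto simp: l gens_iff bounded_word_def s_def)
  have clo: "st_col n n (\<lambda>k. M k c) \<in> carrier St"
    using assms(3) by (intro col_closed) (auto simp: mats_def)
  have A: "st_act w M \<in> mats" by (rule st_act_mats[OF w(1) assms(3)])
  have "conj_by (cls (l # w)) (st_col n n (\<lambda>k. M k c)) = conj_by (x_gen i j s) (conj_by (cls w) (st_col n n (\<lambda>k. M k c)))"
    unfolding l cls_Cons[OF ij(1,4) w(1), of b, folded s_def]
    by (rule conj_by_conj_by) (use ij cls_closed[OF w(1)] clo in auto)
  also have "\<dots> = conj_by (x_gen i j s) (st_col n n (\<lambda>k. st_act w M k c))"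
    using Cons w by simp
  also have "\<dots> = x_gen i n (s \<otimes> st_act w M j c) \<bullet>\<^sub>S st_col n n (\<lambda>k. st_act w M k c)"
    using ij A by (subst conj_by_col) (auto simp: mats_def)
  also have "\<dots> = st_col n n ((\<lambda>k. st_act w M k c)(i := st_act w M i c \<oplus> s \<otimes> st_act w M j c))"
    using ij A by (subst col_upd) (auto simp: mats_def)
  also have "\<dots> = st_col n n (\<lambda>k. st_act (l # w) M k c)"
    by (intro vec_cong) (auto simp: l s_def elem_mult_def)
  finally show ?case .
qed

text \<open>The row vector v times the matrix of w. Multiplication from the right consumes the word
  from its first letter, so that \<open>conj_by_cls_row\<close> can be stated without an inverse
  word.\<close>

primrec vec_act :: "(nat \<times> nat \<times> 'a) word \<Rightarrow> (nat \<Rightarrow> 'a) \<Rightarrow> nat \<Rightarrow> 'a" where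
  "vec_act [] v = v"
| "vec_act (l # w) v = (case l of ((i, j, r), b) \<Rightarrow>
     vec_act w (v(j := v j \<oplus> v i \<otimes> (if b then r else \<ominus> r))))"

lemma vec_act_closed:
  assumes "w \<in> st_words" "\<And>k. v k \<in> carrier R" shows "vec_act w v k \<in> carrier R"
  using assms
proof (induction w arbitrary: v rule: list.induct)
  case (Cons l w)
  obtain i j r b where l: "l = ((i, j, r), b)" by (metis prod.exhaust)
  have "v j \<oplus> v i \<otimes> (if b then r else \<ominus> r) \<in> carrier R"
    using Cons.prems by (intro a_closed m_closed) (auto simp: l gens_iff)
  then show ?case using Cons.prems unfolding l by (auto intro!: Cons.IH simp: gens_iff)
qed auto

lemma conj_by_cls_row:
  assumes "w \<in> st_words" "bounded_word n w" "\<And>k. v k \<in> carrier R"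
  shows "st_row n n v \<bullet>\<^sub>S cls w = cls w \<bullet>\<^sub>S st_row n n (vec_act w v)"
  using assms
proof (induction w arbitrary: v rule: list.induct)
  case Nil
  have "st_row n n v \<in> carrier St" using Nil by (intro row_closed) auto
  thus ?case by (simp add: cls_Nil)
next
  case (Cons l w)
  obtain i j r b where l: "l = ((i, j, r), b)" by (metis prod.exhaust)
  define s where "s = (if b then r else \<ominus> r)"
  define v' where "v' = v(j := v j \<oplus> v i \<otimes> s)"
  have ij: "i \<noteq> j" "i < n" "j < n" "r \<in> carrier R" "s \<in> carrier R" and w: "w \<in> st_words" "bounded_word n w"
    using Cons.prems by (auto simp: l gens_iff bounded_word_def s_def)
  have v: "v k \<in> carrier R" for k using Cons.prems by auto
  have v': "v' k \<in> carrier R" for k using v ij by (auto simp: v'_def)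
  have r: "st_row n n u \<in> carrier St" if "\<And>k. u k \<in> carrier R" for u using that by (intro row_closed) auto
  have "conj_by (x_gen i j s) (st_row n n v') = x_gen n j (\<ominus> (v' i \<otimes> s)) \<bullet>\<^sub>S st_row n n v'"
    using ij v' by (subst conj_by_row) auto
  also have "\<dots> = st_row n n (v'(j := v' j \<oplus> \<ominus> (v' i \<otimes> s)))"
    using ij v' by (subst row_upd) auto
  also have "v'(j := v' j \<oplus> \<ominus> (v' i \<otimes> s)) = v"
    using ij v by (auto simp: v'_def a_assoc r_neg)
  finally have *: "st_row n n v \<bullet>\<^sub>S x_gen i j s = x_gen i j s \<bullet>\<^sub>S st_row n n v'"
    using conj_by_swap[of "x_gen i j s" "st_row n n v'"] ij r[of v', OF v'] by simp
  have va: "vec_act w v' k \<in> carrier R" for k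
    by (rule vec_act_closed[of w v', OF w(1) v'])
  have "st_row n n v \<bullet>\<^sub>S cls (l # w) = st_row n n v \<bullet>\<^sub>S (x_gen i j s \<bullet>\<^sub>S cls w)"
    unfolding l s_def using ij w by (subst cls_Cons) auto
  also have "\<dots> = x_gen i j s \<bullet>\<^sub>S (st_row n n v' \<bullet>\<^sub>S cls w)"
    using * ij w r[of v, OF v] r[of v', OF v'] cls_closed[OF w(1)]
    by (simp add: St.m_assoc[symmetric])
  also have "\<dots> = x_gen i j s \<bullet>\<^sub>S (cls w \<bullet>\<^sub>S st_row n n (vec_act w v'))"
    using Cons.IH[of v', OF w v'] by simp
  also have "\<dots> = (x_gen i j s \<bullet>\<^sub>S cls w) \<bullet>\<^sub>S st_row n n (vec_act w v')"
    using ij cls_closed[OF w(1)] r[of "vec_act w v'", OF va] by (simp add: St.m_assoc)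
  also have "x_gen i j s \<bullet>\<^sub>S cls w = cls (l # w)"
    unfolding l s_def using ij w by (subst cls_Cons) auto
  also have "vec_act w v' = vec_act (l # w) v" by (simp add: l v'_def s_def)
  finally show ?case .
qed

text \<open>Associativity (v w) M = v (w M), read in column c. With M the unit matrix it recovers
  \<open>vec_act w v\<close> from the matrix of w.\<close>

lemma vec_act_eq:
  assumes "w \<in> st_words" "bounded_word n w" "M \<in> mats" "\<And>k. v k \<in> carrier R"
  shows "(\<Oplus>k\<in>{..<n}. vec_act w v k \<otimes> M k c) = (\<Oplus>k\<in>{..<n}. v k \<otimes> st_act w M k c)"
  using assms
proof (induction w arbitrary: v rule: list.induct)
  case (Cons l w)
  obtain i j r b where l: "l = ((i, j, r), b)" by (metis prod.exhaust)
  define s where "s = (if b then r else \<ominus> r)"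
  define v' where "v' = v(j := v j \<oplus> v i \<otimes> s)"
  have ij: "i \<noteq> j" "i < n" "j < n" "r \<in> carrier R" "s \<in> carrier R" and w: "w \<in> st_words" "bounded_word n w"
    using Cons.prems by (auto simp: l gens_iff bounded_word_def s_def)
  have v: "v k \<in> carrier R" for k using Cons.prems by auto
  have v': "v' k \<in> carrier R" for k using v ij by (auto simp: v'_def)
  define A where "A = st_act w M"
  have A: "A k c \<in> carrier R" for k c
    using st_act_mats[OF w(1) assms(3)] by (auto simp: mats_def A_def)
  have "(\<Oplus>k\<in>{..<n}. vec_act (l # w) v k \<otimes> M k c) = (\<Oplus>k\<in>{..<n}. v' k \<otimes> A k c)"
  proof -
    have "vec_act (l # w) v = vec_act w v'" by (simp add: l v'_def s_def)
    thus ?thesis using Cons.IH[of v', OF w assms(3) v'] by (simp add: A_def)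
  qed
  also have "\<dots> = (\<Oplus>k\<in>{..<n}. v k \<otimes> A k c \<oplus> (if j = k then v i \<otimes> s \<otimes> A j c else \<zero>))"
    using v A ij by (intro finsum_cong') (auto simp: v'_def l_distr)
  also have "\<dots> = (\<Oplus>k\<in>{..<n}. v k \<otimes> A k c) \<oplus> v i \<otimes> s \<otimes> A j c"
    using v A ij finsum_singleton[of j "{..<n}" "\<lambda>_. v i \<otimes> s \<otimes> A j c"] by (subst finsum_addf) auto
  also have "\<dots> = (\<Oplus>k\<in>{..<n}. v k \<otimes> A k c) \<oplus> (\<Oplus>k\<in>{..<n}. if i = k then v i \<otimes> (s \<otimes> A j c) else \<zero>)"
    using v A ij finsum_singleton[of i "{..<n}" "\<lambda>_. v i \<otimes> (s \<otimes> A j c)"] by (simp add: m_assoc)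
  also have "\<dots> = (\<Oplus>k\<in>{..<n}. v k \<otimes> A k c \<oplus> (if i = k then v i \<otimes> (s \<otimes> A j c) else \<zero>))"
    using v A ij by (subst finsum_addf) auto
  also have "\<dots> = (\<Oplus>k\<in>{..<n}. v k \<otimes> st_act (l # w) M k c)"
    using v A ij by (intro finsum_cong') (auto simp: l s_def elem_mult_def A_def[symmetric] r_distr)
  finally show ?case .
qed auto


lemma kernel_central:
  assumes w: "w \<in> st_words" "steinberg_matrix R w = unit_matrix R" and g: "g \<in> carrier St"
  shows "cls w \<bullet>\<^sub>S g = g \<bullet>\<^sub>S cls w"
proof -
  have cw: "cls w \<in> carrier St" by (rule cls_closed[OF w(1)])
  have act: "st_act w (unit_matrix R) = unit_matrix R"
    using w(2) by (simp add: steinberg_matrix_eq)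
  have col: "st_col n m (\<lambda>k. unit_matrix R k c \<otimes> s) = (if c < m then x_gen c n s else \<one>\<^bsub>St\<^esub>)"
    if "m \<le> n" "c < n" "s \<in> carrier R" for n m c s
    using that by (induction m) (auto simp: unit_matrix_def less_Suc_eq)
  have row: "st_row n m (\<lambda>k. s \<otimes> unit_matrix R k c) = (if c < m then x_gen n c s else \<one>\<^bsub>St\<^esub>)"
    if "m \<le> n" "c < n" "s \<in> carrier R" for n m c s
    using that by (induction m) (auto simp: unit_matrix_def less_Suc_eq)
  have 1: "cls w \<bullet>\<^sub>S x_gen c n s = x_gen c n s \<bullet>\<^sub>S cls w"
    if n: "bounded_word n w" "c < n" and s: "s \<in> carrier R" for n c s
  proof -
    \<comment> \<open>Column c of the scaled unit matrix encodes the single generator x_cn(s). Row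
      operations commute with scaling on the right, so w fixes this matrix as well.\<close>
    define M where "M = (\<lambda>k c. unit_matrix R k c \<otimes> s)"
    have M: "M \<in> mats" using s by (auto simp: M_def mats_def unit_matrix_def)
    have *: "st_act w (\<lambda>k c. A k c \<otimes> s) = (\<lambda>k c. st_act w A k c \<otimes> s)" if "A \<in> mats" for A
      using w(1)
    proof (induction w rule: list.induct)
      case (Cons l w)
      obtain i j r b where l: "l = ((i, j, r), b)" by (metis prod.exhaust)
      have A: "st_act w A i j \<in> carrier R" for i j
        using st_act_mats[of w A] Cons.prems that by (auto simp: mats_def)
      show ?case using Cons s A by (auto simp: l elem_mult_def gens_iff fun_eq_iff l_distr m_assoc)
    qed auto
    have "conj_by (cls w) (st_col n n (\<lambda>k. M k c)) = st_col n n (\<lambda>k. M k c)"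
      using conj_by_cls_col[OF w(1) n(1) M, of c] *[OF unit_matrix_mats] by (simp add: M_def act)
    hence "conj_by (cls w) (x_gen c n s) = x_gen c n s"
      using col[of n n c s] n s by (simp add: M_def)
    thus ?thesis using conj_by_swap[of "cls w" "x_gen c n s"] cw n s by simp
  qed
  have 2: "cls w \<bullet>\<^sub>S x_gen n c s = x_gen n c s \<bullet>\<^sub>S cls w"
    if n: "bounded_word n w" "c < n" and s: "s \<in> carrier R" for n c s
  proof -
    define v where "v = (\<lambda>k. s \<otimes> unit_matrix R k c)"
    have v: "v k \<in> carrier R" for k using s by (auto simp: v_def unit_matrix_def)
    have fin: "(\<Oplus>k\<in>{..<n}. u k \<otimes> unit_matrix R k d) = u d"
      if "d < n" "\<And>k. k < n \<Longrightarrow> u k \<in> carrier R" for u d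
    proof -
      have "(\<Oplus>k\<in>{..<n}. u k \<otimes> unit_matrix R k d) = (\<Oplus>k\<in>{..<n}. if d = k then u k else \<zero>)"
        using that by (intro finsum_cong') (auto simp: unit_matrix_def)
      thus ?thesis using that by (simp add: finsum_singleton)
    qed
    have va: "vec_act w v k \<in> carrier R" for k
      using vec_act_closed[of w v, OF w(1) v] .
    have "vec_act w v d = v d" if "d < n" for d
      using vec_act_eq[of w n "unit_matrix R" v d, OF w(1) n(1) unit_matrix_mats v] that v va
      by (simp add: act fin)
    hence "st_row n n (vec_act w v) = st_row n n v" by (intro vec_cong) auto
    moreover have "st_row n n v = x_gen n c s" using row[of n n c s] n s by (simp add: v_def)
    ultimately show ?thesis using conj_by_cls_row[of w n v, OF w(1) n(1) v] by simp
  qed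
  \<comment> \<open>Any generator is the commutator of x_in(s) and x_nj(1) for a fresh n, and
    \<open>cls w\<close> commutes with both.\<close>
  have 3: "cls w \<bullet>\<^sub>S x_gen i j s = x_gen i j s \<bullet>\<^sub>S cls w" if "i \<noteq> j" "s \<in> carrier R" for i j s
  proof -
    obtain n where n: "n > max i j" "bounded_word n w" using ex_bounded_word by blast
    define a b where "a = x_gen i n s" and "b = x_gen n j \<one>"
    have ab: "a \<in> carrier St" "b \<in> carrier St" using n that by (auto simp: a_def b_def)
    have "conj_by (cls w) a = a" "conj_by (cls w) b = b"
      using 1[of n i s] 2[of n j \<one>] n that ab cw
      by (auto simp: a_def b_def conj_by_def St.m_assoc)
    moreover have "x_gen i j s = a \<bullet>\<^sub>S b \<bullet>\<^sub>S st_inv a \<bullet>\<^sub>S st_inv b"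
      using x_gen_comm1[of i n j s \<one>] n that by (simp add: a_def b_def)
    ultimately have "conj_by (cls w) (x_gen i j s) = x_gen i j s"
      using ab cw by (simp add: conj_by_mult conj_by_inv)
    thus ?thesis using conj_by_swap[of "cls w" "x_gen i j s"] that cw by simp
  qed
  obtain u where u: "u \<in> st_words" "g = cls u" using g by (auto simp: carrier_St)
  have "cls w \<bullet>\<^sub>S cls u = cls u \<bullet>\<^sub>S cls w"
    using u(1)
  proof (induction u rule: list.induct)
    case Nil
    then show ?case using cw by (simp add: cls_Nil)
  next
    case (Cons l u)
    obtain i j r b where l: "l = ((i, j, r), b)" by (metis prod.exhaust)
    define s where "s = (if b then r else \<ominus> r)"
    have ij: "i \<noteq> j" "r \<in> carrier R" "s \<in> carrier R" "u \<in> st_words"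
      using Cons.prems by (auto simp: l gens_iff s_def)
    have cu: "cls u \<in> carrier St" by (rule cls_closed[OF ij(4)])
    have "cls w \<bullet>\<^sub>S (x_gen i j s \<bullet>\<^sub>S cls u) = x_gen i j s \<bullet>\<^sub>S (cls w \<bullet>\<^sub>S cls u)"
      using 3[OF ij(1,3)] ij cw cu by (simp add: St.m_assoc[symmetric])
    also have "cls w \<bullet>\<^sub>S cls u = cls u \<bullet>\<^sub>S cls w" by (rule Cons.IH[OF ij(4)])
    finally show ?case
      unfolding l cls_Cons[OF ij(1,2,4), of b, folded s_def] using ij cw cu by (simp add: St.m_assoc)
  qed
  thus ?thesis by (simp add: u)
qed

end

section \<open>Milnor symbols\<close>

context steinberg begin

definition w_elt where "w_elt i j u = x_gen i j u \<bullet>\<^sub>S x_gen j i (\<ominus> (inv u)) \<bullet>\<^sub>S x_gen i j u"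

lemma unit_facts:
  assumes "u \<in> Units R"
  shows "u \<in> carrier R" "inv u \<in> carrier R" "u \<otimes> inv u = \<one>" "inv u \<otimes> u = \<one>"
  using assms by auto

lemma unit_cancel:
  assumes "u \<in> Units R" "r \<in> carrier R"
  shows "u \<otimes> (inv u \<otimes> r) = r" "inv u \<otimes> (u \<otimes> r) = r" "r \<otimes> u \<otimes> inv u = r" "r \<otimes> inv u \<otimes> u = r"
  using assms unit_facts[OF assms(1)] by (auto simp: m_assoc[symmetric]) (auto simp: m_assoc)

lemma Units_uminus: "u \<in> Units R \<Longrightarrow> \<ominus> u \<in> Units R"
  by (metis Units_closed Units_minus_one_closed Units_m_closed l_minus l_one one_closed)

lemma inv_uminus: "u \<in> Units R \<Longrightarrow> inv (\<ominus> u) = \<ominus> (inv u)"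
  using unit_facts[of u] Units_uminus[of u]
  by (intro comm_inv_char) (auto simp: l_minus r_minus)

lemma inv_mult_units:
  assumes "u \<in> Units R" "v \<in> Units R" shows "inv (u \<otimes> v) = inv v \<otimes> inv u"
proof (rule comm_inv_char)
  show "u \<otimes> v \<otimes> (inv v \<otimes> inv u) = \<one>"
    using assms unit_facts[of u] unit_facts[of v] unit_cancel[of v "inv u"] by (simp add: m_assoc)
qed (use assms in auto)

lemma w_elt_closed [simp]: "i \<noteq> j \<Longrightarrow> u \<in> Units R \<Longrightarrow> w_elt i j u \<in> carrier St"
  using unit_facts[of u] by (simp add: w_elt_def)

lemma w_elt_inv:
  assumes "i \<noteq> j" "u \<in> Units R" shows "st_inv (w_elt i j u) = w_elt i j (\<ominus> u)"
  using assms unit_facts[of u] Units_uminus[of u]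
  by (simp add: w_elt_def St.inv_mult_group x_gen_inv inv_uminus St.m_assoc)

lemma conj_by_x_gen_split:
  assumes "i \<noteq> j" "u \<in> Units R" "a \<in> carrier St"
  shows "conj_by (w_elt i j u) a = conj_by (x_gen i j u) (conj_by (x_gen j i (\<ominus> (inv u))) (conj_by (x_gen i j u) a))"
  using assms unit_facts[of u] by (simp add: w_elt_def conj_by_conj_by)

text \<open>w_ij(u) lies over the monomial matrix with u at (i,j) and -u^-1 at (j,i), so conjugation
  by it permutes the generators up to scaling. With a third index k this is a computation with the
  three factors of w_ij(u), after which all but one generator cancel.\<close>

lemma conj_by_w_elt_ik:
  assumes "i \<noteq> j" "k \<noteq> i" "k \<noteq> j" "u \<in> Units R" "r \<in> carrier R"
  shows "conj_by (w_elt i j u) (x_gen i k r) = x_gen j k (\<ominus> (inv u \<otimes> r))"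
proof -
  note u = unit_facts[OF assms(4)]
  have "conj_by (w_elt i j u) (x_gen i k r) = conj_by (x_gen i j u) (x_gen j k (\<ominus> (inv u) \<otimes> r) \<bullet>\<^sub>S x_gen i k r)"
    using assms u by (simp add: conj_by_x_gen_split conj_by_x_gen_disjoint conj_by_x_gen_left)
  also have "\<dots> = x_gen i k (u \<otimes> (\<ominus> (inv u) \<otimes> r)) \<bullet>\<^sub>S x_gen j k (\<ominus> (inv u) \<otimes> r) \<bullet>\<^sub>S x_gen i k r"
    using assms u by (simp add: conj_by_mult conj_by_x_gen_disjoint conj_by_x_gen_left)
  also have "u \<otimes> (\<ominus> (inv u) \<otimes> r) = \<ominus> r"
    using assms u unit_cancel[OF assms(4,5)] by (simp add: l_minus r_minus)
  also have "x_gen i k (\<ominus> r) \<bullet>\<^sub>S x_gen j k (\<ominus> (inv u) \<otimes> r) = x_gen j k (\<ominus> (inv u) \<otimes> r) \<bullet>\<^sub>S x_gen i k (\<ominus> r)"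
    using assms u by (intro x_gen_commute) auto
  finally show ?thesis using assms u by (simp add: St.m_assoc x_gen_add l_neg l_minus)
qed

lemma conj_by_w_elt_jk:
  assumes "i \<noteq> j" "k \<noteq> i" "k \<noteq> j" "u \<in> Units R" "r \<in> carrier R"
  shows "conj_by (w_elt i j u) (x_gen j k r) = x_gen i k (u \<otimes> r)"
proof -
  note u = unit_facts[OF assms(4)]
  have "conj_by (w_elt i j u) (x_gen j k r) =
      conj_by (x_gen i j u) (conj_by (x_gen j i (\<ominus> (inv u))) (x_gen i k (u \<otimes> r) \<bullet>\<^sub>S x_gen j k r))"
    using assms u by (simp add: conj_by_x_gen_split conj_by_x_gen_left)
  also have "conj_by (x_gen j i (\<ominus> (inv u))) (x_gen i k (u \<otimes> r) \<bullet>\<^sub>S x_gen j k r) =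
       x_gen j k (\<ominus> (inv u) \<otimes> (u \<otimes> r)) \<bullet>\<^sub>S x_gen i k (u \<otimes> r) \<bullet>\<^sub>S x_gen j k r"
    using assms u by (simp add: conj_by_mult conj_by_x_gen_disjoint conj_by_x_gen_left)
  also have "\<ominus> (inv u) \<otimes> (u \<otimes> r) = \<ominus> r"
    using assms u unit_cancel[OF assms(4,5)] by (simp add: l_minus r_minus)
  also have "x_gen j k (\<ominus> r) \<bullet>\<^sub>S x_gen i k (u \<otimes> r) = x_gen i k (u \<otimes> r) \<bullet>\<^sub>S x_gen j k (\<ominus> r)"
    using assms u by (intro x_gen_commute) auto
  finally show ?thesis
    using assms u by (simp add: St.m_assoc x_gen_add l_neg conj_by_x_gen_disjoint)
qed

lemma conj_by_w_elt_ki: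
  assumes "i \<noteq> j" "k \<noteq> i" "k \<noteq> j" "u \<in> Units R" "r \<in> carrier R"
  shows "conj_by (w_elt i j u) (x_gen k i r) = x_gen k j (\<ominus> (r \<otimes> u))"
proof -
  note u = unit_facts[OF assms(4)]
  have "conj_by (w_elt i j u) (x_gen k i r) =
      conj_by (x_gen i j u) (conj_by (x_gen j i (\<ominus> (inv u))) (x_gen k j (\<ominus> (r \<otimes> u)) \<bullet>\<^sub>S x_gen k i r))"
    using assms u by (simp add: conj_by_x_gen_split conj_by_x_gen_right)
  also have "conj_by (x_gen j i (\<ominus> (inv u))) (x_gen k j (\<ominus> (r \<otimes> u)) \<bullet>\<^sub>S x_gen k i r) =
       x_gen k i (\<ominus> (\<ominus> (r \<otimes> u) \<otimes> \<ominus> (inv u))) \<bullet>\<^sub>S x_gen k j (\<ominus> (r \<otimes> u)) \<bullet>\<^sub>S x_gen k i r"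
    using assms u by (simp add: conj_by_mult conj_by_x_gen_disjoint conj_by_x_gen_right)
  also have "\<ominus> (\<ominus> (r \<otimes> u) \<otimes> \<ominus> (inv u)) = \<ominus> r"
    using assms u unit_cancel[OF assms(4,5)] by (simp add: l_minus r_minus)
  also have "x_gen k i (\<ominus> r) \<bullet>\<^sub>S x_gen k j (\<ominus> (r \<otimes> u)) = x_gen k j (\<ominus> (r \<otimes> u)) \<bullet>\<^sub>S x_gen k i (\<ominus> r)"
    using assms u by (intro x_gen_commute) auto
  finally show ?thesis
    using assms u by (simp add: St.m_assoc x_gen_add l_neg conj_by_x_gen_disjoint)
qed

lemma conj_by_w_elt_kj:
  assumes "i \<noteq> j" "k \<noteq> i" "k \<noteq> j" "u \<in> Units R" "r \<in> carrier R"
  shows "conj_by (w_elt i j u) (x_gen k j r) = x_gen k i (r \<otimes> inv u)"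
proof -
  note u = unit_facts[OF assms(4)]
  have "conj_by (w_elt i j u) (x_gen k j r) = conj_by (x_gen i j u) (x_gen k i (\<ominus> (r \<otimes> \<ominus> (inv u))) \<bullet>\<^sub>S x_gen k j r)"
    using assms u by (simp add: conj_by_x_gen_split conj_by_x_gen_disjoint conj_by_x_gen_right)
  also have "\<dots> = x_gen k j (\<ominus> ((\<ominus> (r \<otimes> \<ominus> (inv u))) \<otimes> u)) \<bullet>\<^sub>S x_gen k i (r \<otimes> inv u) \<bullet>\<^sub>S x_gen k j r"
    using assms u by (simp add: conj_by_mult conj_by_x_gen_disjoint conj_by_x_gen_right r_minus)
  also have "\<ominus> ((\<ominus> (r \<otimes> \<ominus> (inv u))) \<otimes> u) = \<ominus> r"
    using assms u unit_cancel[OF assms(4,5)] by (simp add: l_minus r_minus)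
  also have "x_gen k j (\<ominus> r) \<bullet>\<^sub>S x_gen k i (r \<otimes> inv u) = x_gen k i (r \<otimes> inv u) \<bullet>\<^sub>S x_gen k j (\<ominus> r)"
    using assms u by (intro x_gen_commute) auto
  finally show ?thesis using assms u by (simp add: St.m_assoc x_gen_add l_neg)
qed

lemma ex_other_index: "\<exists>k::nat. k \<noteq> i \<and> k \<noteq> j"
  by (rule exI[of _ "Suc (max i j)"]) auto

lemma conj_by_comm:
  assumes "g \<in> carrier St" "a \<in> carrier St" "b \<in> carrier St"
  shows "conj_by g (a \<bullet>\<^sub>S b \<bullet>\<^sub>S st_inv a \<bullet>\<^sub>S st_inv b) =
     conj_by g a \<bullet>\<^sub>S conj_by g b \<bullet>\<^sub>S st_inv (conj_by g a) \<bullet>\<^sub>S st_inv (conj_by g b)"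
  using assms by (simp add: conj_by_mult conj_by_inv)

text \<open>No relation describes x_ij and x_ji together, so x_ij(r) is written as a commutator
  through a third index k, to which the previous cases apply.\<close>

lemma conj_by_w_elt_ij:
  assumes "i \<noteq> j" "u \<in> Units R" "r \<in> carrier R"
  shows "conj_by (w_elt i j u) (x_gen i j r) = x_gen j i (\<ominus> (inv u \<otimes> r \<otimes> inv u))"
proof -
  note u = unit_facts[OF assms(2)]
  obtain k where k: "k \<noteq> i" "k \<noteq> j" using ex_other_index by blast
  have "x_gen i j r = x_gen i k r \<bullet>\<^sub>S x_gen k j \<one> \<bullet>\<^sub>S st_inv (x_gen i k r) \<bullet>\<^sub>S st_inv (x_gen k j \<one>)"
    using x_gen_comm1[of i k j r \<one>] assms k by simp
  hence "conj_by (w_elt i j u) (x_gen i j r) = x_gen j k (\<ominus> (inv u \<otimes> r)) \<bullet>\<^sub>S x_gen k i (inv u) \<bullet>\<^sub>S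
      st_inv (x_gen j k (\<ominus> (inv u \<otimes> r))) \<bullet>\<^sub>S st_inv (x_gen k i (inv u))"
    using assms k u by (simp add: conj_by_comm conj_by_w_elt_ik conj_by_w_elt_kj)
  also have "\<dots> = x_gen j i (\<ominus> (inv u \<otimes> r \<otimes> inv u))"
    using assms k u by (subst x_gen_comm1) (auto simp: l_minus)
  finally show ?thesis .
qed

lemma conj_by_w_elt_ji:
  assumes "i \<noteq> j" "u \<in> Units R" "r \<in> carrier R"
  shows "conj_by (w_elt i j u) (x_gen j i r) = x_gen i j (\<ominus> (u \<otimes> r \<otimes> u))"
proof -
  note u = unit_facts[OF assms(2)]
  obtain k where k: "k \<noteq> i" "k \<noteq> j" using ex_other_index by blast
  have "x_gen j i r = x_gen j k r \<bullet>\<^sub>S x_gen k i \<one> \<bullet>\<^sub>S st_inv (x_gen j k r) \<bullet>\<^sub>S st_inv (x_gen k i \<one>)"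
    using x_gen_comm1[of j k i r \<one>] assms k by simp
  hence "conj_by (w_elt i j u) (x_gen j i r) = x_gen i k (u \<otimes> r) \<bullet>\<^sub>S x_gen k j (\<ominus> u) \<bullet>\<^sub>S
      st_inv (x_gen i k (u \<otimes> r)) \<bullet>\<^sub>S st_inv (x_gen k j (\<ominus> u))"
    using assms k u by (simp add: conj_by_comm conj_by_w_elt_jk conj_by_w_elt_ki)
  also have "\<dots> = x_gen i j (\<ominus> (u \<otimes> r \<otimes> u))"
    using assms k u by (subst x_gen_comm1) (auto simp: r_minus)
  finally show ?thesis .
qed

text \<open>Conjugating x_ij(u) gives w x_ij(u) = x_ji(-u^-1) w for w = w_ij(u). Expanding w on the
  right-hand side and cancelling the final x_ij(u) leaves the product that defines
  w_ji(-u^-1).\<close>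

lemma w_elt_swap:
  assumes "i \<noteq> j" "u \<in> Units R"
  shows "w_elt i j u = w_elt j i (\<ominus> (inv u))"
proof -
  note u = unit_facts[OF assms(2)]
  have "inv (\<ominus> (inv u)) = \<ominus> u"
    using assms by (simp add: inv_uminus)
  hence w: "w_elt j i (\<ominus> (inv u)) = x_gen j i (\<ominus> (inv u)) \<bullet>\<^sub>S x_gen i j u \<bullet>\<^sub>S x_gen j i (\<ominus> (inv u))"
    using u by (simp add: w_elt_def)
  have "conj_by (w_elt i j u) (x_gen i j u) = x_gen j i (\<ominus> (inv u))"
    using assms u by (simp add: conj_by_w_elt_ij)
  hence "x_gen j i (\<ominus> (inv u)) \<bullet>\<^sub>S w_elt i j u = w_elt i j u \<bullet>\<^sub>S x_gen i j u"
    using conj_by_swap[of "w_elt i j u" "x_gen i j u"] assms u by simp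
  hence "x_gen j i (\<ominus> (inv u)) \<bullet>\<^sub>S x_gen i j u \<bullet>\<^sub>S x_gen j i (\<ominus> (inv u)) \<bullet>\<^sub>S x_gen i j u = w_elt i j u \<bullet>\<^sub>S x_gen i j u"
    using assms u by (simp add: w_elt_def St.m_assoc)
  thus ?thesis using assms u by (simp add: w[symmetric] Units_uminus)
qed

definition h_elt where "h_elt i j u = w_elt i j u \<bullet>\<^sub>S w_elt i j (\<ominus> \<one>)"

lemma h_elt_closed [simp]: "i \<noteq> j \<Longrightarrow> u \<in> Units R \<Longrightarrow> h_elt i j u \<in> carrier St"
  by (simp add: h_elt_def Units_uminus)

text \<open>h_ij(u) lies over the diagonal matrix with u at i and u^-1 at j, hence it scales x_ik by
  u and x_ki by u^-1.\<close>

lemma conj_by_h_elt_w_elt: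
  assumes "distinct [i, j, k]" "u \<in> Units R" "v \<in> Units R"
  shows "conj_by (h_elt i j u) (w_elt i k v) = w_elt i k (u \<otimes> v)"
proof -
  note u = unit_facts[OF assms(2)] and v = unit_facts[OF assms(3)]
  have m1: "\<ominus> \<one> \<in> Units R" by (simp add: Units_uminus)
  have im1: "inv (\<ominus> \<one>) = \<ominus> \<one>" by (simp add: inv_uminus)
  have ij: "i \<noteq> j" "i \<noteq> k" "k \<noteq> i" "k \<noteq> j" using assms by auto
  have "conj_by (h_elt i j u) (x_gen i k r) = x_gen i k (u \<otimes> r)" if "r \<in> carrier R" for r
    using that ij m1 assms u by (simp add: h_elt_def conj_by_conj_by conj_by_w_elt_ik conj_by_w_elt_jk im1 l_minus)
  moreover have "conj_by (h_elt i j u) (x_gen k i r) = x_gen k i (r \<otimes> inv u)" if "r \<in> carrier R" for r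
    using that ij m1 assms u by (simp add: h_elt_def conj_by_conj_by conj_by_w_elt_ki conj_by_w_elt_kj r_minus)
  moreover have "inv (u \<otimes> v) = inv v \<otimes> inv u"
    using assms by (simp add: inv_mult_units m_comm)
  ultimately show ?thesis
    using assms ij u v by (simp add: w_elt_def conj_by_mult l_minus)
qed

text \<open>Consequently {u, v} = h(uv) h(u)^-1 h(v)^-1: a symbol measures the failure of h to be
  multiplicative, and the vanishing results for symbols are proved in this form.\<close>

lemma conj_by_h_elt_h_elt:
  assumes "distinct [i, j, k]" "u \<in> Units R" "v \<in> Units R"
  shows "conj_by (h_elt i j u) (h_elt i k v) = h_elt i k (u \<otimes> v) \<bullet>\<^sub>S st_inv (h_elt i k u)"
proof -
  have m1: "\<ominus> \<one> \<in> Units R" by (simp add: Units_uminus)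
  have ij: "i \<noteq> j" "i \<noteq> k" using assms by auto
  have "conj_by (h_elt i j u) (h_elt i k v) = w_elt i k (u \<otimes> v) \<bullet>\<^sub>S w_elt i k (\<ominus> u)"
    unfolding h_elt_def[of i k v] using assms ij m1
    by (simp add: conj_by_mult conj_by_h_elt_w_elt r_minus Units_closed)
  also have "\<dots> = h_elt i k (u \<otimes> v) \<bullet>\<^sub>S st_inv (h_elt i k u)"
    using assms ij m1 unfolding h_elt_def
    by (simp add: St.inv_mult_group w_elt_inv St.m_assoc Units_uminus)
       (simp add: w_elt_inv[symmetric] Units_uminus)
  finally show ?thesis .
qed

lemma w_elt_steinberg_relation:
  assumes "i \<noteq> j" "u \<in> Units R" "v \<in> Units R" "u \<oplus> v = \<one>"
  shows "h_elt i j u \<bullet>\<^sub>S h_elt i j v = h_elt i j (u \<otimes> v)"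
proof -
  note u = unit_facts[OF assms(2)] and v = unit_facts[OF assms(3)]
  have m1: "\<ominus> \<one> \<in> Units R" by (simp add: Units_uminus)
  have im1: "inv (\<ominus> \<one>) = \<ominus> \<one>" by (simp add: inv_uminus)
  \<comment> \<open>By \<open>w_elt_swap\<close> the element w_ij(-1) starts and ends with x_ji(1).
    Moving these two factors across w_ij(u) and w_ij(v) turns them into x_ij(-u^2) and x_ij(-v^2),
    and u + v = 1 makes neighbouring arguments add up to those of w_ij(uv).\<close>
  have w1: "w_elt i j (\<ominus> \<one>) = x_gen j i \<one> \<bullet>\<^sub>S x_gen i j (\<ominus> \<one>) \<bullet>\<^sub>S x_gen j i \<one>"
    using assms(1) m1 w_elt_swap[of i j "\<ominus> \<one>"] im1 by (simp add: w_elt_def)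
  have a: "w_elt i j u \<bullet>\<^sub>S x_gen j i \<one> = x_gen i j (\<ominus> (u \<otimes> u)) \<bullet>\<^sub>S w_elt i j u"
    using conj_by_w_elt_ji[of i j u \<one>] conj_by_swap[of "w_elt i j u" "x_gen j i \<one>"] assms u by simp
  have "conj_by (w_elt i j v) (x_gen i j (\<ominus> (v \<otimes> v))) = x_gen j i \<one>"
  proof -
    have "inv v \<otimes> (v \<otimes> v) \<otimes> inv v = \<one>"
      using v unit_cancel[OF assms(3), of v] by simp
    thus ?thesis using assms v by (simp add: conj_by_w_elt_ij r_minus l_minus)
  qed
  hence b: "x_gen j i \<one> \<bullet>\<^sub>S w_elt i j v = w_elt i j v \<bullet>\<^sub>S x_gen i j (\<ominus> (v \<otimes> v))"
    using conj_by_swap[of "w_elt i j v" "x_gen i j (\<ominus> (v \<otimes> v))"] assms v by simp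
  have uv: "u \<otimes> v \<in> Units R" using assms by simp
  have e1: "\<ominus> (u \<otimes> u) \<oplus> u = u \<otimes> v"
  proof -
    have "u = u \<otimes> (u \<oplus> v)" using assms u by simp
    hence "u = u \<otimes> u \<oplus> u \<otimes> v" using u v by (simp add: r_distr)
    thus ?thesis using u v by (metis m_closed r_neg1)
  qed
  have e2: "v \<oplus> \<ominus> (v \<otimes> v) = u \<otimes> v"
  proof -
    have "v = (u \<oplus> v) \<otimes> v" using assms v by simp
    hence "v = v \<otimes> v \<oplus> u \<otimes> v" using u v by (simp add: l_distr a_comm)
    thus ?thesis using u v by (metis m_closed r_neg1 a_comm a_inv_closed)
  qed
  have e3: "\<ominus> (inv u) \<oplus> \<ominus> (inv v) = \<ominus> (inv (u \<otimes> v))"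
  proof -
    have "inv (u \<otimes> v) = inv u \<otimes> inv v \<otimes> (u \<oplus> v)"
      using assms u v by (simp add: inv_mult_units m_comm)
    also have "\<dots> = inv u \<oplus> inv v"
      using u v unit_cancel[OF assms(2), of "inv v"] unit_cancel[OF assms(3), of "inv u"]
      by (simp add: r_distr a_comm m_comm[of "inv u" "inv v"])
    finally show ?thesis using u v by (simp add: minus_add)
  qed
  have e4: "u \<oplus> (\<ominus> \<one> \<oplus> v) = \<zero>"
    using u v assms(4) by (metis a_assoc a_comm a_inv_closed one_closed r_neg)
  have "w_elt i j u \<bullet>\<^sub>S w_elt i j (\<ominus> \<one>) \<bullet>\<^sub>S w_elt i j v =
      (w_elt i j u \<bullet>\<^sub>S x_gen j i \<one>) \<bullet>\<^sub>S x_gen i j (\<ominus> \<one>) \<bullet>\<^sub>S (x_gen j i \<one> \<bullet>\<^sub>S w_elt i j v)"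
    using assms u v by (simp add: w1 St.m_assoc)
  also have "\<dots> = (x_gen i j (\<ominus> (u \<otimes> u)) \<bullet>\<^sub>S x_gen i j u) \<bullet>\<^sub>S x_gen j i (\<ominus> (inv u)) \<bullet>\<^sub>S
      (x_gen i j u \<bullet>\<^sub>S (x_gen i j (\<ominus> \<one>) \<bullet>\<^sub>S x_gen i j v)) \<bullet>\<^sub>S x_gen j i (\<ominus> (inv v)) \<bullet>\<^sub>S (x_gen i j v \<bullet>\<^sub>S x_gen i j (\<ominus> (v \<otimes> v)))"
    unfolding a b using assms u v by (simp add: w_elt_def St.m_assoc)
  also have "\<dots> = x_gen i j (u \<otimes> v) \<bullet>\<^sub>S x_gen j i (\<ominus> (inv u)) \<bullet>\<^sub>S x_gen j i (\<ominus> (inv v)) \<bullet>\<^sub>S x_gen i j (u \<otimes> v)"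
    using assms u v by (simp add: x_gen_add e1 e2 e4)
  also have "\<dots> = w_elt i j (u \<otimes> v)"
    using assms u v by (simp add: w_elt_def St.m_assoc e3[symmetric] x_gen_add[symmetric])
  finally show ?thesis
    using assms m1 uv by (simp add: h_elt_def St.m_assoc[symmetric])
qed

text \<open>Since w(-u) = w(u)^-1, the product w(u) w(-1) w(-u) is a conjugate of w(-1), and the
  conjugation formulas evaluate it to w_ji(u^-2) = w_ij(-u^2).\<close>

lemma w_elt_minus_relation:
  assumes "i \<noteq> j" "u \<in> Units R"
  shows "h_elt i j (\<ominus> u) \<bullet>\<^sub>S h_elt i j u = h_elt i j (\<ominus> u \<otimes> u)" "h_elt i j u \<bullet>\<^sub>S h_elt i j (\<ominus> u) = h_elt i j (u \<otimes> \<ominus> u)"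
proof -
  have *: "h_elt i j u \<bullet>\<^sub>S h_elt i j (\<ominus> u) = h_elt i j (u \<otimes> \<ominus> u)" if u': "u \<in> Units R" for u
  proof -
    note u = unit_facts[OF u']
    have m1: "\<ominus> \<one> \<in> Units R" by (simp add: Units_uminus)
    have im1: "inv (\<ominus> \<one>) = \<ominus> \<one>" by (simp add: inv_uminus)
    have uu: "inv (u \<otimes> \<ominus> u) = \<ominus> (inv u \<otimes> inv u)" "u \<otimes> \<ominus> u \<in> Units R"
      using u' u by (auto simp: Units_uminus inv_mult_units inv_uminus l_minus)
    have "w_elt i j u \<bullet>\<^sub>S w_elt i j (\<ominus> \<one>) \<bullet>\<^sub>S w_elt i j (\<ominus> u) = conj_by (w_elt i j u) (w_elt i j (\<ominus> \<one>))"
      using assms u' by (simp add: conj_by_def w_elt_inv)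
    also have "\<dots> = x_gen j i (inv u \<otimes> inv u) \<bullet>\<^sub>S x_gen i j (\<ominus> (u \<otimes> u)) \<bullet>\<^sub>S x_gen j i (inv u \<otimes> inv u)"
      unfolding w_elt_def[of i j "\<ominus> \<one>"] using assms u u' m1
      by (simp add: conj_by_mult conj_by_w_elt_ij conj_by_w_elt_ji im1 l_minus r_minus)
    also have "\<dots> = w_elt j i (inv u \<otimes> inv u)"
      using u u' by (simp add: w_elt_def inv_mult_units)
    also have "\<dots> = w_elt i j (u \<otimes> \<ominus> u)"
      using assms u u' w_elt_swap[of i j "u \<otimes> \<ominus> u"] uu by simp
    finally show ?thesis
      using assms m1 uu u' by (simp add: h_elt_def St.m_assoc[symmetric] Units_uminus)
  qed
  show "h_elt i j u \<bullet>\<^sub>S h_elt i j (\<ominus> u) = h_elt i j (u \<otimes> \<ominus> u)" by (rule *[OF assms(2)])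
  show "h_elt i j (\<ominus> u) \<bullet>\<^sub>S h_elt i j u = h_elt i j (\<ominus> u \<otimes> u)"
    using *[OF Units_uminus[OF assms(2)]] unit_facts[OF assms(2)] by simp
qed

end

section \<open>Centrality, bilinearity and relations of Milnor symbols\<close>

context steinberg begin

text \<open>Membership in K_2 is a condition on words, so each element gets a concrete word whose
  matrix can be computed. \<open>h_inv_word\<close> relies on w(u)^-1 = w(-u), which avoids formal
  inverse letters.\<close>

definition w_word where "w_word i j u = stx i j u @ stx j i (\<ominus> (inv u)) @ stx i j u"
definition h_word where "h_word i j u = w_word i j u @ w_word i j (\<ominus> \<one>)"
definition h_inv_word where "h_inv_word i j u = w_word i j \<one> @ w_word i j (\<ominus> u)"

lemma minus_one_Units [simp]: "\<ominus> \<one> \<in> Units R"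
  by (simp add: Units_uminus)

lemma w_word_words: "i \<noteq> j \<Longrightarrow> u \<in> Units R \<Longrightarrow> w_word i j u \<in> st_words"
  using unit_facts[of u] by (simp add: w_word_def gens_iff)

lemma h_word_words: "i \<noteq> j \<Longrightarrow> u \<in> Units R \<Longrightarrow> h_word i j u \<in> st_words"
  by (simp only: h_word_def append_in_lists_conv w_word_words Units_uminus Units_one_closed simp_thms)

lemma h_inv_word_words: "i \<noteq> j \<Longrightarrow> u \<in> Units R \<Longrightarrow> h_inv_word i j u \<in> st_words"
  by (simp only: h_inv_word_def append_in_lists_conv w_word_words Units_uminus Units_one_closed simp_thms)

lemma cls_append: "v \<in> st_words \<Longrightarrow> w \<in> st_words \<Longrightarrow> cls (v @ w) = cls v \<bullet>\<^sub>S cls w"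
  by (rule cls_mult[symmetric])

lemma cls_w_word: "i \<noteq> j \<Longrightarrow> u \<in> Units R \<Longrightarrow> cls (w_word i j u) = w_elt i j u"
proof -
  assume a: "i \<noteq> j" "u \<in> Units R"
  have "stx i j u \<in> st_words" "stx j i (\<ominus> (inv u)) \<in> st_words"
    using a unit_facts[of u] by (auto simp: gens_iff)
  thus ?thesis using a unit_facts[of u]
    unfolding w_word_def w_elt_def
    by (simp only: cls_append append_in_lists_conv simp_thms)
       (simp add: x_gen_def[symmetric] St.m_assoc)
qed

lemma steinberg_w_eq: "i \<noteq> j \<Longrightarrow> u \<in> Units R \<Longrightarrow> steinberg_w R i j u = w_elt i j u"
  by (simp add: steinberg_w_def cls_w_word[symmetric] w_word_def)

lemma steinberg_h_eq: "i \<noteq> j \<Longrightarrow> u \<in> Units R \<Longrightarrow> steinberg_h R i j u = h_elt i j u"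
  by (simp add: steinberg_h_def steinberg_w_eq h_elt_def)

lemma cls_h_word: "i \<noteq> j \<Longrightarrow> u \<in> Units R \<Longrightarrow> cls (h_word i j u) = h_elt i j u"
  by (simp add: h_word_def cls_append w_word_words cls_w_word h_elt_def)

lemma cls_h_inv_word: "i \<noteq> j \<Longrightarrow> u \<in> Units R \<Longrightarrow> cls (h_inv_word i j u) = st_inv (h_elt i j u)"
  by (simp add: h_inv_word_def cls_append w_word_words cls_w_word h_elt_def Units_uminus
      St.inv_mult_group w_elt_inv)

lemma st_act_w_word:
  assumes "i \<noteq> j" "u \<in> Units R" "M \<in> mats"
  shows "st_act (w_word i j u) M = M(i := (\<lambda>k. u \<otimes> M j k), j := (\<lambda>k. \<ominus> (inv u) \<otimes> M i k))"
proof -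
  have M: "M a b \<in> carrier R" for a b using assms(3) by (auto simp: mats_def)
  note u = unit_facts[OF assms(2)]
  have 1: "M j k \<oplus> \<ominus> (inv u) \<otimes> (M i k \<oplus> u \<otimes> M j k) = \<ominus> (inv u) \<otimes> M i k" for k
    using M u unit_cancel[OF assms(2), of "M j k"]
    by (simp add: r_distr l_minus a_ac r_neg r_neg1 r_neg2)
  have 2: "(M i k \<oplus> u \<otimes> M j k) \<oplus> u \<otimes> (\<ominus> (inv u) \<otimes> M i k) = u \<otimes> M j k" for k
    using M u unit_cancel[OF assms(2), of "M i k"]
    by (simp add: r_minus l_minus a_ac r_neg r_neg1 r_neg2)
  show ?thesis
    using assms(1) by (auto simp: w_word_def elem_mult_def fun_eq_iff 1 2)
qed

lemma st_act_h_word: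
  assumes "i \<noteq> j" "u \<in> Units R" "M \<in> mats"
  shows "st_act (h_word i j u) M = M(i := (\<lambda>k. u \<otimes> M i k), j := (\<lambda>k. inv u \<otimes> M j k))"
proof -
  have M: "M a b \<in> carrier R" for a b using assms(3) by (auto simp: mats_def)
  have im1: "inv (\<ominus> \<one>) = \<ominus> \<one>" by (simp add: inv_uminus)
  have w: "st_act (w_word i j (\<ominus> \<one>)) M \<in> mats"
    using assms by (intro st_act_mats w_word_words) auto
  show ?thesis
    unfolding h_word_def st_act_append using assms M unit_facts[OF assms(2)]
    by (subst st_act_w_word[OF _ _ w]) (auto simp: st_act_w_word fun_eq_iff l_minus r_minus im1)
qed

lemma st_act_h_inv_word:
  assumes "i \<noteq> j" "u \<in> Units R" "M \<in> mats"
  shows "st_act (h_inv_word i j u) M = M(i := (\<lambda>k. inv u \<otimes> M i k), j := (\<lambda>k. u \<otimes> M j k))"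
proof -
  have M: "M a b \<in> carrier R" for a b using assms(3) by (auto simp: mats_def)
  have w: "st_act (w_word i j (\<ominus> u)) M \<in> mats"
    using assms by (intro st_act_mats w_word_words) (auto simp: Units_uminus)
  show ?thesis
    unfolding h_inv_word_def st_act_append using assms M unit_facts[OF assms(2)]
    by (subst st_act_w_word[OF _ _ w])
       (auto simp: st_act_w_word Units_uminus fun_eq_iff l_minus r_minus inv_uminus)
qed

text \<open>Trivial action on all matrices is the form that computing with row operations produces
  directly; it implies membership in K_2 and centrality.\<close>

definition kern where
  "kern g \<longleftrightarrow> (\<exists>w\<in>st_words. g = cls w \<and> (\<forall>M\<in>mats. st_act w M = M))"

lemma kern_central: "kern z \<Longrightarrow> g \<in> carrier St \<Longrightarrow> z \<bullet>\<^sub>S g = g \<bullet>\<^sub>S z"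
  unfolding kern_def using kernel_central unit_matrix_mats
  by (auto simp: steinberg_matrix_eq)

lemma kern_closed: "kern z \<Longrightarrow> z \<in> carrier St"
  unfolding kern_def using cls_closed by auto

text \<open>\<open>K2\<close> quantifies over all words of a class; one representative suffices
  because the matrix is constant on the class.\<close>

lemma K2_iff: "z \<in> carrier (K2 R) \<longleftrightarrow> (\<exists>w\<in>st_words. z = cls w \<and> steinberg_matrix R w = unit_matrix R)"
proof
  assume "z \<in> carrier (K2 R)"
  hence "z \<in> carrier St" "\<forall>w\<in>z. steinberg_matrix R w = unit_matrix R" by (auto simp: K2_def)
  moreover then obtain w where "w \<in> st_words" "z = cls w" by (auto simp: carrier_St)
  moreover have "w \<in> cls w" if "w \<in> st_words"
    using that unfolding steinberg_class_def by (rule word_class_mem)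
  ultimately show "\<exists>w\<in>st_words. z = cls w \<and> steinberg_matrix R w = unit_matrix R" by blast
next
  assume "\<exists>w\<in>st_words. z = cls w \<and> steinberg_matrix R w = unit_matrix R"
  then obtain w where w: "w \<in> st_words" "z = cls w" "steinberg_matrix R w = unit_matrix R" by blast
  have "steinberg_matrix R v = unit_matrix R" if "v \<in> z" for v
  proof -
    have "word_eq (steinberg_gens R) (steinberg_rels R) w v"
      using that by (simp add: w(2) steinberg_class_def word_class_def)
    hence "st_act w (unit_matrix R) = st_act v (unit_matrix R)"
      using unit_matrix_mats by (intro st_act_word_eq)
    thus ?thesis using w(3) by (simp add: steinberg_matrix_eq)
  qed
  thus "z \<in> carrier (K2 R)" using w(1,2) cls_closed by (simp add: K2_def)
qed

lemma kern_K2: "kern z \<Longrightarrow> z \<in> carrier (K2 R)"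
  unfolding kern_def K2_iff using unit_matrix_mats by (auto simp: steinberg_matrix_eq)

abbreviation comm where "comm a b \<equiv> a \<bullet>\<^sub>S b \<bullet>\<^sub>S st_inv a \<bullet>\<^sub>S st_inv b"

lemma milnor_symbol_eq:
  "u \<in> Units R \<Longrightarrow> v \<in> Units R \<Longrightarrow> milnor_symbol R u v = comm (h_elt 1 2 u) (h_elt 1 3 v)"
  by (simp add: milnor_symbol_def steinberg_h_eq Let_def)

text \<open>Both factors lie over diagonal matrices, and these commute.\<close>

lemma h_elt_comm_kern:
  assumes "distinct [i, j, k]" "u \<in> Units R" "v \<in> Units R"
  shows "kern (comm (h_elt i j u) (h_elt i k v))"
proof -
  have ij: "i \<noteq> j" "i \<noteq> k" "j \<noteq> k" using assms by auto
  let ?w = "h_word i j u @ h_word i k v @ h_inv_word i j u @ h_inv_word i k v"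
  have words: "h_word i j u \<in> st_words" "h_word i k v \<in> st_words"
    "h_inv_word i j u \<in> st_words" "h_inv_word i k v \<in> st_words"
    using assms(2,3) ij by (simp_all only: h_word_words h_inv_word_words simp_thms)
  have "cls ?w = comm (h_elt i j u) (h_elt i k v)"
    using words assms(2,3) ij
    by (simp only: cls_append append_in_lists_conv simp_thms) (simp add: cls_h_word cls_h_inv_word St.m_assoc)
  moreover have "st_act ?w M = M" if M: "M \<in> mats" for M
  proof -
    have m: "M a b \<in> carrier R" for a b using M by (auto simp: mats_def)
    note uv = unit_facts[OF assms(2)] unit_facts[OF assms(3)]
    define M1 where "M1 = M(i := (\<lambda>l. inv v \<otimes> M i l), k := (\<lambda>l. v \<otimes> M k l))"
    define M2 where "M2 = M1(i := (\<lambda>l. inv u \<otimes> M1 i l), j := (\<lambda>l. u \<otimes> M1 j l))"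
    define M3 where "M3 = M2(i := (\<lambda>l. v \<otimes> M2 i l), k := (\<lambda>l. inv v \<otimes> M2 k l))"
    have mm: "M1 \<in> mats" "M2 \<in> mats" "M3 \<in> mats"
      using m uv by (auto simp: M1_def M2_def M3_def mats_def)
    have "st_act ?w M = M3(i := (\<lambda>l. u \<otimes> M3 i l), j := (\<lambda>l. inv u \<otimes> M3 j l))"
      using assms ij M mm
      by (simp add: st_act_append st_act_h_inv_word st_act_h_word M1_def[symmetric] M2_def[symmetric] M3_def[symmetric])
    also have "\<dots> = M"
    proof -
      have "u \<otimes> (v \<otimes> (inv u \<otimes> (inv v \<otimes> M i l))) = M i l" for l
        using m uv unit_cancel[OF assms(2)] unit_cancel[OF assms(3)]
        by (metis m_closed m_lcomm)
      thus ?thesis using ij m uv unit_cancel[OF assms(2)] unit_cancel[OF assms(3)]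
        by (auto simp: M3_def M2_def M1_def fun_eq_iff)
    qed
    finally show ?thesis .
  qed
  ultimately show ?thesis
    unfolding kern_def using words by (intro bexI[of _ ?w]) (simp_all only: append_in_lists_conv simp_thms, auto)
qed

text \<open>The diagonal matrices below h_ij(u) are multiplicative in u, so h_ij itself is
  multiplicative up to a central element.\<close>

lemma h_elt_mult_kern:
  assumes "i \<noteq> j" "u \<in> Units R" "v \<in> Units R"
  shows "\<exists>z. kern z \<and> h_elt i j (u \<otimes> v) = z \<bullet>\<^sub>S (h_elt i j u \<bullet>\<^sub>S h_elt i j v)"
proof -
  note uv = unit_facts[OF assms(2)] unit_facts[OF assms(3)]
  have uv': "u \<otimes> v \<in> Units R" using assms by auto
  define z where "z = h_elt i j (u \<otimes> v) \<bullet>\<^sub>S st_inv (h_elt i j v) \<bullet>\<^sub>S st_inv (h_elt i j u)"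
  let ?w = "h_word i j (u \<otimes> v) @ h_inv_word i j v @ h_inv_word i j u"
  have words: "h_word i j (u \<otimes> v) \<in> st_words" "h_inv_word i j u \<in> st_words" "h_inv_word i j v \<in> st_words"
    using assms uv' by (simp_all only: h_word_words h_inv_word_words simp_thms)
  have "cls ?w = z"
    using words assms uv' unfolding z_def
    by (simp only: cls_append append_in_lists_conv simp_thms) (simp add: cls_h_word cls_h_inv_word St.m_assoc)
  moreover have "st_act ?w M = M" if M: "M \<in> mats" for M
  proof -
    have m: "M a b \<in> carrier R" for a b using M by (auto simp: mats_def)
    define M1 where "M1 = M(i := (\<lambda>l. inv u \<otimes> M i l), j := (\<lambda>l. u \<otimes> M j l))"
    define M2 where "M2 = M1(i := (\<lambda>l. inv v \<otimes> M1 i l), j := (\<lambda>l. v \<otimes> M1 j l))"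
    have mm: "M1 \<in> mats" "M2 \<in> mats"
      using m uv by (auto simp: M1_def M2_def mats_def)
    have "st_act ?w M = M2(i := (\<lambda>l. u \<otimes> v \<otimes> M2 i l), j := (\<lambda>l. inv (u \<otimes> v) \<otimes> M2 j l))"
      using assms M mm uv'
      by (simp add: st_act_append st_act_h_inv_word st_act_h_word M1_def[symmetric] M2_def[symmetric])
    also have "\<dots> = M"
      using assms m uv m_lcomm[of "inv u" v "u \<otimes> _"] unit_cancel[OF assms(2)] unit_cancel[OF assms(3)]
      by (auto simp: M2_def M1_def fun_eq_iff inv_mult_units m_assoc)
    finally show ?thesis .
  qed
  ultimately have "kern z"
    unfolding kern_def using words by (intro bexI[of _ ?w]) (simp_all only: append_in_lists_conv simp_thms, auto)
  moreover have "h_elt i j (u \<otimes> v) = z \<bullet>\<^sub>S (h_elt i j u \<bullet>\<^sub>S h_elt i j v)"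
    using assms uv' by (simp add: z_def St.m_assoc)
  ultimately show ?thesis by blast
qed

text \<open>In every group [ab, c] = a [b, c] a^-1 [a, c]. The central z cancels against its
  inverse, and the central [b, c] can be taken out of the conjugation.\<close>

lemma comm_mult_left:
  assumes "a \<in> carrier St" "b \<in> carrier St" "c \<in> carrier St" "kern z" "kern (comm b c)"
  shows "comm (z \<bullet>\<^sub>S (a \<bullet>\<^sub>S b)) c = comm a c \<bullet>\<^sub>S comm b c"
proof -
  note z = kern_closed[OF assms(4)]
  have "comm (z \<bullet>\<^sub>S (a \<bullet>\<^sub>S b)) c = z \<bullet>\<^sub>S (a \<bullet>\<^sub>S b \<bullet>\<^sub>S c \<bullet>\<^sub>S st_inv b \<bullet>\<^sub>S st_inv a) \<bullet>\<^sub>S st_inv z \<bullet>\<^sub>S st_inv c"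
    using assms(1-3) z by (simp add: St.inv_mult_group St.m_assoc)
  also have "z \<bullet>\<^sub>S (a \<bullet>\<^sub>S b \<bullet>\<^sub>S c \<bullet>\<^sub>S st_inv b \<bullet>\<^sub>S st_inv a) = (a \<bullet>\<^sub>S b \<bullet>\<^sub>S c \<bullet>\<^sub>S st_inv b \<bullet>\<^sub>S st_inv a) \<bullet>\<^sub>S z"
    using assms(1-3) by (intro kern_central[OF assms(4)]) auto
  also have "\<dots> \<bullet>\<^sub>S st_inv z \<bullet>\<^sub>S st_inv c = a \<bullet>\<^sub>S (comm b c) \<bullet>\<^sub>S (c \<bullet>\<^sub>S st_inv a \<bullet>\<^sub>S st_inv c)"
    using assms(1-3) z by (simp add: St.m_assoc)
  also have "a \<bullet>\<^sub>S (comm b c) = comm b c \<bullet>\<^sub>S a"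
    by (rule kern_central[OF assms(5,1), symmetric])
  also have "comm b c \<bullet>\<^sub>S a \<bullet>\<^sub>S (c \<bullet>\<^sub>S st_inv a \<bullet>\<^sub>S st_inv c) = comm b c \<bullet>\<^sub>S comm a c"
    using assms(1-3) by (simp add: St.m_assoc)
  also have "\<dots> = comm a c \<bullet>\<^sub>S comm b c"
    using assms(1-3) by (intro kern_central[OF assms(5)]) auto
  finally show ?thesis .
qed

lemma comm_mult_right:
  assumes "a \<in> carrier St" "b \<in> carrier St" "c \<in> carrier St" "kern z" "kern (comm a c)"
  shows "comm a (z \<bullet>\<^sub>S (b \<bullet>\<^sub>S c)) = comm a b \<bullet>\<^sub>S comm a c"
proof -
  note z = kern_closed[OF assms(4)]
  have "comm a (z \<bullet>\<^sub>S (b \<bullet>\<^sub>S c)) = (a \<bullet>\<^sub>S z) \<bullet>\<^sub>S (b \<bullet>\<^sub>S c \<bullet>\<^sub>S st_inv a \<bullet>\<^sub>S st_inv c \<bullet>\<^sub>S st_inv b) \<bullet>\<^sub>S st_inv z"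
    using assms(1-3) z by (simp add: St.inv_mult_group St.m_assoc)
  also have "a \<bullet>\<^sub>S z = z \<bullet>\<^sub>S a"
    by (rule kern_central[OF assms(4,1), symmetric])
  also have "z \<bullet>\<^sub>S a \<bullet>\<^sub>S (b \<bullet>\<^sub>S c \<bullet>\<^sub>S st_inv a \<bullet>\<^sub>S st_inv c \<bullet>\<^sub>S st_inv b) \<bullet>\<^sub>S st_inv z =
      z \<bullet>\<^sub>S (a \<bullet>\<^sub>S b \<bullet>\<^sub>S c \<bullet>\<^sub>S st_inv a \<bullet>\<^sub>S st_inv c \<bullet>\<^sub>S st_inv b) \<bullet>\<^sub>S st_inv z"
    using assms(1-3) z by (simp add: St.m_assoc)
  also have "z \<bullet>\<^sub>S (a \<bullet>\<^sub>S b \<bullet>\<^sub>S c \<bullet>\<^sub>S st_inv a \<bullet>\<^sub>S st_inv c \<bullet>\<^sub>S st_inv b) = (a \<bullet>\<^sub>S b \<bullet>\<^sub>S c \<bullet>\<^sub>S st_inv a \<bullet>\<^sub>S st_inv c \<bullet>\<^sub>S st_inv b) \<bullet>\<^sub>S z"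
    using assms(1-3) by (intro kern_central[OF assms(4)]) auto
  also have "\<dots> \<bullet>\<^sub>S st_inv z = (a \<bullet>\<^sub>S b \<bullet>\<^sub>S st_inv a) \<bullet>\<^sub>S comm a c \<bullet>\<^sub>S st_inv b"
    using assms(1-3) z by (simp add: St.m_assoc)
  also have "(a \<bullet>\<^sub>S b \<bullet>\<^sub>S st_inv a) \<bullet>\<^sub>S comm a c = comm a c \<bullet>\<^sub>S (a \<bullet>\<^sub>S b \<bullet>\<^sub>S st_inv a)"
    using assms(1-3) by (intro kern_central[OF assms(5), symmetric]) auto
  also have "comm a c \<bullet>\<^sub>S (a \<bullet>\<^sub>S b \<bullet>\<^sub>S st_inv a) \<bullet>\<^sub>S st_inv b = comm a c \<bullet>\<^sub>S comm a b"
    using assms(1-3) by (simp add: St.m_assoc)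
  also have "\<dots> = comm a b \<bullet>\<^sub>S comm a c"
    using assms(1-3) by (intro kern_central[OF assms(5)]) auto
  finally show ?thesis .
qed

lemma K2_mult: "x \<otimes>\<^bsub>K2 R\<^esub> y = x \<bullet>\<^sub>S y" and K2_one: "\<one>\<^bsub>K2 R\<^esub> = \<one>\<^bsub>St\<^esub>"
  by (simp_all add: K2_def)

lemma milnor_symbol_kern: "u \<in> Units R \<Longrightarrow> v \<in> Units R \<Longrightarrow> kern (milnor_symbol R u v)"
  by (simp only: milnor_symbol_eq) (rule h_elt_comm_kern, auto)

lemma milnor_symbol_K2: "u \<in> Units R \<Longrightarrow> v \<in> Units R \<Longrightarrow> milnor_symbol R u v \<in> carrier (K2 R)"
  by (intro kern_K2 milnor_symbol_kern)

lemma milnor_symbol_mult_left: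
  assumes "u \<in> Units R" "u' \<in> Units R" "v \<in> Units R"
  shows "milnor_symbol R (u \<otimes> u') v = milnor_symbol R u v \<otimes>\<^bsub>K2 R\<^esub> milnor_symbol R u' v"
proof -
  obtain z where z: "kern z" "h_elt 1 2 (u \<otimes> u') = z \<bullet>\<^sub>S (h_elt 1 2 u \<bullet>\<^sub>S h_elt 1 2 u')"
    using h_elt_mult_kern[of 1 2 u u'] assms by auto
  have "kern (comm (h_elt 1 2 u') (h_elt 1 3 v))" using assms by (intro h_elt_comm_kern) auto
  from comm_mult_left[OF _ _ _ z(1) this, of "h_elt 1 2 u"] show ?thesis
    using assms by (simp add: milnor_symbol_eq K2_mult z(2) del: One_nat_def)
qed

lemma milnor_symbol_mult_right:
  assumes "u \<in> Units R" "v \<in> Units R" "v' \<in> Units R"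
  shows "milnor_symbol R u (v \<otimes> v') = milnor_symbol R u v \<otimes>\<^bsub>K2 R\<^esub> milnor_symbol R u v'"
proof -
  obtain z where z: "kern z" "h_elt 1 3 (v \<otimes> v') = z \<bullet>\<^sub>S (h_elt 1 3 v \<bullet>\<^sub>S h_elt 1 3 v')"
    using h_elt_mult_kern[of 1 3 v v'] assms by auto
  have "kern (comm (h_elt 1 2 u) (h_elt 1 3 v'))" using assms by (intro h_elt_comm_kern) auto
  from comm_mult_right[OF _ _ _ z(1) this, of "h_elt 1 3 v"] show ?thesis
    using assms by (simp add: milnor_symbol_eq K2_mult z(2) del: One_nat_def)
qed

text \<open>By \<open>conj_by_h_elt_h_elt\<close> the symbol is h(uv) (h(v) h(u))^-1.\<close>

lemma milnor_symbol_trivial: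
  assumes "u \<in> Units R" "v \<in> Units R" "h_elt 1 3 v \<bullet>\<^sub>S h_elt 1 3 u = h_elt 1 3 (u \<otimes> v)"
  shows "milnor_symbol R u v = \<one>\<^bsub>K2 R\<^esub>"
proof -
  have uv: "u \<otimes> v \<in> Units R" using assms by auto
  have "milnor_symbol R u v = conj_by (h_elt 1 2 u) (h_elt 1 3 v) \<bullet>\<^sub>S st_inv (h_elt 1 3 v)"
    using assms by (simp add: milnor_symbol_eq conj_by_def)
  also have "\<dots> = h_elt 1 3 (u \<otimes> v) \<bullet>\<^sub>S (st_inv (h_elt 1 3 u) \<bullet>\<^sub>S st_inv (h_elt 1 3 v))"
    using assms uv by (simp add: conj_by_h_elt_h_elt St.m_assoc)
  also have "\<dots> = \<one>\<^bsub>St\<^esub>"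
    using assms uv by (simp add: assms(3)[symmetric] St.inv_mult_group[symmetric])
  finally show ?thesis by (simp add: K2_one)
qed

lemma milnor_symbol_steinberg:
  assumes "u \<in> Units R" "v \<in> Units R" "u \<oplus> v = \<one>"
  shows "milnor_symbol R u v = \<one>\<^bsub>K2 R\<^esub>"
  using assms w_elt_steinberg_relation[of 1 3 v u] unit_facts[of u] unit_facts[of v]
  by (intro milnor_symbol_trivial) (auto simp: a_comm m_comm)

lemma milnor_symbol_minus:
  assumes "u \<in> Units R"
  shows "milnor_symbol R u (\<ominus> u) = \<one>\<^bsub>K2 R\<^esub>"
  using assms w_elt_minus_relation[of 1 3 u] unit_facts[of u]
  by (intro milnor_symbol_trivial) (auto simp: Units_uminus m_comm)

text \<open>Expanding {uv, -uv} = 1 bilinearly and removing {u, -u} = {v, -v} = 1 leaves {u, v}{v,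
  u}.\<close>

lemma milnor_symbol_skew:
  assumes u: "u \<in> Units R" and v: "v \<in> Units R"
  shows "milnor_symbol R u v \<otimes>\<^bsub>K2 R\<^esub> milnor_symbol R v u = \<one>\<^bsub>K2 R\<^esub>"
proof -
  have uv: "u \<otimes> v \<in> Units R" using u v by auto
  have div_map: "\<ominus> u \<in> Units R" "\<ominus> v \<in> Units R" using u v by (auto intro: Units_uminus)
  let ?s = "milnor_symbol R"
  have cl: "?s a b \<in> carrier St" if "a \<in> Units R" "b \<in> Units R" for a b
    using kern_closed[OF milnor_symbol_kern[OF that]] .
  have "\<one>\<^bsub>St\<^esub> = ?s (u \<otimes> v) (\<ominus> (u \<otimes> v))"
    using milnor_symbol_minus[OF uv] by (simp add: K2_one)
  also have "\<dots> = ?s u (\<ominus> (u \<otimes> v)) \<bullet>\<^sub>S ?s v (\<ominus> (u \<otimes> v))"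
    using u v uv by (simp add: milnor_symbol_mult_left K2_mult Units_uminus)
  also have "\<ominus> (u \<otimes> v) = \<ominus> u \<otimes> v" using u v by (simp add: l_minus Units_closed)
  also have "?s u (\<ominus> u \<otimes> v) = ?s u v"
    using u v div_map cl by (simp add: milnor_symbol_mult_right K2_mult milnor_symbol_minus K2_one)
  also have "\<ominus> u \<otimes> v = u \<otimes> \<ominus> v" using u v by (simp add: l_minus r_minus Units_closed)
  also have "?s v (u \<otimes> \<ominus> v) = ?s v u"
    using u v div_map cl by (simp add: milnor_symbol_mult_right K2_mult milnor_symbol_minus K2_one)
  finally show ?thesis by (simp add: K2_mult K2_one)
qed

end

section \<open>Tensor products and divisibility\<close>

definition tfree where "tfree A B f \<longleftrightarrow> Poly_Mapping.keys f \<subseteq> carrier A \<times> carrier B"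

lemma tfree_frag_of: "a \<in> carrier A \<Longrightarrow> b \<in> carrier B \<Longrightarrow> tfree A B (frag_of (a, b))"
  by (simp add: tfree_def)

lemma tfree_add: "tfree A B f \<Longrightarrow> tfree A B g \<Longrightarrow> tfree A B (f + g)"
  using keys_add[of f g] by (auto simp: tfree_def)

lemma tfree_diff: "tfree A B f \<Longrightarrow> tfree A B g \<Longrightarrow> tfree A B (f - g)"
  using keys_diff[of f g] by (auto simp: tfree_def)

lemma tensor_rels_tfree:
  assumes "\<And>x y. x \<in> carrier A \<Longrightarrow> y \<in> carrier A \<Longrightarrow> x \<otimes>\<^bsub>A\<^esub> y \<in> carrier A"
    and "\<And>x y. x \<in> carrier B \<Longrightarrow> y \<in> carrier B \<Longrightarrow> x \<otimes>\<^bsub>B\<^esub> y \<in> carrier B"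
    and "f \<in> tensor_rels A B"
  shows "tfree A B f"
  using assms unfolding tensor_rels_def by (auto intro!: tfree_diff tfree_frag_of)

locale tensor =
  fixes A :: "('a, 'm) monoid_scheme" and B :: "('b, 'n) monoid_scheme"
  assumes clA: "x \<in> carrier A \<Longrightarrow> y \<in> carrier A \<Longrightarrow> x \<otimes>\<^bsub>A\<^esub> y \<in> carrier A"
    and clB: "z \<in> carrier B \<Longrightarrow> w \<in> carrier B \<Longrightarrow> z \<otimes>\<^bsub>B\<^esub> w \<in> carrier B"
begin

abbreviation "H \<equiv> tensor_subgroup A B"

lemma rels_tfree: "f \<in> tensor_rels A B \<Longrightarrow> tfree A B f"
  using tensor_rels_tfree[of A B f] clA clB by blast

lemma group_tensor_free: "comm_group (tensor_free A B)"
  by (simp add: tensor_free_def abelian_free_Abelian_group)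

lemma tfree_iff: "f \<in> carrier (tensor_free A B) \<longleftrightarrow> tfree A B f"
  by (simp add: tensor_free_def tfree_def)

lemma subgroup_H: "subgroup H (tensor_free A B)"
  unfolding tensor_subgroup_def
  using rels_tfree tfree_iff comm_group.axioms(2)[OF group_tensor_free]
  by (intro group.generate_is_subgroup) auto

lemma H_tfree: "f \<in> H \<Longrightarrow> tfree A B f"
  using subgroup.subset[OF subgroup_H] tfree_iff by blast

lemma H_zero: "0 \<in> H"
  using subgroup.one_closed[OF subgroup_H] by (simp add: tensor_free_def)

lemma H_add: "f \<in> H \<Longrightarrow> g \<in> H \<Longrightarrow> f + g \<in> H"
  using subgroup.m_closed[OF subgroup_H, of f g] by (simp add: tensor_free_def)

lemma H_neg: "f \<in> H \<Longrightarrow> - f \<in> H"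
  using subgroup.m_inv_closed[OF subgroup_H, of f] H_tfree[of f]
  by (simp add: tensor_free_def tfree_def)

lemma H_diff: "f \<in> H \<Longrightarrow> g \<in> H \<Longrightarrow> f - g \<in> H"
  using H_add[of f "- g"] H_neg by simp

lemma H_rel: "f \<in> tensor_rels A B \<Longrightarrow> f \<in> H"
  unfolding tensor_subgroup_def by (rule generate.incl)

lemma H_left: "x \<in> carrier A \<Longrightarrow> y \<in> carrier A \<Longrightarrow> b \<in> carrier B \<Longrightarrow>
    frag_of (x \<otimes>\<^bsub>A\<^esub> y, b) - frag_of (x, b) - frag_of (y, b) \<in> H"
  by (rule H_rel) (auto simp: tensor_rels_def)

lemma H_right: "a \<in> carrier A \<Longrightarrow> x \<in> carrier B \<Longrightarrow> y \<in> carrier B \<Longrightarrow>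
    frag_of (a, x \<otimes>\<^bsub>B\<^esub> y) - frag_of (a, x) - frag_of (a, y) \<in> H"
  by (rule H_rel) (auto simp: tensor_rels_def)

text \<open>The universal property of the tensor product at the level of the free group: the
  biadditivity relations generate H, so additivity carries membership over from them.\<close>

lemma H_hom:
  assumes f: "f \<in> H"
    and K: "0 \<in> K" "\<And>x y. x \<in> K \<Longrightarrow> y \<in> K \<Longrightarrow> x - y \<in> K"
    and \<phi>: "\<phi> 0 = 0" "\<And>x y. \<phi> (x - y) = \<phi> x - (\<phi> y :: 'c :: ab_group_add)"
    and left: "\<And>x y b. x \<in> carrier A \<Longrightarrow> y \<in> carrier A \<Longrightarrow> b \<in> carrier B \<Longrightarrow>
       \<phi> (frag_of (x \<otimes>\<^bsub>A\<^esub> y, b)) - \<phi> (frag_of (x, b)) - \<phi> (frag_of (y, b)) \<in> K"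
    and right: "\<And>a x y. a \<in> carrier A \<Longrightarrow> x \<in> carrier B \<Longrightarrow> y \<in> carrier B \<Longrightarrow>
       \<phi> (frag_of (a, x \<otimes>\<^bsub>B\<^esub> y)) - \<phi> (frag_of (a, x)) - \<phi> (frag_of (a, y)) \<in> K"
  shows "\<phi> f \<in> K"
proof -
  have neg: "\<phi> (- x) = - \<phi> x" for x using \<phi>(2)[of 0 x] \<phi>(1) by simp
  have add: "\<phi> (x + y) = \<phi> x + \<phi> y" for x y using \<phi>(2)[of x "- y"] neg by simp
  have Kneg: "- x \<in> K" if "x \<in> K" for x using K(2)[OF K(1) that] by simp
  have Kadd: "x + y \<in> K" if "x \<in> K" "y \<in> K" for x y using K(2)[OF that(1) Kneg[OF that(2)]] by simp
  have rel: "\<phi> h \<in> K" if "h \<in> tensor_rels A B" for h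
    using that left right unfolding tensor_rels_def by (auto simp: \<phi>(2))
  show ?thesis using f unfolding tensor_subgroup_def
  proof (induction rule: generate.induct)
    case (inv h)
    have "inv\<^bsub>tensor_free A B\<^esub> h = - h"
      using rels_tfree[OF inv] by (simp add: tensor_free_def tfree_def)
    thus ?case using rel[OF inv] Kneg neg by simp
  qed (auto simp: tensor_free_def \<phi>(1) K(1) add Kadd rel)
qed

lemma tensor_class_eq: "tensor_class A B f = {h + f | h. h \<in> H}"
  by (auto simp: tensor_class_def r_coset_def tensor_free_def)

lemma mem_tensor_class: "g \<in> tensor_class A B f \<longleftrightarrow> g - f \<in> H"
  unfolding tensor_class_eq by (auto, metis diff_add_cancel)

lemma tensor_class_cong:
  assumes "f - g \<in> H" shows "tensor_class A B f = tensor_class A B g"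
proof -
  have "h - f \<in> H \<longleftrightarrow> h - g \<in> H" for h
    using H_add[of "h - f" "f - g"] H_diff[of "h - g" "f - g"] assms by auto
  thus ?thesis by (auto simp: mem_tensor_class)
qed

lemma tensor_product_mult:
  assumes "tfree A B f" "tfree A B g"
  shows "tensor_class A B f \<otimes>\<^bsub>tensor_product A B\<^esub> tensor_class A B g = tensor_class A B (f + g)"
proof -
  have "H \<lhd> tensor_free A B"
    using comm_group.normal_iff_subgroup[OF group_tensor_free] subgroup_H by blast
  from normal.rcos_sum[OF this] show ?thesis
    using assms tfree_iff by (simp add: tensor_product_def FactGroup_def tensor_class_def tensor_free_def)
qed

lemma tensor_product_one: "\<one>\<^bsub>tensor_product A B\<^esub> = tensor_class A B 0"
  unfolding tensor_product_def FactGroup_def tensor_class_eq by simp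

end

section \<open>Tensor products with Z[1/m]\<close>

lemma carrier_Z_inv: "x \<in> carrier (Z_inv m) \<longleftrightarrow> (\<exists>a k. x = of_int a / of_nat m ^ k)"
  by (simp add: Z_inv_def)

lemma Z_inv_simps [simp]: "x \<otimes>\<^bsub>Z_inv m\<^esub> y = x + y"
  by (simp add: Z_inv_def)

lemma Z_inv_of_int: "of_int a \<in> carrier (Z_inv m)"
  unfolding carrier_Z_inv by (rule exI[of _ a], rule exI[of _ 0]) simp

lemma Z_inv_mult: "x \<in> carrier (Z_inv m) \<Longrightarrow> y \<in> carrier (Z_inv m) \<Longrightarrow> x * y \<in> carrier (Z_inv m)"
  unfolding carrier_Z_inv by (metis of_int_mult power_add times_divide_times_eq)

lemma Z_inv_div: "x \<in> carrier (Z_inv m) \<Longrightarrow> x / of_nat m \<in> carrier (Z_inv m)"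
  unfolding carrier_Z_inv by (metis divide_divide_eq_left power_Suc2)

lemma Z_inv_add:
  assumes "m > 0" "x \<in> carrier (Z_inv m)" "y \<in> carrier (Z_inv m)"
  shows "x + y \<in> carrier (Z_inv m)"
proof -
  obtain a k b l where xy: "x = of_int a / of_nat m ^ k" "y = of_int b / of_nat m ^ l"
    using assms(2,3) unfolding carrier_Z_inv by blast
  have "x + y = of_int (a * int m ^ l + b * int m ^ k) / of_nat m ^ (k + l)"
    unfolding xy using assms(1) by (simp add: power_add add_divide_distrib)
  thus ?thesis unfolding carrier_Z_inv by blast
qed

locale Z_inv_tensor = tensor A "Z_inv m" for A :: "('a, 'm) monoid_scheme" and m +
  assumes m: "m > 0"
begin

lemma H_mult_right:
  assumes "a \<in> carrier A" "r \<in> carrier (Z_inv m)"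
  shows "frag_of (a, of_nat n * r) - frag_cmul (int n) (frag_of (a, r)) \<in> H"
proof (induction n)
  case 0
  have "frag_of (a, 0 + 0) - frag_of (a, 0) - frag_of (a, 0 :: rat) \<in> H"
    using H_right[of a 0 0] assms Z_inv_of_int[of 0 m] by simp
  thus ?case using H_neg by fastforce
next
  case (Suc n)
  have "frag_of (a, r + of_nat n * r) - frag_of (a, r) - frag_of (a, of_nat n * r) \<in> H"
    using H_right[of a r "of_nat n * r"] assms Z_inv_mult[of "of_int (int n)" m r] Z_inv_of_int[of "int n" m]
    by simp
  from H_add[OF this Suc.IH] show ?case
    by (simp add: frag_cmul_distrib algebra_simps)
qed

text \<open>Division by m on the factor Z[1/m], lifted to the free group. It preserves H and inverts
  multiplication by m modulo H.\<close>

definition div_map where "div_map = frag_extend (\<lambda>(a, r). frag_of (a :: 'a, r / of_nat m :: rat))"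

lemma div_map_H: "f \<in> H \<Longrightarrow> div_map f \<in> H"
  by (rule H_hom[of f H div_map])
     (auto simp: div_map_def H_zero H_diff frag_extend_diff add_divide_distrib Z_inv_div H_left
           intro!: H_right[simplified])

lemma div_map_inverse: "tfree A (Z_inv m) f \<Longrightarrow> f - frag_cmul (int m) (div_map f) \<in> H"
  unfolding tfree_def
proof (induction f rule: frag_induction)
  case (one x)
  then show ?case
    using H_mult_right[of "fst x" "snd x / of_nat m" m] m
    by (cases x) (auto simp: div_map_def Z_inv_div)
next
  case (diff f g)
  have "frag_cmul (int m) (div_map (f - g)) = frag_cmul (int m) (div_map f) - frag_cmul (int m) (div_map g)"
    unfolding div_map_def frag_extend_diff
    by (simp add: poly_mapping_eq_iff fun_eq_iff lookup_minus right_diff_distrib)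
  then have "f - g - frag_cmul (int m) (div_map (f - g)) =
      f - frag_cmul (int m) (div_map f) - (g - frag_cmul (int m) (div_map g))"
    by (simp only:) (simp add: algebra_simps)
  then show ?case using H_diff[OF diff(1,2)] by (simp only:)
qed (simp add: H_zero div_map_def)

text \<open>From m f in H follows m div(f) = div(m f) in H, and f is congruent to m div(f): the
  tensor product has no m-torsion.\<close>

lemma H_saturated: assumes "tfree A (Z_inv m) f" "frag_cmul (int m) f \<in> H" shows "f \<in> H"
proof -
  have "div_map (frag_cmul (int m) f) \<in> H" by (rule div_map_H[OF assms(2)])
  also have "div_map (frag_cmul (int m) f) = frag_cmul (int m) (div_map f)"
    by (simp add: div_map_def frag_extend_cmul)
  finally show ?thesis using H_add[OF div_map_inverse[OF assms(1)], of "frag_cmul (int m) (div_map f)"] by simp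
qed

lemma H_cmul: "f \<in> H \<Longrightarrow> frag_cmul (int n) f \<in> H"
  by (induction n) (auto simp: H_zero H_add frag_cmul_distrib)

lemma H_saturated_dvd:
  assumes "tfree A (Z_inv m) f" "frag_cmul (int n) f \<in> H" "n dvd m" shows "f \<in> H"
proof -
  obtain k where "m = n * k" using assms(3) by blast
  thus ?thesis using H_saturated[OF assms(1)] H_cmul[OF assms(2), of k] by (simp add: mult.commute)
qed

end

section \<open>Alternating pairings on $(\mathbb{Z}/N\mathbb{Z})^2$\<close>

text \<open>The exponent pattern of f_ab written additively: the defect of F in the parallelogram
  law.\<close>

definition wp_comb :: "(int \<times> int \<Rightarrow> 'b::ab_group_add) \<Rightarrow> int \<times> int \<Rightarrow> int \<times> int \<Rightarrow> 'b" where
  "wp_comb F a b = F (a + b) + F (a - b) - F a - F a - F b - F b"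

text \<open>B x y stands for the antisymmetrised symbol of g_x and g_y. Antisymmetry, evenness and
  periodicity are equations in the free group, so they can be used for rewriting; only T holds
  modulo H, and \<open>sat2\<close>, \<open>satN\<close> allow division by 2 and N.\<close>

locale alternating_pairing =
  fixes N :: nat and B :: "int \<times> int \<Rightarrow> int \<times> int \<Rightarrow> ('k \<Rightarrow>\<^sub>0 int)" and H :: "('k \<Rightarrow>\<^sub>0 int) set"
  assumes N: "N \<ge> 1"
    and anti: "B y x = - B x y"
    and even: "B (- x) y = B x y"
    and per: "B (x + (int N * i, int N * j)) y = B x y"
    and H0: "0 \<in> H" and Hadd: "f \<in> H \<Longrightarrow> g \<in> H \<Longrightarrow> f + g \<in> H" and Hneg: "f \<in> H \<Longrightarrow> - f \<in> H"
    and sat2: "f + f \<in> H \<Longrightarrow> f \<in> H" and satN: "frag_cmul (int N) f \<in> H \<Longrightarrow> f \<in> H"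
    and T: "wp_comb (\<lambda>x. wp_comb (\<lambda>y. B x y) b c) a b + wp_comb (\<lambda>x. wp_comb (\<lambda>y. B x y) c a) b c
        + wp_comb (\<lambda>x. wp_comb (\<lambda>y. B x y) a b) c a \<in> H"
begin

lemma Hdiff: "f \<in> H \<Longrightarrow> g \<in> H \<Longrightarrow> f - g \<in> H"
  using Hadd[of f "- g"] Hneg[of g] by simp

lemma Hsum: "(\<And>i. i \<in> I \<Longrightarrow> F i \<in> H) \<Longrightarrow> sum F I \<in> H"
  by (induction I rule: infinite_finite_induct) (auto intro: H0 Hadd)

text \<open>The free abelian group has no 2-torsion, so vanishing sums are obtained exactly and not
  only modulo H.\<close>

lemma self0: "f = - f \<Longrightarrow> f = (0 :: 'k \<Rightarrow>\<^sub>0 int)"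
  by (metis frag_cmul_eq_0_iff frag_cmul_distrib frag_cmul_one add.right_inverse one_add_one zero_neq_numeral)

lemma even2: "B x (- y) = B x y"
  by (metis anti even)

lemma swap1: "B (x - y) z = B (y - x) z" and swap2: "B z (x - y) = B z (y - x)"
  using even[of "x - y" z] even2[of z "x - y"] by simp_all

lemma per2: "B y (x + (int N * i, int N * j)) = B y x"
  by (metis anti per)

lemma B_self: "B x x = 0"
  using self0 anti by metis

definition S3 where "S3 x y z = B x y + B y z + B z x"
definition S where "S x y = S3 x y (x + y)"

definition S_sym where "S_sym x y = S x y + S x (- y)"

lemma T_expand:
  "wp_comb (\<lambda>x. wp_comb (\<lambda>y. B x y) b c) a b + wp_comb (\<lambda>x. wp_comb (\<lambda>y. B x y) c a) b c
        + wp_comb (\<lambda>x. wp_comb (\<lambda>y. B x y) a b) c a =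
   S3 (a + b) (b + c) (c - a) + S3 (a + b) (b - c) (c + a) + S3 (a - b) (b + c) (c + a) +
   S3 (a - b) (b - c) (c - a) +
   (S_sym a b + S_sym b c + S_sym c a) + (S_sym a b + S_sym b c + S_sym c a)"
proof -
  \<comment> \<open>The six sums and differences become opaque names, and one instance of
    antisymmetry per pair of names fixes the orientation of every B; an identity of linear
    combinations remains.\<close>
  define p1 where "p1 = a + b" define p2 where "p2 = a - b"
  define p3 where "p3 = b + c" define p4 where "p4 = b - c"
  define p5 where "p5 = c + a" define p6 where "p6 = c - a"
  note an =
    anti[of a b] anti[of a c] anti[of b c]
    anti[of a p1] anti[of a p2] anti[of a p3] anti[of a p4] anti[of a p5] anti[of a p6]
    anti[of b p1] anti[of b p2] anti[of b p3] anti[of b p4] anti[of b p5] anti[of b p6]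
    anti[of c p1] anti[of c p2] anti[of c p3] anti[of c p4] anti[of c p5] anti[of c p6]
    anti[of p1 p2] anti[of p1 p3] anti[of p1 p4] anti[of p1 p5] anti[of p1 p6]
    anti[of p2 p3] anti[of p2 p4] anti[of p2 p5] anti[of p2 p6]
    anti[of p3 p4] anti[of p3 p5] anti[of p3 p6] anti[of p4 p5] anti[of p4 p6] anti[of p5 p6]
  have s: "S_sym a b = B a b + B b p1 + B p1 a + B a b + B b p2 + B p2 a"
     "S_sym b c = B b c + B c p3 + B p3 b + B b c + B c p4 + B p4 b"
     "S_sym c a = B c a + B a p5 + B p5 c + B c a + B a p6 + B p6 c"
    by (simp_all add: S_sym_def S_def S3_def even even2 p1_def p2_def p3_def p4_def p5_def p6_def)
  show ?thesis
    unfolding s unfolding wp_comb_def p1_def[symmetric] p2_def[symmetric] p3_def[symmetric]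
      p4_def[symmetric] p5_def[symmetric] p6_def[symmetric] S3_def
    by (simp add: an B_self algebra_simps)
qed

definition box where "box = {0..<int N} \<times> {0..<int N}"

text \<open>Any system of representatives modulo N gives the same sum of a periodic function;
  \<open>red\<close> returns to the one in \<open>box\<close>.\<close>

lemma sum_shift:
  fixes F :: "int \<times> int \<Rightarrow> ('k \<Rightarrow>\<^sub>0 int)"
  assumes "\<And>x i j. F (x + (int N * i, int N * j)) = F x"
  shows "(\<Sum>x\<in>box. F (x + d)) = sum F box" "(\<Sum>x\<in>box. F (d - x)) = sum F box"
proof -
  define red where "red x = (fst x mod int N, snd x mod int N)" for x :: "int \<times> int"
  have F: "F (red x) = F x" for x
  proof -
    have "x = red x + (int N * (fst x div int N), int N * (snd x div int N))"
      by (simp add: red_def prod_eq_iff)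
    thus ?thesis by (metis assms)
  qed
  have red_box: "red x \<in> box" for x using N by (simp add: red_def box_def)
  have red_id: "red x = x" if "x \<in> box" for x using that by (auto simp: red_def box_def)
  have r1: "red (red x + y) = red (x + y)" "red (red x - y) = red (x - y)" "red (y - red x) = red (y - x)" for x y
    by (simp_all add: red_def mod_simps)
  show "(\<Sum>x\<in>box. F (x + d)) = sum F box"
    by (rule sum.reindex_bij_witness[of _ "\<lambda>x. red (x - d)" "\<lambda>x. red (x + d)"])
       (auto simp: F r1 red_box red_id)
  show "(\<Sum>x\<in>box. F (d - x)) = sum F box"
    by (rule sum.reindex_bij_witness[of _ "\<lambda>x. red (d - x)" "\<lambda>x. red (d - x)"])
       (auto simp: F r1 red_box red_id)
qed

lemma S_per: "S x (y + (int N * i, int N * j)) = S x y"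
  by (simp add: S_def S3_def per per2 add.assoc[symmetric])

lemma S_neg: "S (- x) (- y) = S x y"
  using even[of "x + y"] even2[of _ "x + y"] by (simp add: S_def S3_def even even2)

lemma S_swap: "S y x = - S x y"
  by (simp add: S_def S3_def add.commute[of y x] anti[of y x] anti[of y "x + y"] anti[of x "x + y"])

text \<open>By evenness -(x + y) counts as x + y, so the cyclic sum runs through the same three
  points in the opposite order.\<close>

lemma S_third: "S x (- (x + y)) = - S x y"
proof -
  have "S x (- (x + y)) = B x (x + y) + B (x + y) y + B y x"
    unfolding S_def S3_def by (simp add: even even2 del: minus_add_distrib)
  thus ?thesis
    by (simp add: S_def S3_def anti[of x y] anti[of y "x + y"] anti[of "x + y" x])
qed

lemma S_minus2: "S (- x) y = S x (- y)"
  using S_neg[of x "- y"] by simp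

text \<open>The reflection c -> -b - c permutes the residues and changes the sign of S b c by
  \<open>S_third\<close>.\<close>

lemma sum_S: "(\<Sum>c\<in>box. S b c) = 0"
proof (rule self0)
  have "(\<Sum>c\<in>box. S b c) = (\<Sum>c\<in>box. S b (- b - c))"
    by (rule sum_shift(2)[symmetric]) (rule S_per)
  also have "\<dots> = (\<Sum>c\<in>box. - S b c)"
    using S_third[of b] by (intro sum.cong refl) (metis minus_add_distrib diff_conv_add_uminus)
  finally show "(\<Sum>c\<in>box. S b c) = - (\<Sum>c\<in>box. S b c)" by (simp add: sum_negf)
qed

lemma sum_S_shift: "(\<Sum>c\<in>box. S b (c + d)) = 0" "(\<Sum>c\<in>box. S b (d - c)) = 0"
  using sum_shift[of "S b" d] S_per sum_S by simp_all

lemma sum_const: "(\<Sum>c\<in>box. f) = frag_cmul (int N * int N) (f :: 'k \<Rightarrow>\<^sub>0 int)"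
proof -
  have "(\<Sum>c\<in>A. f) = frag_cmul (int (card A)) f" if "finite A" for A :: "(int \<times> int) set"
    using that by induction (auto simp: frag_cmul_distrib)
  moreover have "card box = N * N" by (simp add: box_def)
  ultimately show ?thesis by (simp add: box_def)
qed

lemma satNN: "frag_cmul (int N * int N) f \<in> H \<Longrightarrow> f \<in> H"
  using satN[of "frag_cmul (int N) f"] satN[of f] by simp

lemma S_sym_mem: "S_sym a b \<in> H"
proof -
  \<comment> \<open>Each of the four mixed terms is S with a fixed first point and a translate or
    reflection of c as second point, so its sum over c vanishes.\<close>
  define G where "G c = S3 (a + b) (b + c) (c - a) + S3 (a + b) (b - c) (c + a) + S3 (a - b) (b + c) (c + a) +
     S3 (a - b) (b - c) (c - a)" for c
  have G: "G c = S (a + b) (- b - c) + S (a + b) (c - b) + S (a - b) (c + b) + S (a - b) (b - c)" for c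
  proof -
    have "S3 (a + b) (b + c) (c - a) = S (a + b) (- b - c)"
      using swap2[of _ c a] swap1[of c a] even2[of _ "b + c"] even[of "b + c"]
      by (simp add: S_def S3_def algebra_simps)
    moreover have "S3 (a + b) (b - c) (c + a) = S (a + b) (c - b)"
      using swap2[of _ b c] swap1[of b c] by (simp add: S_def S3_def algebra_simps)
    moreover have "S3 (a - b) (b + c) (c + a) = S (a - b) (c + b)"
      by (simp add: S_def S3_def algebra_simps)
    moreover have "S3 (a - b) (b - c) (c - a) = S (a - b) (b - c)"
      using swap2[of _ c a] swap1[of c a] by (simp add: S_def S3_def algebra_simps)
    ultimately show ?thesis by (simp add: G_def)
  qed
  have n: "(\<Sum>c\<in>box. S (a + b) (- b - c)) = 0" "(\<Sum>c\<in>box. S (a + b) (c - b)) = 0"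
    "(\<Sum>c\<in>box. S (a - b) (c + b)) = 0" "(\<Sum>c\<in>box. S (a - b) (b - c)) = 0"
    using sum_S_shift[of "a + b" "- b"] sum_S_shift[of "a - b" b] by simp_all
  hence G0: "(\<Sum>c\<in>box. G c) = 0"
    unfolding G by (simp add: sum.distrib)
  have m: "(\<Sum>c\<in>box. S x (- c)) = 0" for x using sum_S_shift(2)[of x 0] by simp
  have m1: "(\<Sum>c\<in>box. S_sym b c) = 0"
    unfolding S_sym_def by (simp add: sum.distrib sum_S m)
  have "S_sym c a = - S a c - S a (- c)" for c
    unfolding S_sym_def by (simp add: S_swap[of c a] S_swap[of c "- a"] S_minus2)
  hence m2: "(\<Sum>c\<in>box. S_sym c a) = 0"
    by (simp add: sum_subtractf sum_negf sum_S m)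
  have "(\<Sum>c\<in>box. G c + (S_sym a b + S_sym b c + S_sym c a) + (S_sym a b + S_sym b c + S_sym c a)) \<in> H"
    by (intro Hsum) (use T[unfolded T_expand] in \<open>simp add: G_def\<close>)
  hence "frag_cmul (int N * int N) (S_sym a b) + frag_cmul (int N * int N) (S_sym a b) \<in> H"
    by (simp only: sum.distrib G0 m1 m2 sum_const add_0_left add_0_right)
  hence "frag_cmul (int N * int N) (S_sym a b) \<in> H" by (rule sat2)
  thus ?thesis by (rule satNN)
qed

text \<open>This is \<open>S_sym_mem\<close> for the points x and x + y, rewritten with
  \<open>S_third\<close>.\<close>

lemma S_add: "S x (x + y) - S x y \<in> H"
  using S_sym_mem[of x "x + y"] S_third[of x y] by (simp add: S_sym_def)

lemma S_mem: "S u v \<in> H"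
proof -
  \<comment> \<open>The substitution t -> v - t changes v - 2t into its negative, so twice the sum
    is a sum of values of \<open>S_sym\<close>.\<close>
  have tau: "(\<Sum>t\<in>box. S u (v - t - t)) \<in> H" for u v
  proof (rule sat2)
    have "S u (v - (t + (int N * i, int N * j)) - (t + (int N * i, int N * j))) = S u (v - t - t)" for t i j
    proof -
      have "v - (t + (int N * i, int N * j)) - (t + (int N * i, int N * j)) =
          (v - t - t) + (int N * (- 2 * i), int N * (- 2 * j))"
        by (simp add: prod_eq_iff algebra_simps)
      thus ?thesis by (simp only: S_per)
    qed
    hence "(\<Sum>t\<in>box. S u (v - t - t)) = (\<Sum>t\<in>box. S u (v - (v - t) - (v - t)))"
      by (rule sum_shift(2)[symmetric, of "\<lambda>t. S u (v - t - t)" v])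
    also have "\<dots> = (\<Sum>t\<in>box. S u (- (v - t - t)))"
      by (simp add: algebra_simps)
    finally have "(\<Sum>t\<in>box. S u (v - t - t)) + (\<Sum>t\<in>box. S u (v - t - t)) = (\<Sum>t\<in>box. S_sym u (v - t - t))"
      unfolding S_sym_def sum.distrib by simp
    also have "\<dots> \<in> H" by (intro Hsum S_sym_mem)
    finally show "(\<Sum>t\<in>box. S u (v - t - t)) + (\<Sum>t\<in>box. S u (v - t - t)) \<in> H" .
  qed
  have *: "S u v - S u (v - t - t) + S v (u - t - t) - S (v - u) (u - t - t) \<in> H" for t
  proof -
    \<comment> \<open>This choice keeps a + b = u and b + c = v fixed while a - b and b - c move
      with 2t.\<close>
    define a b c where "a = u - t" and "b = t" and "c = v - t"
    have e: "a + b = u" "b + c = v" "c - a = v - u" "a - b = u - t - t" "b - c = - (v - t - t)"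
        "c + a = u + (v - t - t)"
      by (auto simp: a_def b_def c_def)
    define w where "w = v - t - t"
    have "S3 u v (v - u) = S u (- v)"
      using swap2[of _ u v] swap1[of u v] by (simp add: S_def S3_def even even2)
    moreover have "S3 u (- w) (u + w) = S u w"
      by (simp add: S_def S3_def even even2)
    moreover have "S3 (u - t - t) v (u + w) = S (u - t - t) v"
      by (simp add: S_def S3_def w_def algebra_simps)
    moreover have "S3 (u - t - t) (- w) (v - u) = S (u - t - t) (- w)"
      using swap2[of _ v u] swap1[of v u] by (simp add: S_def S3_def w_def algebra_simps)
    ultimately have 1: "S u (- v) + S u w + S (u - t - t) v + S (u - t - t) (- w) +
        (S_sym a b + S_sym b c + S_sym c a) + (S_sym a b + S_sym b c + S_sym c a) \<in> H"
      using T[of b c a, unfolded T_expand e] by (simp add: w_def)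
    have 2: "(S_sym a b + S_sym b c + S_sym c a) + (S_sym a b + S_sym b c + S_sym c a) \<in> H"
      by (intro Hadd S_sym_mem)
    \<comment> \<open>In this term t occurs in both arguments. As w = (u - 2t) + (v - u),
      \<open>S_add\<close> replaces w by v - u, and then every sum over t has the shape covered by
      \<open>tau\<close>.\<close>
    have 3: "S (u - t - t) w - S (u - t - t) (v - u) \<in> H"
      using S_add[of "u - t - t" "v - u"] by (simp add: w_def algebra_simps)
    have "(S_sym u v + S_sym (u - t - t) w) - (S (u - t - t) w - S (u - t - t) (v - u)) -
       ((S u (- v) + S u w + S (u - t - t) v + S (u - t - t) (- w) +
        (S_sym a b + S_sym b c + S_sym c a) + (S_sym a b + S_sym b c + S_sym c a)) -
        ((S_sym a b + S_sym b c + S_sym c a) + (S_sym a b + S_sym b c + S_sym c a))) \<in> H"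
      by (intro Hadd Hdiff S_sym_mem 1 2 3)
    also have "(S_sym u v + S_sym (u - t - t) w) - (S (u - t - t) w - S (u - t - t) (v - u)) -
       ((S u (- v) + S u w + S (u - t - t) v + S (u - t - t) (- w) +
        (S_sym a b + S_sym b c + S_sym c a) + (S_sym a b + S_sym b c + S_sym c a)) -
        ((S_sym a b + S_sym b c + S_sym c a) + (S_sym a b + S_sym b c + S_sym c a))) =
       S u v - S u w - S (u - t - t) v + S (u - t - t) (v - u)"
      by (simp add: S_sym_def algebra_simps)
    finally show ?thesis
      by (simp add: w_def S_swap[of "u - t - t" v] S_swap[of "u - t - t" "v - u"])
  qed
  have "(\<Sum>t\<in>box. S u v - S u (v - t - t) + S v (u - t - t) - S (v - u) (u - t - t)) \<in> H"
    by (intro Hsum *)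
  hence *: "frag_cmul (int N * int N) (S u v) - (\<Sum>t\<in>box. S u (v - t - t)) + (\<Sum>t\<in>box. S v (u - t - t))
      - (\<Sum>t\<in>box. S (v - u) (u - t - t)) \<in> H"
    by (simp add: sum.distrib sum_subtractf sum_const)
  have "frag_cmul (int N * int N) (S u v) \<in> H"
    using Hadd[OF Hdiff[OF Hadd[OF * tau[of "v - u" u]] tau[of v u]] tau[of u v]] by simp
  thus ?thesis by (rule satNN)
qed

end

section \<open>From Steinberg relations to three-term relations\<close>

lemma frag_extend_mem:
  assumes "0 \<in> K" "\<And>x y. x \<in> K \<Longrightarrow> y \<in> K \<Longrightarrow> x - y \<in> K" "\<And>k. k \<in> Poly_Mapping.keys g \<Longrightarrow> F k \<in> K"
  shows "frag_extend F g \<in> K"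
proof -
  have "Poly_Mapping.keys g \<subseteq> Poly_Mapping.keys g" by simp
  thus ?thesis
    by (induction g rule: frag_induction) (auto simp: assms frag_extend_diff)
qed

lemma frag_extend_fun_diff: "frag_extend (\<lambda>x. F x - G x) h = frag_extend F h - frag_extend G h"
  unfolding frag_extend_def
  by (simp add: sum_subtractf[symmetric] poly_mapping_eq_iff fun_eq_iff lookup_sum lookup_minus right_diff_distrib)

locale milnor_tensor = steinberg R for R (structure) +
  fixes m :: nat and \<rho> :: rat
  assumes m: "m > 0" and \<rho>: "\<rho> \<in> carrier (Z_inv m)"
begin

lemma K2_m_closed: "x \<in> carrier (K2 R) \<Longrightarrow> y \<in> carrier (K2 R) \<Longrightarrow> x \<otimes>\<^bsub>K2 R\<^esub> y \<in> carrier (K2 R)"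
proof -
  assume "x \<in> carrier (K2 R)" "y \<in> carrier (K2 R)"
  then obtain u v where "u \<in> st_words" "x = cls u" "steinberg_matrix R u = unit_matrix R"
     "v \<in> st_words" "y = cls v" "steinberg_matrix R v = unit_matrix R" unfolding K2_iff by blast
  thus ?thesis unfolding K2_iff K2_mult
    by (intro bexI[of _ "u @ v"]) (simp_all add: cls_mult steinberg_matrix_eq st_act_append)
qed

sublocale KT: Z_inv_tensor "K2 R" m
  by unfold_locales (use m K2_m_closed Z_inv_add[OF m] in auto)

sublocale UT: tensor "units_of R" "Z_inv m"
  by unfold_locales (use Z_inv_add[OF m] in \<open>auto simp: units_of_def\<close>)

lemma milnor_frag_diff_left: "milnor_frag R (f - f') g = milnor_frag R f g - milnor_frag R f' g"
  by (simp add: milnor_frag_def frag_extend_diff)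

lemma milnor_frag_diff_right: "milnor_frag R f (g - g') = milnor_frag R f g - milnor_frag R f g'"
  by (simp add: milnor_frag_def frag_extend_diff case_prod_unfold frag_extend_fun_diff)

text \<open>Together with \<open>milnor_frag_H_right\<close> this is the independence of
  representatives: biadditivity of Milnor's symbol sends relations between units to relations in
  K_2.\<close>

lemma milnor_frag_H_left:
  assumes "f \<in> UT.H" "tfree (units_of R) (Z_inv m) g"
  shows "milnor_frag R f g \<in> KT.H"
proof (rule UT.H_hom[OF assms(1) KT.H_zero KT.H_diff])
  have keys: "v \<in> Units R \<and> s \<in> carrier (Z_inv m)" if "(v, s) \<in> Poly_Mapping.keys g" for v s
    using that assms(2) by (auto simp: tfree_def units_of_def)
  fix x y b assume "x \<in> carrier (units_of R)" "y \<in> carrier (units_of R)" "b \<in> carrier (Z_inv m)"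
  thus "milnor_frag R (frag_of (x \<otimes>\<^bsub>units_of R\<^esub> y, b)) g - milnor_frag R (frag_of (x, b)) g
        - milnor_frag R (frag_of (y, b)) g \<in> KT.H"
    unfolding milnor_frag_def
    by (auto simp: units_of_def frag_extend_fun_diff[symmetric] case_prod_unfold milnor_symbol_mult_left
          intro!: frag_extend_mem[OF KT.H_zero KT.H_diff] KT.H_left milnor_symbol_K2 Z_inv_mult dest!: keys)
next
  have keys: "v \<in> Units R \<and> s \<in> carrier (Z_inv m)" if "(v, s) \<in> Poly_Mapping.keys g" for v s
    using that assms(2) by (auto simp: tfree_def units_of_def)
  fix a x y assume "a \<in> carrier (units_of R)" "x \<in> carrier (Z_inv m)" "y \<in> carrier (Z_inv m)"
  thus "milnor_frag R (frag_of (a, x \<otimes>\<^bsub>Z_inv m\<^esub> y)) g - milnor_frag R (frag_of (a, x)) g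
        - milnor_frag R (frag_of (a, y)) g \<in> KT.H"
    unfolding milnor_frag_def
    by (auto simp: units_of_def frag_extend_fun_diff[symmetric] case_prod_unfold distrib_right
          intro!: frag_extend_mem[OF KT.H_zero KT.H_diff] KT.H_right[simplified] milnor_symbol_K2 Z_inv_mult dest!: keys)
qed (simp_all add: milnor_frag_diff_left, simp add: milnor_frag_def)

lemma milnor_frag_H_right:
  assumes "g \<in> UT.H" "tfree (units_of R) (Z_inv m) f"
  shows "milnor_frag R f g \<in> KT.H"
  unfolding milnor_frag_def
proof (rule frag_extend_mem[OF KT.H_zero KT.H_diff])
  fix k assume k: "k \<in> Poly_Mapping.keys f"
  obtain u r where ur: "k = (u, r)" by force
  have u: "u \<in> Units R" "r \<in> carrier (Z_inv m)" using k assms(2) by (auto simp: ur tfree_def units_of_def)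
  show "(case k of (u, r) \<Rightarrow> frag_extend (\<lambda>(v, s). frag_of (milnor_symbol R u v, r * s)) g) \<in> KT.H"
    unfolding ur prod.case
    by (rule UT.H_hom[OF assms(1) KT.H_zero KT.H_diff])
       (use u in \<open>auto simp: units_of_def frag_extend_diff distrib_left milnor_symbol_mult_right
        intro!: KT.H_right[simplified] KT.H_left milnor_symbol_K2 Z_inv_mult\<close>)
qed

text \<open>\<open>milnor_symbol_inv\<close> is a union over all representatives; independence of
  their choice collapses it to one coset.\<close>

lemma milnor_symbol_inv_pure:
  assumes "u \<in> Units R" "v \<in> Units R" "r \<in> carrier (Z_inv m)" "s \<in> carrier (Z_inv m)"
  shows "milnor_symbol_inv m R (pure_tensor (units_of R) (Z_inv m) u r) (pure_tensor (units_of R) (Z_inv m) v s) =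
      tensor_class (K2 R) (Z_inv m) (frag_of (milnor_symbol R u v, r * s))"
proof -
  have *: "tensor_class (K2 R) (Z_inv m) (milnor_frag R f g) =
      tensor_class (K2 R) (Z_inv m) (frag_of (milnor_symbol R u v, r * s))"
    if fg: "f - frag_of (u, r) \<in> UT.H" "g - frag_of (v, s) \<in> UT.H" for f g
  proof (rule KT.tensor_class_cong)
    have t: "tfree (units_of R) (Z_inv m) (frag_of (u, r))" "tfree (units_of R) (Z_inv m) (frag_of (v, s))"
      using assms by (auto intro!: tfree_frag_of simp: units_of_def)
    have tg: "tfree (units_of R) (Z_inv m) g"
      using tfree_add[OF UT.H_tfree[OF fg(2)] t(2)] by simp
    \<comment> \<open>The representatives are exchanged one after the other: the first against g,
      the second against the pure tensor.\<close>
    have "milnor_frag R (f - frag_of (u, r)) g + milnor_frag R (frag_of (u, r)) (g - frag_of (v, s)) \<in> KT.H"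
      by (intro KT.H_add milnor_frag_H_left[OF fg(1) tg] milnor_frag_H_right[OF fg(2) t(1)])
    moreover have "milnor_frag R (frag_of (u, r)) (frag_of (v, s)) = frag_of (milnor_symbol R u v, r * s)"
      by (simp add: milnor_frag_def)
    ultimately show "milnor_frag R f g - frag_of (milnor_symbol R u v, r * s) \<in> KT.H"
      by (simp add: milnor_frag_diff_left milnor_frag_diff_right)
  qed
  have "frag_of (u, r) \<in> pure_tensor (units_of R) (Z_inv m) u r"
     "frag_of (v, s) \<in> pure_tensor (units_of R) (Z_inv m) v s"
    by (simp_all add: pure_tensor_def UT.mem_tensor_class UT.H_zero)
  moreover have "(\<Union>f\<in>pure_tensor (units_of R) (Z_inv m) u r. \<Union>g\<in>pure_tensor (units_of R) (Z_inv m) v s.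
        tensor_class (K2 R) (Z_inv m) (milnor_frag R f g)) =
     (\<Union>f\<in>pure_tensor (units_of R) (Z_inv m) u r. \<Union>g\<in>pure_tensor (units_of R) (Z_inv m) v s.
        tensor_class (K2 R) (Z_inv m) (frag_of (milnor_symbol R u v, r * s)))"
    by (intro SUP_cong refl *) (simp_all add: pure_tensor_def UT.mem_tensor_class)
  ultimately show ?thesis unfolding milnor_symbol_inv_def by auto
qed

text \<open>The symbols are taken with a fixed scalar \<open>\<rho>\<close>, which will be \<open>1/(12N)\<^sup>2\<close>.\<close>

definition symb where "symb u v = frag_of (milnor_symbol R u v, \<rho>)"

lemma symb_tfree: "u \<in> Units R \<Longrightarrow> v \<in> Units R \<Longrightarrow> tfree (K2 R) (Z_inv m) (symb u v)"
  unfolding symb_def by (intro tfree_frag_of milnor_symbol_K2 \<rho>)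

lemma symb_mult_left: "u \<in> Units R \<Longrightarrow> u' \<in> Units R \<Longrightarrow> v \<in> Units R \<Longrightarrow> symb (u \<otimes> u') v - symb u v - symb u' v \<in> KT.H"
  unfolding symb_def by (simp add: milnor_symbol_mult_left KT.H_left milnor_symbol_K2 \<rho>)

lemma symb_mult_right: "u \<in> Units R \<Longrightarrow> v \<in> Units R \<Longrightarrow> v' \<in> Units R \<Longrightarrow> symb u (v \<otimes> v') - symb u v - symb u v' \<in> KT.H"
  unfolding symb_def by (simp add: milnor_symbol_mult_right KT.H_left milnor_symbol_K2 \<rho>)

lemma symb_one_K2: "frag_of (\<one>\<^bsub>K2 R\<^esub>, \<rho>) \<in> KT.H"
proof -
  \<comment> \<open>Writing 1 as the symbol {1, -1} shows that it lies in the carrier of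
    K_2.\<close>
  have o: "\<one>\<^bsub>K2 R\<^esub> = milnor_symbol R \<one> (\<ominus> \<one>)" by (simp add: milnor_symbol_minus)
  hence "\<one>\<^bsub>K2 R\<^esub> \<in> carrier (K2 R)" by (simp add: milnor_symbol_K2)
  moreover have "\<one>\<^bsub>K2 R\<^esub> \<otimes>\<^bsub>K2 R\<^esub> \<one>\<^bsub>K2 R\<^esub> = \<one>\<^bsub>K2 R\<^esub>" by (simp add: K2_mult K2_one)
  ultimately have "- frag_of (\<one>\<^bsub>K2 R\<^esub>, \<rho>) \<in> KT.H"
    using KT.H_left[of "\<one>\<^bsub>K2 R\<^esub>" "\<one>\<^bsub>K2 R\<^esub>" \<rho>] \<rho> by simp
  from KT.H_neg[OF this] show ?thesis by simp
qed

lemma symb_steinberg: "u \<in> Units R \<Longrightarrow> v \<in> Units R \<Longrightarrow> u \<oplus> v = \<one> \<Longrightarrow> symb u v \<in> KT.H"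
  unfolding symb_def by (simp add: milnor_symbol_steinberg symb_one_K2)

lemma symb_skew: "u \<in> Units R \<Longrightarrow> v \<in> Units R \<Longrightarrow> symb u v + symb v u \<in> KT.H"
proof -
  assume u: "u \<in> Units R" "v \<in> Units R"
  have "frag_of (milnor_symbol R u v \<otimes>\<^bsub>K2 R\<^esub> milnor_symbol R v u, \<rho>) - symb u v - symb v u \<in> KT.H"
    unfolding symb_def using u by (intro KT.H_left milnor_symbol_K2 \<rho>)
  from KT.H_diff[OF symb_one_K2 this] show ?thesis using u by (simp add: milnor_symbol_skew add.commute)
qed

text \<open>Antisymmetrising makes the relation \<open>B(v, u) = - B(u, v)\<close> hold already in the free abelian group, at the cost of a factor 2, which is invertible.\<close>

definition alt_symb where "alt_symb u v = symb u v - symb v u"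

lemma alt_symb_anti: "alt_symb v u = - alt_symb u v" by (simp add: alt_symb_def)

lemma alt_symb_mult_left:
  assumes "u \<in> Units R" "u' \<in> Units R" "v \<in> Units R"
  shows "alt_symb (u \<otimes> u') v - (alt_symb u v + alt_symb u' v) \<in> KT.H"
  using KT.H_diff[OF symb_mult_left[OF assms] symb_mult_right[OF assms(3,1,2)]] by (simp add: alt_symb_def algebra_simps)

lemma alt_symb_one_left: "v \<in> Units R \<Longrightarrow> alt_symb \<one> v \<in> KT.H"
  using KT.H_neg[OF alt_symb_mult_left[of \<one> \<one> v]] by simp

lemma alt_symb_inv_left:
  assumes "u \<in> Units R" "v \<in> Units R" shows "alt_symb (inv u) v + alt_symb u v \<in> KT.H"
  using KT.H_diff[OF alt_symb_one_left[OF assms(2)] alt_symb_mult_left[of "inv u" u v]] assms by (simp add: add.commute)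

lemma alt_symb_pow_left:
  assumes "u \<in> Units R" "v \<in> Units R"
  shows "alt_symb (u [^] n) v - frag_cmul (int n) (alt_symb u v) \<in> KT.H"
proof (induction n)
  case 0
  then show ?case using alt_symb_one_left[OF assms(2)] by simp
next
  case (Suc n)
  have "u [^] n \<in> Units R" using assms by (simp add: Units_pow_closed)
  from KT.H_add[OF alt_symb_mult_left[OF this assms] Suc] show ?case
    by (simp add: frag_cmul_distrib algebra_simps)
qed

text \<open>The multiplicative counterpart of \<open>wp_comb\<close>, that is, f_ab for the family
  F.\<close>

definition wp_quot where "wp_quot F a b = F (a + b) \<otimes> F (a - b) \<otimes> inv (F a \<otimes> F a \<otimes> F b \<otimes> F b)"

lemma alt_symb_wp_quot:
  assumes "\<And>x :: int \<times> int. F x \<in> Units R" "v \<in> Units R"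
  shows "alt_symb (wp_quot F a b) v - wp_comb (\<lambda>x. alt_symb (F x) v) a b \<in> KT.H"
proof -
  define p where "p = F a \<otimes> F a"
  define q where "q = p \<otimes> F b"
  define r where "r = q \<otimes> F b"
  define t where "t = F (a + b) \<otimes> F (a - b)"
  have U: "p \<in> Units R" "q \<in> Units R" "r \<in> Units R" "t \<in> Units R"
    using assms by (auto simp: p_def q_def r_def t_def)
  note X = alt_symb_mult_left[OF _ _ assms(2)]
  have "alt_symb (t \<otimes> inv r) v - (alt_symb t v + alt_symb (inv r) v) \<in> KT.H" "alt_symb (inv r) v + alt_symb r v \<in> KT.H"
    "alt_symb t v - (alt_symb (F (a + b)) v + alt_symb (F (a - b)) v) \<in> KT.H"
    "alt_symb r v - (alt_symb q v + alt_symb (F b) v) \<in> KT.H" "alt_symb q v - (alt_symb p v + alt_symb (F b) v) \<in> KT.H"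
    "alt_symb p v - (alt_symb (F a) v + alt_symb (F a) v) \<in> KT.H"
    using U assms X alt_symb_inv_left by (auto simp: p_def q_def r_def t_def)
  note KT.H_diff[OF KT.H_diff[OF KT.H_diff[OF KT.H_add[OF KT.H_add[OF this(1,2)] this(3)] this(4)] this(5)] this(6)]
  thus ?thesis by (simp add: wp_comb_def wp_quot_def p_def q_def r_def t_def algebra_simps)
qed

lemma wp_comb_mem:
  assumes "\<And>x. F x - G x \<in> KT.H" shows "wp_comb F a b - wp_comb G a b \<in> KT.H"
proof -
  have "(F (a + b) - G (a + b)) + (F (a - b) - G (a - b)) - (F a - G a) - (F a - G a) - (F b - G b) - (F b - G b) \<in> KT.H"
    by (intro KT.H_add KT.H_diff assms)
  thus ?thesis by (simp add: wp_comb_def algebra_simps)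
qed

lemma wp_comb_neg: "wp_comb (\<lambda>x. - F x) a b = - wp_comb F a b"
  by (simp add: wp_comb_def)

lemma alt_symb_wp_quot_wp_quot:
  assumes "\<And>x :: int \<times> int. F x \<in> Units R" 
  shows "alt_symb (wp_quot F a b) (wp_quot F c d) - wp_comb (\<lambda>x. wp_comb (\<lambda>y. alt_symb (F x) (F y)) c d) a b \<in> KT.H"
proof -
  have U: "wp_quot F c d \<in> Units R" for c d using assms by (simp add: wp_quot_def)
  have "wp_comb (\<lambda>x. alt_symb (F x) (wp_quot F c d)) a b - wp_comb (\<lambda>x. wp_comb (\<lambda>y. alt_symb (F x) (F y)) c d) a b \<in> KT.H"
  proof (rule wp_comb_mem)
    fix x
    have "- (alt_symb (wp_quot F c d) (F x) - wp_comb (\<lambda>y. alt_symb (F y) (F x)) c d) \<in> KT.H"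
      by (rule KT.H_neg[OF alt_symb_wp_quot[of F, OF assms assms]])
    moreover have "wp_comb (\<lambda>y. alt_symb (F x) (F y)) c d = - wp_comb (\<lambda>y. alt_symb (F y) (F x)) c d"
      by (simp add: wp_comb_neg[symmetric] alt_symb_anti[of "F x"])
    ultimately show "alt_symb (F x) (wp_quot F c d) - wp_comb (\<lambda>y. alt_symb (F x) (F y)) c d \<in> KT.H"
      by (simp add: alt_symb_anti[of "F x"])
  qed
  from KT.H_add[OF alt_symb_wp_quot[of F "wp_quot F c d" a b, OF assms U] this] show ?thesis by simp
qed

text \<open>The equation u + v = 1 holds only for the n-th roots u, v of f/h and g/h, but the symbol
  of f/h and g/h is n^2 times that of u and v. Expanding it, with {h, h} = 0 for the antisymmetrised
  symbol, gives the cyclic sum.\<close>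

lemma alt_symb_triple:
  assumes "f \<in> Units R" "g \<in> Units R" "h \<in> Units R" "u \<in> Units R" "v \<in> Units R" "u \<oplus> v = \<one>"
    and "u [^] (n :: nat) = f \<otimes> inv h" "v [^] n = g \<otimes> inv h"
  shows "alt_symb f g + alt_symb g h + alt_symb h f \<in> KT.H"
proof -
  have un: "u [^] n \<in> Units R" "v [^] n \<in> Units R" using assms by (simp_all add: Units_pow_closed)
  have cm: "frag_cmul (int n) x \<in> KT.H" if "x \<in> KT.H" for x by (rule KT.H_cmul[OF that])
  have "alt_symb u v \<in> KT.H" unfolding alt_symb_def
    using assms a_comm[of v u] by (intro KT.H_diff symb_steinberg) (simp_all add: Units_closed)
  hence "alt_symb v u \<in> KT.H" using KT.H_neg alt_symb_anti by metis
  hence "alt_symb (v [^] n) u \<in> KT.H"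
    using KT.H_add[OF alt_symb_pow_left[OF assms(5,4), of n] cm[of "alt_symb v u"]] by simp
  hence "alt_symb u (v [^] n) \<in> KT.H" using KT.H_neg alt_symb_anti by metis
  hence "alt_symb (u [^] n) (v [^] n) \<in> KT.H"
    using KT.H_add[OF alt_symb_pow_left[OF assms(4) un(2), of n] cm[of "alt_symb u (v [^] n)"]] by simp
  hence main: "alt_symb (f \<otimes> inv h) (g \<otimes> inv h) \<in> KT.H" using assms by simp
  have ih: "inv h \<in> Units R" "g \<otimes> inv h \<in> Units R" using assms by auto
  have e: "alt_symb x (g \<otimes> inv h) - alt_symb x g + alt_symb x h \<in> KT.H" if x: "x \<in> Units R" for x
  proof -
    note KT.H_diff[OF KT.H_neg[OF alt_symb_mult_left[OF assms(2) ih(1) x]] alt_symb_inv_left[OF assms(3) x]]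
    thus ?thesis by (simp add: alt_symb_anti[of x] algebra_simps)
  qed
  have hh: "alt_symb h h = 0" by (simp add: alt_symb_def)
  note KT.H_add[OF KT.H_diff[OF KT.H_diff[OF KT.H_diff[OF main alt_symb_mult_left[OF assms(1) ih]]
      alt_symb_inv_left[OF assms(3) ih(2)]] e[OF assms(1)]] e[OF assms(3)]]
  thus ?thesis by (simp add: hh alt_symb_anti[of f h] alt_symb_anti[of h g] algebra_simps)
qed


text \<open>The formal part of the argument for a family of units F. All arithmetic input sits in
  \<open>ex\<close>, which is demanded only for triples where none of the points, sums and
  differences is 0 modulo N.\<close>

theorem three_term:
  fixes N :: nat and F :: "int \<times> int \<Rightarrow> 'a" and a b c :: "int \<times> int"
  assumes N: "N \<ge> 1" "N dvd m" "2 dvd m"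
    and F: "\<And>x. F x \<in> Units R" and even: "\<And>x. F (- x) = F x"
    and per: "\<And>x i j. F (x + (int N * i, int N * j)) = F x"
    and F0: "F 0 = \<one>"
    and ex: "\<And>a b c. \<lbrakk>\<And>i j. (int N * i, int N * j) \<notin> {a, b, c, a + b, a - b, b + c, b - c, c + a, c - a}\<rbrakk> \<Longrightarrow>
       \<exists>u\<in>Units R. \<exists>v\<in>Units R. \<exists>n::nat. u \<oplus> v = \<one> \<and> u [^] n = wp_quot F a b \<otimes> inv (wp_quot F c a) \<and>
         v [^] n = wp_quot F b c \<otimes> inv (wp_quot F c a)"
    and abc: "a + b + c = (int N * i, int N * j)"
  shows "symb (F a) (F b) + symb (F b) (F c) + symb (F c) (F a) \<in> KT.H"
proof -
  have U: "wp_quot F c d \<in> Units R" for c d using F by (simp add: wp_quot_def)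
  have cong: "F x = F y" if "x - y = (int N * i, int N * j)" for x y i j
    using per[of y i j] that by (metis add.commute diff_add_cancel)
  have cong': "F x = F y" if "x + y = (int N * i, int N * j)" for x y i j
    using cong[of x "- y" i j] that even[of y] by simp
  have qt1: "wp_quot F a b = \<one>" if "a = (int N * i, int N * j) \<or> b = (int N * i, int N * j)" for a b i j
  proof -
    have F1: "F (int N * i, int N * j) = \<one>"
      using per[of 0 i j] F0 by simp
    from that show ?thesis
    proof
      assume "a = (int N * i, int N * j)"
      moreover from this have "F (a + b) = F b" "F (a - b) = F b"
        by (auto intro: cong[of _ _ i j] cong'[of _ _ i j])
      ultimately show ?thesis using F1 F[of b] by (simp add: wp_quot_def Units_closed)
    next
      assume b: "b = (int N * i, int N * j)"
      have "F (a + b) = F a" using b by (auto intro: cong[of _ _ i j])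
      moreover have "F (a - b) = F a" by (rule cong[of _ _ "- i" "- j"]) (use b in simp)
      ultimately show ?thesis using F1 b F[of a] by (simp add: wp_quot_def Units_closed)
    qed
  qed
  have wp_quot_sym: "wp_quot F a b = wp_quot F b a" for a b
  proof -
    have "F (a - b) = F (b - a)" using even[of "a - b"] by simp
    moreover have "F a \<otimes> F a \<otimes> F b \<otimes> F b = F b \<otimes> F b \<otimes> F a \<otimes> F a"
      using Units_closed[OF F] by (simp add: m_ac)
    ultimately show ?thesis by (simp add: wp_quot_def add.commute)
  qed
  have wp_quot_cong: "wp_quot F a c = wp_quot F b c" if "a - b = (int N * i, int N * j) \<or> a + b = (int N * i, int N * j)" for a b c i j
    using that
  proof
    assume "a - b = (int N * i, int N * j)"
    moreover from this have "F (a + c) = F (b + c)" "F (a - c) = F (b - c)"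
      by (auto intro: cong[of _ _ i j])
    ultimately show ?thesis using cong[of a b i j] by (simp add: wp_quot_def)
  next
    assume "a + b = (int N * i, int N * j)"
    moreover from this have "F (a + c) = F (b - c)" "F (a - c) = F (b + c)"
      by (auto intro: cong'[of _ _ i j])
    moreover have "F (b - c) \<otimes> F (b + c) = F (b + c) \<otimes> F (b - c)"
      using Units_closed[OF F] by (simp add: m_comm)
    ultimately show ?thesis using cong'[of a b i j] by (simp add: wp_quot_def)
  qed
  \<comment> \<open>The averaging needs T for all triples. If a point is 0 modulo N, two of the
    three quotients are 1. If two points agree up to sign, their quotients with the third point
    coincide and antisymmetry cancels the sum.\<close>
  have T: "alt_symb (wp_quot F a b) (wp_quot F b c) + alt_symb (wp_quot F b c) (wp_quot F c a) + alt_symb (wp_quot F c a) (wp_quot F a b) \<in> KT.H" for a b c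
  proof -
    have B1: "alt_symb \<one> (wp_quot F x y) \<in> KT.H" "alt_symb (wp_quot F x y) \<one> \<in> KT.H" for x y
      using alt_symb_one_left[OF U] KT.H_neg alt_symb_anti by metis+
    have B0: "alt_symb x x = 0" for x by (simp add: alt_symb_def)
    have B2: "alt_symb x y + alt_symb y x = 0" for x y by (simp add: alt_symb_def)
    consider i j where "a = (int N * i, int N * j)" | i j where "b = (int N * i, int N * j)"
      | i j where "c = (int N * i, int N * j)"
      | i j where "a - b = (int N * i, int N * j) \<or> a + b = (int N * i, int N * j)"
      | i j where "b - c = (int N * i, int N * j) \<or> b + c = (int N * i, int N * j)"
      | i j where "c - a = (int N * i, int N * j) \<or> c + a = (int N * i, int N * j)"
      | "\<And>i j. (int N * i, int N * j) \<notin> {a, b, c, a + b, a - b, b + c, b - c, c + a, c - a}"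
      by (smt (verit, best) insert_iff singletonD)
    thus ?thesis
    proof cases
      case (1 i j)
      hence "wp_quot F a b = \<one>" "wp_quot F c a = \<one>" using qt1 by blast+
      thus ?thesis using B1 KT.H_add KT.H_zero by (simp add: B0)
    next
      case (2 i j)
      hence "wp_quot F a b = \<one>" "wp_quot F b c = \<one>" using qt1 by blast+
      thus ?thesis using B1 KT.H_add KT.H_zero by (simp add: B0)
    next
      case (3 i j)
      hence "wp_quot F b c = \<one>" "wp_quot F c a = \<one>" using qt1 by blast+
      thus ?thesis using B1 KT.H_add KT.H_zero by (simp add: B0)
    next
      case (4 i j)
      hence "wp_quot F b c = wp_quot F c a" using wp_quot_cong[of a b i j c] wp_quot_sym by metis
      thus ?thesis using B2 KT.H_zero by (simp add: B0)
    next
      case (5 i j)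
      hence "wp_quot F c a = wp_quot F a b" using wp_quot_cong[of b c i j a] wp_quot_sym by metis
      thus ?thesis using B2 KT.H_zero by (simp add: B0)
    next
      case (6 i j)
      hence "wp_quot F a b = wp_quot F b c" using wp_quot_cong[of c a i j b] wp_quot_sym by metis
      thus ?thesis using B2 KT.H_zero by (simp add: B0)
    next
      case 7
      from ex[OF this] obtain u v and n :: nat where "u \<in> Units R" "v \<in> Units R" "u \<oplus> v = \<one>"
        "u [^] n = wp_quot F a b \<otimes> inv (wp_quot F c a)" "v [^] n = wp_quot F b c \<otimes> inv (wp_quot F c a)"
        by blast
      thus ?thesis by (intro alt_symb_triple[OF U U U])
    qed
  qed
  define B where "B x y = alt_symb (F x) (F y)" for x y
  have sat: "f \<in> KT.H" if "frag_cmul (int n) f \<in> KT.H" "n dvd m" for n f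
  proof -
    \<comment> \<open>A nonzero multiple has the same support, so f is supported on the carrier when
      its multiple is.\<close>
    have "n \<noteq> 0" using that(2) m by (cases "n = 0") auto
    hence "Poly_Mapping.keys f \<subseteq> Poly_Mapping.keys (frag_cmul (int n) f)" by auto
    hence "tfree (K2 R) (Z_inv m) f" using KT.H_tfree[OF that(1)] by (auto simp: tfree_def)
    thus ?thesis using KT.H_saturated_dvd that by blast
  qed
  have sat2: "f \<in> KT.H" if "f + f \<in> KT.H" for f
    using sat[of 2 f] N(3) that by (simp add: frag_cmul_distrib[of 1 1, simplified])
  interpret P: alternating_pairing N B KT.H
  proof
    fix a b c
    have e: "alt_symb (wp_quot F a b) (wp_quot F c d) - wp_comb (\<lambda>x. wp_comb (\<lambda>y. B x y) c d) a b \<in> KT.H" for a b c d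
      unfolding B_def by (rule alt_symb_wp_quot_wp_quot) (rule F)
    show "wp_comb (\<lambda>x. wp_comb (\<lambda>y. B x y) b c) a b + wp_comb (\<lambda>x. wp_comb (\<lambda>y. B x y) c a) b c
        + wp_comb (\<lambda>x. wp_comb (\<lambda>y. B x y) a b) c a \<in> KT.H"
      using KT.H_diff[OF KT.H_diff[OF KT.H_diff[OF T[of a b c] e[of a b b c]] e[of b c c a]] e[of c a a b]]
      by (simp add: algebra_simps)
  qed (use N(1) in \<open>auto simp: B_def even per KT.H_zero KT.H_add KT.H_neg intro: sat2 sat[OF _ N(2)] alt_symb_anti\<close>)
  \<comment> \<open>c is congruent to -(a + b) and evenness removes the sign, so S(a, b) becomes the
    cyclic sum for a, b, c.\<close>
  have Bc: "B x (- (a + b)) = B x c" "B (- (a + b)) x = B c x" for x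
  proof -
    have "F (- (a + b)) = F c"
      by (rule cong[of _ _ "- i" "- j"]) (use abc in \<open>simp add: algebra_simps prod_eq_iff\<close>)
    thus "B x (- (a + b)) = B x c" "B (- (a + b)) x = B c x" by (simp_all add: B_def)
  qed
  have s0: "B a b + B b c + B c a \<in> KT.H"
    using P.S_mem[of a b] Bc[of a] Bc[of b] P.even[of "a + b"] P.even2[of _ "a + b"]
    unfolding P.S_def P.S3_def by simp
  have s: "symb (F a) (F b) + symb (F b) (F a) \<in> KT.H" "symb (F b) (F c) + symb (F c) (F b) \<in> KT.H"
      "symb (F c) (F a) + symb (F a) (F c) \<in> KT.H"
    by (intro symb_skew F)+
  \<comment> \<open>Adding {x, y} + {y, x} to {x, y} - {y, x} gives 2 {x, y} for each of the three
    pairs, and 2 can be divided out.\<close>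
  note KT.H_add[OF KT.H_add[OF KT.H_add[OF s0 s(1)] s(2)] s(3)]
  thus ?thesis
    by (rule sat2[OF back_subst[of "\<lambda>x. x \<in> KT.H"]]) (simp add: B_def alt_symb_def algebra_simps)
qed

text \<open>n times the symbol of z is the symbol of 1, hence zero, and n is invertible.\<close>

lemma symb_torsion:
  assumes "u \<in> Units R" "v \<in> Units R" "z \<in> Units R" "z [^] n = \<one>" "n dvd m"
  shows "symb (z \<otimes> u) v - symb u v \<in> KT.H" "symb v (z \<otimes> u) - symb v u \<in> KT.H"
proof -
  have zn: "z [^] k \<in> Units R" for k :: nat using assms by (simp add: Units_pow_closed)
  have one: "symb \<one> v \<in> KT.H"
    using KT.H_neg[OF symb_mult_left[of \<one> \<one> v]] assms by simp
  have "symb (z [^] k) v - frag_cmul (int k) (symb z v) \<in> KT.H" for k :: nat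
  proof (induction k)
    case (Suc k)
    from KT.H_add[OF symb_mult_left[OF zn[of k] assms(3,2)] Suc] show ?case
      by (simp add: frag_cmul_distrib algebra_simps)
  qed (simp add: one)
  from KT.H_diff[OF one this[of n]] have "frag_cmul (int n) (symb z v) \<in> KT.H"
    using assms by simp
  hence z: "symb z v \<in> KT.H"
    using symb_tfree assms KT.H_saturated_dvd by blast
  show 1: "symb (z \<otimes> u) v - symb u v \<in> KT.H"
    using KT.H_add[OF symb_mult_left[OF assms(3,1,2)] z] by simp
  show "symb v (z \<otimes> u) - symb v u \<in> KT.H"
    using KT.H_diff[OF KT.H_diff[OF symb_skew[of v "z \<otimes> u"] 1] symb_skew[of v u]] assms by simp
qed

end

section \<open>Theta functions\<close>

lemma e2pi_add: "e2pi (x + y) = e2pi x * e2pi y"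
  by (simp add: e2pi_def algebra_simps exp_add)

lemma e2pi_nonzero [simp]: "e2pi x \<noteq> 0"
  by (simp add: e2pi_def)

lemma e2pi_0 [simp]: "e2pi 0 = 1"
  by (simp add: e2pi_def)

lemma e2pi_minus: "e2pi (- x) = inverse (e2pi x)"
  by (simp add: e2pi_def exp_minus)

lemma e2pi_diff: "e2pi (x - y) = e2pi x / e2pi y"
  by (simp add: e2pi_def exp_diff right_diff_distrib)

lemma e2pi_of_int [simp]: "e2pi (of_int n) = 1"
  using exp_integer_2pi[of "of_int n"] by (simp add: e2pi_def mult_ac)

lemma e2pi_eq_1_iff: "e2pi x = 1 \<longleftrightarrow> (\<exists>n. x = of_int n)"
  unfolding e2pi_def exp_eq_1
  by (auto simp: complex_eq_iff)

lemma e2pi_power: "e2pi x ^ n = e2pi (of_nat n * x)"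
  by (simp add: e2pi_def exp_of_nat_mult[symmetric] mult_ac)

lemma norm_e2pi: "norm (e2pi z) = exp (- 2 * pi * Im z)"
  by (simp add: e2pi_def norm_exp_eq_Re)

lemma norm_e2pi_less_1: "Im z > 0 \<Longrightarrow> norm (e2pi z) < 1"
  by (simp add: norm_e2pi)

lemma e2pi_half: "e2pi (1 / 2) = - 1"
  by (simp add: e2pi_def)

lemma e2pi_cong: "x - y = of_int n \<Longrightarrow> e2pi x = e2pi y"
  using e2pi_add[of y "of_int n"] by (simp add: algebra_simps)

lemma holomorphic_on_e2pi [holomorphic_intros]: "f holomorphic_on A \<Longrightarrow> (\<lambda>x. e2pi (f x)) holomorphic_on A"
  unfolding e2pi_def by (intro holomorphic_intros)

lemma has_field_derivative_e2pi: "(e2pi has_field_derivative (2 * of_real pi * \<i> * e2pi z)) (at z within A)"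
  unfolding e2pi_def by (auto intro!: derivative_eq_intros)

text \<open>The q-Pochhammer symbol (s; q)_infinity.\<close>

definition qprod :: "complex \<Rightarrow> complex \<Rightarrow> complex" where
  "qprod s q = prodinf (\<lambda>n. 1 - q ^ n * s)"

lemma convergent_qprod:
  fixes q :: complex
  assumes "norm q < 1" shows "convergent_prod (\<lambda>n. 1 - q ^ n * s)"
proof (intro abs_convergent_prod_imp_convergent_prod summable_imp_abs_convergent_prod)
  show "summable (\<lambda>n. norm (1 - q ^ n * s - 1))"
    using assms by (simp add: norm_mult norm_power summable_mult2 summable_geometric)
qed

lemma qprod_LIMSEQ:
  assumes "norm q < 1" shows "(\<lambda>M. \<Prod>n<M. 1 - q ^ n * s) \<longlonglongrightarrow> qprod s q"
  using convergent_prod_LIMSEQ[OF convergent_qprod[OF assms, of s]]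
  unfolding qprod_def lessThan_Suc_atMost[symmetric]
  using filterlim_sequentially_Suc[of "\<lambda>M. \<Prod>n<M. 1 - q ^ n * s"] by blast

lemma qprod_rec:
  assumes "norm q < 1" shows "qprod s q = (1 - s) * qprod (q * s) q"
proof (rule LIMSEQ_unique)
  show "(\<lambda>M. \<Prod>n<Suc M. 1 - q ^ n * s) \<longlonglongrightarrow> qprod s q"
    by (rule LIMSEQ_Suc[OF qprod_LIMSEQ[OF assms]])
  have "(\<Prod>n<Suc M. 1 - q ^ n * s) = (1 - s) * (\<Prod>n<M. 1 - q ^ n * (q * s))" for M
    by (simp add: prod.lessThan_Suc_shift mult_ac del: prod.lessThan_Suc)
  thus "(\<lambda>M. \<Prod>n<Suc M. 1 - q ^ n * s) \<longlonglongrightarrow> (1 - s) * qprod (q * s) q"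
    using tendsto_mult_left[OF qprod_LIMSEQ[OF assms, of "q * s"], of "1 - s"] by simp
qed

lemma qprod_nonzero: "norm q < 1 \<Longrightarrow> (\<And>n. q ^ n * s \<noteq> 1) \<Longrightarrow> qprod s q \<noteq> 0"
  unfolding qprod_def by (intro prodinf_nonzero convergent_qprod) auto

lemma qprod_minus:
  assumes "norm q < 1" shows "qprod s q * qprod (- s) q = qprod (s\<^sup>2) (q\<^sup>2)"
proof (rule LIMSEQ_unique)
  show "(\<lambda>M. (\<Prod>n<M. 1 - q ^ n * s) * (\<Prod>n<M. 1 - q ^ n * (- s))) \<longlonglongrightarrow> qprod s q * qprod (- s) q"
    by (intro tendsto_mult qprod_LIMSEQ assms)
  have "norm (q\<^sup>2) < 1" using assms by (simp add: norm_power power_less_one_iff)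
  moreover have "(\<Prod>n<M. 1 - q ^ n * s) * (\<Prod>n<M. 1 - q ^ n * (- s)) = (\<Prod>n<M. 1 - (q\<^sup>2) ^ n * s\<^sup>2)" for M
    unfolding prod.distrib[symmetric]
    by (intro prod.cong refl) (simp add: power2_eq_square algebra_simps power_mult_distrib)
  ultimately show "(\<lambda>M. (\<Prod>n<M. 1 - q ^ n * s) * (\<Prod>n<M. 1 - q ^ n * (- s))) \<longlonglongrightarrow> qprod (s\<^sup>2) (q\<^sup>2)"
    using qprod_LIMSEQ[of "q\<^sup>2" "s\<^sup>2"] by simp
qed

lemma qprod_split:
  assumes "norm q < 1" shows "qprod s q = qprod s (q\<^sup>2) * qprod (q * s) (q\<^sup>2)"
proof (rule LIMSEQ_unique)
  have "strict_mono (\<lambda>M::nat. 2 * M)" by (simp add: strict_mono_def)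
  from LIMSEQ_subseq_LIMSEQ[OF qprod_LIMSEQ[OF assms, of s] this]
  show "(\<lambda>M. \<Prod>n<2*M. 1 - q ^ n * s) \<longlonglongrightarrow> qprod s q" by (simp add: o_def)
  have "norm (q\<^sup>2) < 1" using assms by (simp add: norm_power power_less_one_iff)
  moreover have "(\<Prod>n<2*M. 1 - q ^ n * s) = (\<Prod>n<M. 1 - (q\<^sup>2) ^ n * s) * (\<Prod>n<M. 1 - (q\<^sup>2) ^ n * (q * s))" for M
    by (induction M) (simp_all add: power_mult[symmetric] mult_ac)
  ultimately show "(\<lambda>M. \<Prod>n<2*M. 1 - q ^ n * s) \<longlonglongrightarrow> qprod s (q\<^sup>2) * qprod (q * s) (q\<^sup>2)"
    by (simp add: tendsto_mult qprod_LIMSEQ)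
qed

lemma power_mult_neq_1:
  fixes q :: complex assumes "norm q < 1" shows "q ^ n * q \<noteq> 1"
proof
  assume "q ^ n * q = 1"
  moreover have "norm (q ^ n * q) \<le> norm q"
    using assms by (simp add: norm_mult norm_power mult_left_le_one_le power_le_one)
  ultimately show False using assms by simp
qed

text \<open>Euler's identity: the product of (1 - r^(2n-1))(1 + r^(2n-1))(1 + r^(2n)) over n >= 1 is
  1. After multiplication by (r^2; r^2)_infinity the factors pair up by \<open>qprod_minus\<close>
  and are reassembled by \<open>qprod_split\<close>.\<close>

lemma qprod_euler:
  assumes "norm r < 1" shows "qprod r (r\<^sup>2) * qprod (- r) (r\<^sup>2) * qprod (- r\<^sup>2) (r\<^sup>2) = 1"
proof -
  have n: "norm (r\<^sup>2) < 1" using assms by (simp add: norm_power power_less_one_iff)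
  have n2: "norm ((r\<^sup>2)\<^sup>2) < 1" using n by (simp only: norm_power power_less_one_iff) (simp add: power_less_one_iff)
  have "(r\<^sup>2) ^ k * r\<^sup>2 \<noteq> 1" for k by (rule power_mult_neq_1[OF n])
  hence nz: "qprod (r\<^sup>2) (r\<^sup>2) \<noteq> 0" by (rule qprod_nonzero[OF n])
  have "qprod r (r\<^sup>2) * qprod (- r) (r\<^sup>2) * (qprod (r\<^sup>2) (r\<^sup>2) * qprod (- r\<^sup>2) (r\<^sup>2)) =
      qprod (r\<^sup>2) ((r\<^sup>2)\<^sup>2) * qprod ((r\<^sup>2)\<^sup>2) ((r\<^sup>2)\<^sup>2)"
    by (simp only: qprod_minus[OF n])
  also have "\<dots> = qprod (r\<^sup>2) (r\<^sup>2)"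
    using qprod_split[OF n, of "r\<^sup>2"] by (simp add: power2_eq_square)
  finally show ?thesis using nz by (simp add: field_simps)
qed

lemma qprod_uniform_limit:
  assumes K: "compact K" and f: "continuous_on K f" "continuous_on K g" and g: "\<And>x. x \<in> K \<Longrightarrow> norm (g x) < 1"
  shows "uniform_limit K (\<lambda>M x. \<Prod>n<M. 1 - g x ^ n * f x) (\<lambda>x :: complex. qprod (f x) (g x)) sequentially"
proof (cases "K = {}")
  case False
  have "\<exists>x\<in>K. \<forall>y\<in>K. norm (g y) \<le> norm (g x)"
    by (rule continuous_attains_sup[OF K False]) (intro continuous_intros f)
  then obtain \<rho> where \<rho>: "0 \<le> \<rho>" "\<rho> < 1" "\<And>x. x \<in> K \<Longrightarrow> norm (g x) \<le> \<rho>"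
    using g norm_ge_zero by metis
  have "bounded (f ` K)" by (intro compact_imp_bounded compact_continuous_image f K)
  then obtain b where b: "\<And>x. x \<in> K \<Longrightarrow> norm (f x) \<le> b" "b > 0" by (force simp: bounded_pos)
  have "uniformly_convergent_on K (\<lambda>M x. \<Sum>n<M. norm (1 - g x ^ n * f x - 1))"
  proof (rule Weierstrass_m_test'_ev)
    show "summable (\<lambda>n. \<rho> ^ n * b)" using \<rho> by (intro summable_mult2 summable_geometric) auto
    show "\<forall>\<^sub>F n in sequentially. \<forall>x\<in>K. norm (norm (1 - g x ^ n * f x - 1)) \<le> \<rho> ^ n * b"
      using \<rho> b by (intro always_eventually allI ballI) (auto simp: norm_mult norm_power intro!: mult_mono power_mono)
  qed
  hence "uniformly_convergent_on K (\<lambda>M x. \<Prod>n<M. 1 - g x ^ n * f x)"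
    by (intro uniformly_convergent_on_prod' K continuous_intros f)
  then obtain l where l: "uniform_limit K (\<lambda>M x. \<Prod>n<M. 1 - g x ^ n * f x) l sequentially"
    by (auto simp: uniformly_convergent_on_def)
  have "l x = qprod (f x) (g x)" if "x \<in> K" for x
    using tendsto_uniform_limitI[OF l that] qprod_LIMSEQ[OF g[OF that], of "f x"] by (rule LIMSEQ_unique)
  thus ?thesis using l by (metis (no_types, lifting) uniform_limit_cong')
qed auto

lemma holomorphic_on_qprod [holomorphic_intros]:
  assumes S: "open S" and f: "f holomorphic_on S" "g holomorphic_on S" and g: "\<And>x. x \<in> S \<Longrightarrow> norm (g x) < 1"
  shows "(\<lambda>x. qprod (f x) (g x)) holomorphic_on S"
proof (rule holomorphic_uniform_sequence[OF S])
  show "(\<lambda>x. \<Prod>n<M. 1 - g x ^ n * f x) holomorphic_on S" for M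
    by (intro holomorphic_intros f)
  fix x assume "x \<in> S"
  then obtain d where d: "d > 0" "cball x d \<subseteq> S" using S open_contains_cball by blast
  have "uniform_limit (cball x d) (\<lambda>M x. \<Prod>n<M. 1 - g x ^ n * f x) (\<lambda>x. qprod (f x) (g x)) sequentially"
    using d g by (intro qprod_uniform_limit holomorphic_on_imp_continuous_on holomorphic_on_subset[OF f(1)]
       holomorphic_on_subset[OF f(2)]) auto
  thus "\<exists>d>0. cball x d \<subseteq> S \<and> uniform_limit (cball x d) (\<lambda>M x. \<Prod>n<M. 1 - g x ^ n * f x) (\<lambda>x. qprod (f x) (g x)) sequentially"
    using d by blast
qed

text \<open>Up to a constant this is Jacobi's \<open>\<theta>\<^sub>1 / \<eta>\<close>; dividing by \<open>\<eta>\<close> makes the multiplier in its modular transformation a root of unity.\<close>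

definition phi :: "complex \<Rightarrow> complex \<Rightarrow> complex" where
  "phi z \<tau> = e2pi (\<tau> / 12 - z / 2) * qprod (e2pi z) (e2pi \<tau>) * qprod (e2pi (\<tau> - z)) (e2pi \<tau>)"

text \<open>\<open>phi\<close> without the factor 1 - e(z) that causes its zero at z = 0; the value
  at 0 is the derivative of \<open>phi\<close> there up to a constant.\<close>

definition psi :: "complex \<Rightarrow> complex \<Rightarrow> complex" where
  "psi z \<tau> = e2pi (\<tau> / 12 - z / 2) * qprod (e2pi (\<tau> + z)) (e2pi \<tau>) * qprod (e2pi (\<tau> - z)) (e2pi \<tau>)"

section \<open>Quasi-periodicity and zeros of \<open>phi\<close>\<close>

context
  fixes \<tau> :: complex assumes \<tau>: "Im \<tau> > 0"
begin

lemma q_less: "norm (e2pi \<tau>) < 1"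
  using \<tau> by (rule norm_e2pi_less_1)

lemma phi_psi: "phi z \<tau> = (1 - e2pi z) * psi z \<tau>"
  unfolding phi_def psi_def by (subst qprod_rec[OF q_less, of "e2pi z"]) (simp add: e2pi_add)

lemma phi_minus: "phi (- z) \<tau> = - phi z \<tau>"
proof -
  have e: "e2pi (\<tau> / 12 + z / 2) = e2pi (\<tau> / 12 - z / 2) * e2pi z"
    by (simp add: e2pi_add[symmetric] add.commute)
  show ?thesis unfolding phi_psi psi_def by (simp add: e) (simp add: e2pi_minus field_simps)
qed

lemma phi_zero [simp]: "phi 0 \<tau> = 0"
  by (simp add: phi_psi)

lemma phi_add_1: "phi (z + 1) \<tau> = - phi z \<tau>"
proof -
  have "e2pi (z + 1) = e2pi z" "e2pi (\<tau> - (z + 1)) = e2pi (\<tau> - z)"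
    by (rule e2pi_cong[of _ _ 1], simp) (rule e2pi_cong[of _ _ "-1"], simp)
  moreover have "e2pi (\<tau> / 12 - (z + 1) / 2) = - e2pi (\<tau> / 12 - z / 2)"
    using e2pi_add[of "\<tau> / 12 - (z + 1) / 2" "1/2"] by (simp add: e2pi_half add_divide_distrib)
  ultimately show ?thesis by (simp add: phi_def)
qed

lemma phi_add_tau: "phi (z + \<tau>) \<tau> = e2pi (1 / 2 - z - \<tau> / 2) * phi z \<tau>"
proof -
  have "qprod (e2pi (- z)) (e2pi \<tau>) = (1 - e2pi (- z)) * qprod (e2pi (\<tau> - z)) (e2pi \<tau>)"
    by (subst qprod_rec[OF q_less]) (simp add: e2pi_add[symmetric])
  moreover have "\<tau> - (z + \<tau>) = - z" "z + \<tau> = \<tau> + z" by simp_all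
  ultimately have "phi (z + \<tau>) \<tau> = e2pi (\<tau> / 12 - (\<tau> + z) / 2) * qprod (e2pi (\<tau> + z)) (e2pi \<tau>) *
       ((1 - e2pi (- z)) * qprod (e2pi (\<tau> - z)) (e2pi \<tau>))"
    by (simp only: phi_def)
  also have "e2pi (\<tau> / 12 - (\<tau> + z) / 2) = e2pi (\<tau> / 12 - z / 2) * e2pi (- \<tau> / 2)"
    by (simp add: e2pi_add[symmetric] diff_divide_distrib add_divide_distrib)
  also have "1 - e2pi (- z) = - e2pi (- z) * (1 - e2pi z)"
    by (simp add: e2pi_minus field_simps)
  also have "- e2pi (- z) = e2pi (1 / 2) * e2pi (- z)" by (simp add: e2pi_half)
  finally have "phi (z + \<tau>) \<tau> = (e2pi (1 / 2) * e2pi (- z) * e2pi (- \<tau> / 2)) * phi z \<tau>"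
    by (simp add: phi_psi psi_def mult_ac)
  thus ?thesis by (simp add: e2pi_add[symmetric])
qed

lemma phi_add_int: "phi (z + of_int n) \<tau> = e2pi (of_int n / 2) * phi z \<tau>"
proof (induction n rule: int_induct[of _ 0])
  case (step1 i)
  have "e2pi ((of_int i + 1) / 2) = - e2pi (of_int i / 2)"
    by (simp add: add_divide_distrib e2pi_add e2pi_half)
  with step1 phi_add_1[of "z + of_int i"] show ?case by (simp add: algebra_simps)
next
  case (step2 i)
  have "e2pi (of_int i / 2) = - e2pi ((of_int i - 1) / 2)"
    using e2pi_add[of "(of_int i - 1) / 2" "1/2"] by (simp add: diff_divide_distrib e2pi_half)
  with step2 phi_add_1[of "z + of_int (i - 1)"] show ?case by (simp add: algebra_simps)
qed simp

lemma phi_add_int_tau: "phi (z + of_int m * \<tau>) \<tau> = e2pi (of_int m / 2 - of_int m * z - of_int m ^ 2 * \<tau> / 2) * phi z \<tau>"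
proof -
  have ex: "(1 / 2 - (z + of_int i * \<tau>) - \<tau> / 2) + (of_int i / 2 - of_int i * z - of_int i ^ 2 * \<tau> / 2) =
     of_int (i + 1) / 2 - of_int (i + 1) * z - of_int (i + 1) ^ 2 * \<tau> / 2" for i
    by (simp add: field_simps power2_eq_square)
  show ?thesis
  proof (induction m rule: int_induct[of _ 0])
  case (step1 i)
  have "phi (z + of_int (i + 1) * \<tau>) \<tau> = e2pi (1 / 2 - (z + of_int i * \<tau>) - \<tau> / 2) * phi (z + of_int i * \<tau>) \<tau>"
    using phi_add_tau[of "z + of_int i * \<tau>"] by (simp add: algebra_simps)
  also have "\<dots> = e2pi ((1 / 2 - (z + of_int i * \<tau>) - \<tau> / 2) + (of_int i / 2 - of_int i * z - of_int i ^ 2 * \<tau> / 2)) * phi z \<tau>"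
    by (simp only: step1 e2pi_add mult.assoc)
  finally show ?case by (simp only: ex)
next
  case (step2 i)
  define j where "j = i - 1"
  have i: "i = j + 1" by (simp add: j_def)
  have "e2pi (1 / 2 - (z + of_int j * \<tau>) - \<tau> / 2) * phi (z + of_int j * \<tau>) \<tau> = phi (z + of_int i * \<tau>) \<tau>"
    using phi_add_tau[of "z + of_int j * \<tau>"] by (simp add: i algebra_simps)
  also have "\<dots> = e2pi (of_int i / 2 - of_int i * z - of_int i ^ 2 * \<tau> / 2) * phi z \<tau>"
    by (rule step2)
  also have "\<dots> = e2pi (1 / 2 - (z + of_int j * \<tau>) - \<tau> / 2) * (e2pi (of_int j / 2 - of_int j * z - of_int j ^ 2 * \<tau> / 2) * phi z \<tau>)"
    by (simp only: i ex[symmetric] e2pi_add mult.assoc)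
  finally show ?case unfolding j_def[symmetric] by simp
qed simp
qed

lemma phi_lattice: "phi (z + of_int m * \<tau> + of_int n) \<tau> =
    e2pi (of_int (m + n) / 2 - of_int m * z - of_int m ^ 2 * \<tau> / 2) * phi z \<tau>"
proof -
  have "phi (z + of_int m * \<tau> + of_int n) \<tau> =
     e2pi (of_int n / 2 + (of_int m / 2 - of_int m * z - of_int m ^ 2 * \<tau> / 2)) * phi z \<tau>"
    by (simp only: phi_add_int phi_add_int_tau e2pi_add mult.assoc)
  thus ?thesis by (simp add: add_divide_distrib algebra_simps)
qed

lemma psi_zero_nonzero: "psi 0 \<tau> \<noteq> 0"
proof -
  have "e2pi \<tau> ^ n * e2pi \<tau> \<noteq> 1" for n by (rule power_mult_neq_1[OF q_less])
  hence "qprod (e2pi \<tau>) (e2pi \<tau>) \<noteq> 0" by (rule qprod_nonzero[OF q_less])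
  thus ?thesis by (simp add: psi_def)
qed

text \<open>A convergent product vanishes only if one of its factors does, and each factor vanishes
  only at lattice points.\<close>

lemma phi_eq_0_iff: "phi z \<tau> = 0 \<longleftrightarrow> (\<exists>m n. z = of_int m * \<tau> + of_int n)"
proof
  assume "\<exists>m n. z = of_int m * \<tau> + of_int n"
  thus "phi z \<tau> = 0" using phi_lattice[of 0] by auto
next
  assume "phi z \<tau> = 0"
  hence "qprod (e2pi z) (e2pi \<tau>) = 0 \<or> qprod (e2pi (\<tau> - z)) (e2pi \<tau>) = 0" by (simp add: phi_def)
  then consider n where "e2pi \<tau> ^ n * e2pi z = 1" | n where "e2pi \<tau> ^ n * e2pi (\<tau> - z) = 1"
    using qprod_nonzero[OF q_less] by blast
  thus "\<exists>m n. z = of_int m * \<tau> + of_int n"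
  proof cases
    case (1 n)
    then obtain k where "of_nat n * \<tau> + z = of_int k"
      by (auto simp: e2pi_power e2pi_add[symmetric] e2pi_eq_1_iff)
    hence "z = of_int (- int n) * \<tau> + of_int k" by (simp add: algebra_simps)
    thus ?thesis by blast
  next
    case (2 n)
    then obtain k where "of_nat n * \<tau> + (\<tau> - z) = of_int k"
      by (auto simp: e2pi_power e2pi_add[symmetric] e2pi_eq_1_iff)
    hence "z = of_int (int n + 1) * \<tau> + of_int (- k)" by (simp add: algebra_simps)
    thus ?thesis by blast
  qed
qed

lemma phi_holomorphic: "(\<lambda>z. phi z \<tau>) holomorphic_on A"
proof -
  have "(\<lambda>z. phi z \<tau>) holomorphic_on UNIV"
    unfolding phi_def using q_less by (intro holomorphic_intros) auto
  thus ?thesis by (rule holomorphic_on_subset) auto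
qed

lemma psi_holomorphic: "(\<lambda>z. psi z \<tau>) holomorphic_on UNIV"
  unfolding psi_def using q_less by (intro holomorphic_intros) auto

lemma phi_deriv_0: "((\<lambda>z. phi z \<tau>) has_field_derivative (- (2 * of_real pi * \<i>) * psi 0 \<tau>)) (at 0)"
proof -
  have "((\<lambda>z. psi z \<tau>) has_field_derivative deriv (\<lambda>z. psi z \<tau>) 0) (at 0)"
    by (rule holomorphic_derivI[OF psi_holomorphic]) auto
  hence "((\<lambda>z. (1 - e2pi z) * psi z \<tau>) has_field_derivative (- (2 * of_real pi * \<i>) * psi 0 \<tau>)) (at 0)"
    by (auto intro!: derivative_eq_intros has_field_derivative_e2pi)
  thus ?thesis by (simp add: phi_psi)
qed

text \<open>Quasi-periodicity moves any zero to 0, where the derivative is a nonzero multiple of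
  \<open>psi 0 \<tau>\<close>; the exponential factor never vanishes.\<close>

lemma phi_simple_zero: assumes "phi z \<tau> = 0" shows "deriv (\<lambda>z. phi z \<tau>) z \<noteq> 0"
proof -
  obtain m n where z: "z = of_int m * \<tau> + of_int n" using assms phi_eq_0_iff by blast
  define L where "L w = e2pi (of_int (m + n) / 2 - of_int m * (w - z) - of_int m ^ 2 * \<tau> / 2)" for w
  have phi: "phi w \<tau> = L w * phi (w - z) \<tau>" for w
    using phi_lattice[of "w - z" m n] by (simp add: z L_def algebra_simps)
  have L: "(L has_field_derivative deriv L z) (at z)"
    unfolding L_def by (rule holomorphic_derivI[of _ UNIV]) (intro holomorphic_intros, auto)
  have "((\<lambda>w. phi (w - z) \<tau>) has_field_derivative (- (2 * of_real pi * \<i>) * psi 0 \<tau>)) (at z)"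
  proof -
    have d: "((\<lambda>w. w - z) has_field_derivative 1) (at z)" by (auto intro!: derivative_eq_intros)
    show ?thesis
      using DERIV_chain2[of "\<lambda>z. phi z \<tau>" "- (2 * of_real pi * \<i>) * psi 0 \<tau>" "\<lambda>w. w - z" z 1 UNIV] phi_deriv_0 d
      by simp
  qed
  hence "((\<lambda>w. L w * phi (w - z) \<tau>) has_field_derivative (- (2 * of_real pi * \<i>) * psi 0 \<tau>) * L z) (at z)"
    using L by (auto intro!: derivative_eq_intros)
  hence "deriv (\<lambda>z. phi z \<tau>) z = (- (2 * of_real pi * \<i>) * psi 0 \<tau>) * L z"
    by (intro DERIV_imp_deriv) (simp add: phi[symmetric])
  thus ?thesis using psi_zero_nonzero by (simp add: L_def)
qed

end

section \<open>Liouville's theorem for quotients of theta functions\<close>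

lemma removable_quotient_holomorphic:
  fixes f g :: "complex \<Rightarrow> complex"
  assumes hol: "f holomorphic_on UNIV" "g holomorphic_on UNIV"
    and simple: "\<And>z. g z = 0 \<Longrightarrow> f z = 0 \<and> deriv g z \<noteq> 0"
  shows "(\<lambda>z. if g z = 0 then deriv f z / deriv g z else f z / g z) holomorphic_on UNIV"
proof -
  let ?h = "\<lambda>z. if g z = 0 then deriv f z / deriv g z else f z / g z"
  have "?h field_differentiable (at z)" for z
  proof (cases "g z = 0")
    case False
    have op: "open {w. g w \<noteq> 0}"
      using holomorphic_on_imp_continuous_on[OF hol(2)] by (intro open_Collect_neq) auto
    have "(\<lambda>z. f z / g z) holomorphic_on {w. g w \<noteq> 0}"
      by (intro holomorphic_intros holomorphic_on_subset[OF hol(1)] holomorphic_on_subset[OF hol(2)]) auto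
    hence "?h holomorphic_on {w. g w \<noteq> 0}" by (rule holomorphic_transform) auto
    thus ?thesis using op False by (auto simp: holomorphic_on_open field_differentiable_def)
  next
    case True
    \<comment> \<open>At a common zero z the difference quotients of f and g are holomorphic. Their
      quotient agrees with f/g nearby and has the value \<open>deriv f z / deriv g z\<close> at
      z.\<close>
    define F where "F w = (if w = z then deriv f z else (f w - f z) / (w - z))" for w
    define G where "G w = (if w = z then deriv g z else (g w - g z) / (w - z))" for w
    have FG: "F holomorphic_on UNIV" "G holomorphic_on UNIV"
      unfolding F_def G_def by (rule pole_lemma; use hol in simp)+
    have op: "open {w. G w \<noteq> 0}"
      using holomorphic_on_imp_continuous_on[OF FG(2)] by (intro open_Collect_neq) auto
    have "(\<lambda>w. F w / G w) holomorphic_on {w. G w \<noteq> 0}"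
      by (intro holomorphic_intros holomorphic_on_subset[OF FG(1)] holomorphic_on_subset[OF FG(2)]) auto
    hence "?h holomorphic_on {w. G w \<noteq> 0}"
      by (rule holomorphic_transform) (use True simple in \<open>auto simp: F_def G_def\<close>)
    moreover have "G z \<noteq> 0" using simple[OF True] by (simp add: G_def)
    ultimately show ?thesis using op by (auto simp: holomorphic_on_open field_differentiable_def)
  qed
  thus ?thesis by (simp add: holomorphic_on_def)
qed

text \<open>The quotient f/g is doubly periodic because f and g have the same multipliers, and it
  extends to an entire function because the zeros of g are simple and shared by f.\<close>

lemma elliptic_quotient_constant:
  fixes f g :: "complex \<Rightarrow> complex"
  assumes \<tau>: "Im \<tau> > 0" and hol: "f holomorphic_on UNIV" "g holomorphic_on UNIV"
    and simple: "\<And>z. g z = 0 \<Longrightarrow> f z = 0 \<and> deriv g z \<noteq> 0"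
    and u1: "\<And>z. f (z + 1) = u1 z * f z" "\<And>z. g (z + 1) = u1 z * g z" "\<And>z. u1 z \<noteq> 0"
    and u2: "\<And>z. f (z + \<tau>) = u2 z * f z" "\<And>z. g (z + \<tau>) = u2 z * g z" "\<And>z. u2 z \<noteq> 0"
  shows "\<exists>C. \<forall>z. f z = C * g z"
proof -
  define h where "h = (\<lambda>z. if g z = 0 then deriv f z / deriv g z else f z / g z)"
  have h: "h holomorphic_on UNIV"
    unfolding h_def by (rule removable_quotient_holomorphic[OF hol simple])
  \<comment> \<open>Periodicity of h is established away from the zeros of g, where h is the plain
    quotient.\<close>
  define P where "P z w \<longleftrightarrow> (g z \<noteq> 0 \<longleftrightarrow> g w \<noteq> 0) \<and> (g z \<noteq> 0 \<longrightarrow> h z = h w)" for z w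
  have P_trans: "P x y \<Longrightarrow> P y z \<Longrightarrow> P x z" for x y z by (auto simp: P_def)
  have P_sym: "P x y \<Longrightarrow> P y x" for x y by (auto simp: P_def)
  have P1: "P (z + 1) z" "P (z + \<tau>) z" for z
    using u1 u2 by (auto simp: P_def h_def)
  have Pn: "P (z + of_int n) z" for z n
  proof (induction n rule: int_induct[of _ 0])
    case (step1 i)
    show ?case using P_trans[OF P1(1)[of "z + of_int i"] step1(2)] by (simp add: algebra_simps)
  next
    case (step2 i)
    show ?case using P_trans[OF P_sym[OF P1(1)[of "z + of_int (i - 1)"]], of z] step2(2)
      by (simp add: algebra_simps)
  qed (simp add: P_def)
  have Pm: "P (z + of_int n * \<tau>) z" for z n
  proof (induction n rule: int_induct[of _ 0])
    case (step1 i)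
    show ?case using P_trans[OF P1(2)[of "z + of_int i * \<tau>"] step1(2)] by (simp add: algebra_simps)
  next
    case (step2 i)
    show ?case using P_trans[OF P_sym[OF P1(2)[of "z + of_int (i - 1) * \<tau>"]], of z] step2(2)
      by (simp add: algebra_simps)
  qed (simp add: P_def)
  define K where "K = (\<lambda>(s, t). of_real s + of_real t * \<tau>) ` ({0..1} \<times> {0..1})"
  have "compact K" unfolding K_def
    by (intro compact_continuous_image compact_Times compact_Icc)
       (auto simp: case_prod_unfold intro!: continuous_intros)
  hence "compact (h ` K)"
    by (intro compact_continuous_image holomorphic_on_imp_continuous_on holomorphic_on_subset[OF h]) auto
  then obtain B where B: "\<And>z. z \<in> K \<Longrightarrow> norm (h z) \<le> B"
    using compact_imp_bounded bounded_iff by (metis imageI)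
  have 1: "norm (h z) \<le> B" if "g z \<noteq> 0" for z
  proof -
    define t where "t = Im z / Im \<tau>"
    define s where "s = Re z - t * Re \<tau>"
    have z: "z = of_real s + of_real t * \<tau>"
      using \<tau> by (simp add: complex_eq_iff s_def t_def)
    define z0 where "z0 = of_real (frac s) + of_real (frac t) * \<tau>"
    have "z0 \<in> K" unfolding K_def z0_def
      by (rule image_eqI[of _ _ "(frac s, frac t)"]) (auto simp: frac_lt_1 less_imp_le)
    moreover have "z = z0 + of_int \<lfloor>t\<rfloor> * \<tau> + of_int \<lfloor>s\<rfloor>"
      by (simp add: z z0_def frac_def algebra_simps)
    hence "P z z0" using P_trans[OF Pn Pm] by simp
    ultimately show ?thesis using B that by (auto simp: P_def)
  qed
  \<comment> \<open>The set where the bound fails is open and consists of zeros of g, which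
    contradicts their simplicity.\<close>
  have 2: "norm (h z) \<le> B" for z
  proof (rule ccontr)
    assume "\<not> norm (h z) \<le> B"
    define U where "U = {w. norm (h w) > B}"
    have U: "open U" "z \<in> U" unfolding U_def
      using holomorphic_on_imp_continuous_on[OF h] \<open>\<not> norm (h z) \<le> B\<close>
      by (auto intro!: open_Collect_less continuous_intros)
    have "g w = 0" if "w \<in> U" for w using 1[of w] that by (auto simp: U_def)
    hence "deriv g z = deriv (\<lambda>_. 0) z"
      by (intro deriv_cong_ev eventually_mono[OF eventually_nhds_in_open[OF U]]) auto
    thus False using simple[of z] \<open>\<And>w. w \<in> U \<Longrightarrow> g w = 0\<close> U by simp
  qed
  have "h constant_on UNIV"
    using 2 by (intro Liouville_theorem[OF h]) (auto simp: bounded_iff)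
  then obtain C where hC: "\<And>z. h z = C" by (auto simp: constant_on_def)
  have "f z = C * g z" for z
  proof (cases "g z = 0")
    case True
    thus ?thesis using simple[of z] by simp
  next
    case False
    hence "f z / g z = C" using hC[of z] by (simp add: h_def)
    thus ?thesis using False by (simp add: field_simps)
  qed
  thus ?thesis by blast
qed

lemma Im_moebius:
  assumes "a * d - b * c = 1" "Im \<tau> > 0"
  shows "of_int c * \<tau> + of_int d \<noteq> 0" "Im (moebius (a, b, c, d) \<tau>) > 0"
proof -
  show nz: "of_int c * \<tau> + of_int d \<noteq> 0"
  proof
    assume e: "of_int c * \<tau> + of_int d = 0"
    hence "Im (of_int c * \<tau> + of_int d) = 0" by (simp only: zero_complex.sel)
    hence "c = 0" using assms(2) by simp
    with e assms(1) show False by simp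
  qed
  have "Im (moebius (a, b, c, d) \<tau>) = Im \<tau> * of_int (a * d - b * c) / (cmod (of_int c * \<tau> + of_int d))\<^sup>2"
    unfolding cmod_power2 by (simp add: Im_divide algebra_simps power2_eq_square)
  thus "Im (moebius (a, b, c, d) \<tau>) > 0" using assms nz by simp
qed

lemma e2pi_half_int:
  assumes "even (n - m)" shows "e2pi (of_int n / 2 + z) = e2pi (of_int m / 2 + z)"
proof -
  obtain k where k: "n - m = 2 * k" using assms by blast
  hence n: "n = m + 2 * k" by linarith
  have "of_int n / 2 + z - (of_int m / 2 + z) = of_int k" unfolding n by simp
  thus ?thesis by (rule e2pi_cong)
qed

text \<open>As functions of w both sides are theta functions for the lattice Z \<tau> + Z: division
  by J maps it onto the lattice of the transformed point, so the zeros match, and the Gaussian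
  factor makes the multipliers match. C may depend on \<tau> and on the matrix.\<close>

lemma phi_modular:
  assumes det: "a * d - b * c = 1" and \<tau>: "Im \<tau> > 0"
  defines "J \<equiv> of_int c * \<tau> + of_int d"
  shows "\<exists>C. \<forall>w. phi (w / J) (moebius (a, b, c, d) \<tau>) = C * (e2pi (of_int c * w\<^sup>2 / (2 * J)) * phi w \<tau>)"
proof -
  define \<tau>' where "\<tau>' = moebius (a, b, c, d) \<tau>"
  have J: "J \<noteq> 0" and \<tau>': "Im \<tau>' > 0"
    using Im_moebius[OF det \<tau>] by (auto simp: J_def \<tau>'_def)
  have \<tau>'J: "\<tau>' * J = of_int a * \<tau> + of_int b" using J by (simp add: \<tau>'_def J_def)
  have det': "of_int a * of_int d - of_int b * of_int c = (1 :: complex)"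
    using det by (metis of_int_1 of_int_diff of_int_mult)
  \<comment> \<open>1/J and \<tau>/J expand the rescaled old basis in the new lattice, with
    coefficients from the inverse matrix.\<close>
  have J1: "1 / J = of_int a - of_int c * \<tau>'"
  proof -
    have "(of_int a - of_int c * \<tau>') * J = of_int a * J - of_int c * (\<tau>' * J)" by (simp add: algebra_simps)
    also have "\<dots> = 1" unfolding \<tau>'J using det' by (simp add: J_def algebra_simps)
    finally show ?thesis by (rule eq_divide_imp[OF J, symmetric])
  qed
  have J2: "\<tau> / J = of_int d * \<tau>' - of_int b"
  proof -
    have "(of_int d * \<tau>' - of_int b) * J = of_int d * (\<tau>' * J) - of_int b * J" by (simp add: algebra_simps)
    also have "\<dots> = (of_int a * of_int d - of_int b * of_int c) * \<tau>" unfolding \<tau>'J by (simp add: J_def algebra_simps)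
    also have "\<dots> = \<tau>" by (simp only: det' mult_1)
    finally show ?thesis by (rule eq_divide_imp[OF J, symmetric])
  qed
  define f where "f w = phi (w / J) \<tau>'" for w
  define g where "g w = e2pi (of_int c * w\<^sup>2 / (2 * J)) * phi w \<tau>" for w
  define u1 where "u1 w = e2pi (of_int c * w / J + of_int c / (2 * J) + 1 / 2)" for w
  define u2 where "u2 w = e2pi (of_int c * w * \<tau> / J + of_int c * \<tau>\<^sup>2 / (2 * J) + 1 / 2 - w - \<tau> / 2)" for w
  have "\<exists>C. \<forall>w. f w = C * g w"
  proof (rule elliptic_quotient_constant[OF \<tau>])
    show "f holomorphic_on UNIV"
      unfolding f_def
    proof (rule holomorphic_on_compose[OF _ phi_holomorphic[OF \<tau>'], unfolded o_def])
      show "(\<lambda>w. w / J) holomorphic_on UNIV" using J by (intro holomorphic_intros) auto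
    qed
    show "g holomorphic_on UNIV"
      unfolding g_def using J by (intro holomorphic_intros phi_holomorphic[OF \<tau>]) auto
    fix w
    show "u1 w \<noteq> 0" "u2 w \<noteq> 0" by (simp_all add: u1_def u2_def)
    show "g w = 0 \<Longrightarrow> f w = 0 \<and> deriv g w \<noteq> 0"
    proof
      assume "g w = 0"
      hence p: "phi w \<tau> = 0" by (simp add: g_def)
      then obtain m n where w: "w = of_int m * \<tau> + of_int n" using phi_eq_0_iff[OF \<tau>] by blast
      have "w / J = of_int m * (\<tau> / J) + of_int n * (1 / J)" by (simp add: w add_divide_distrib)
      also have "\<dots> = of_int (m * d - n * c) * \<tau>' + of_int (n * a - m * b)"
        unfolding J1 J2 by (simp add: algebra_simps)
      finally show "f w = 0" unfolding f_def using phi_eq_0_iff[OF \<tau>'] by blast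
      have "((\<lambda>z. phi z \<tau>) has_field_derivative deriv (\<lambda>z. phi z \<tau>) w) (at w)"
        by (rule holomorphic_derivI[OF phi_holomorphic[OF \<tau>, of UNIV]]) auto
      moreover have "((\<lambda>w. e2pi (of_int c * w\<^sup>2 / (2 * J))) has_field_derivative deriv (\<lambda>w. e2pi (of_int c * w\<^sup>2 / (2 * J))) w) (at w)"
        by (rule holomorphic_derivI[of _ UNIV]) (use J in \<open>auto intro!: holomorphic_intros\<close>)
      ultimately have "(g has_field_derivative (e2pi (of_int c * w\<^sup>2 / (2 * J)) * deriv (\<lambda>z. phi z \<tau>) w)) (at w)"
        unfolding g_def by (auto intro!: derivative_eq_intros simp: p)
      thus "deriv g w \<noteq> 0" using phi_simple_zero[OF \<tau> p] by (simp add: DERIV_imp_deriv)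
    qed
    show "g (w + 1) = u1 w * g w"
    proof -
      have "of_int c * (w + 1)\<^sup>2 / (2 * J) = of_int c * w / J + of_int c / (2 * J) + of_int c * w\<^sup>2 / (2 * J)"
        using J by (simp add: field_simps power2_eq_square)
      thus ?thesis by (simp add: g_def u1_def phi_add_1[OF \<tau>] e2pi_add e2pi_half)
    qed
    show "g (w + \<tau>) = u2 w * g w"
    proof -
      have "of_int c * (w + \<tau>)\<^sup>2 / (2 * J) + (1 / 2 - w - \<tau> / 2) =
          (of_int c * w * \<tau> / J + of_int c * \<tau>\<^sup>2 / (2 * J) + 1 / 2 - w - \<tau> / 2) + of_int c * w\<^sup>2 / (2 * J)"
        using J by (simp add: field_simps power2_eq_square)
      thus ?thesis
        unfolding g_def u2_def phi_add_tau[OF \<tau>] mult.assoc[symmetric] e2pi_add[symmetric] by (simp only:)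
    qed
    show "f (w + 1) = u1 w * f w"
    proof -
      have "(w + 1) / J = w / J + of_int (- c) * \<tau>' + of_int a" by (simp add: add_divide_distrib J1)
      hence "f (w + 1) = e2pi (of_int (- c + a) / 2 - of_int (- c) * (w / J) - of_int (- c) ^ 2 * \<tau>' / 2) * f w"
        unfolding f_def using phi_lattice[OF \<tau>', of "w / J" "- c" a] by simp
      also have "of_int (- c + a) / 2 - of_int (- c) * (w / J) - of_int (- c) ^ 2 * \<tau>' / 2 =
          of_int (a - c) / 2 + (of_int c * w / J - of_int c ^ 2 * \<tau>' / 2)"
        by (simp add: algebra_simps)
      \<comment> \<open>Here the determinant enters: a and c are not both even, so a - c and ac + 1
        have the same parity.\<close>
      also have "e2pi \<dots> = e2pi (of_int (a * c + 1) / 2 + (of_int c * w / J - of_int c ^ 2 * \<tau>' / 2))"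
      proof (rule e2pi_half_int)
        have "even (a - c - (a * c + 1)) \<longleftrightarrow> even ((a + 1) * (c + 1))" by auto
        thus "even (a - c - (a * c + 1))"
          using arg_cong[OF det, of even] by auto
      qed
      also have "of_int (a * c + 1) / 2 + (of_int c * w / J - of_int c ^ 2 * \<tau>' / 2) =
          of_int c * w / J + of_int c * (1 / J) / 2 + 1 / 2"
        unfolding J1 by (simp add: field_simps power2_eq_square)
      finally show ?thesis by (simp add: u1_def mult.commute)
    qed
    show "f (w + \<tau>) = u2 w * f w"
    proof -
      have "(w + \<tau>) / J = w / J + of_int d * \<tau>' + of_int (- b)" by (simp add: add_divide_distrib J2)
      hence "f (w + \<tau>) = e2pi (of_int (d + - b) / 2 - of_int d * (w / J) - of_int d ^ 2 * \<tau>' / 2) * f w"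
        unfolding f_def using phi_lattice[OF \<tau>', of "w / J" d "- b"] by simp
      also have "of_int (d + - b) / 2 - of_int d * (w / J) - of_int d ^ 2 * \<tau>' / 2 =
          of_int (d - b) / 2 + (- of_int d * (w / J) - of_int d ^ 2 * \<tau>' / 2)"
        by (simp add: algebra_simps)
      also have "e2pi \<dots> = e2pi (of_int (b * d + 1) / 2 + (- of_int d * (w / J) - of_int d ^ 2 * \<tau>' / 2))"
      proof (rule e2pi_half_int)
        have "even (d - b - (b * d + 1)) \<longleftrightarrow> even ((b + 1) * (d + 1))" by auto
        thus "even (d - b - (b * d + 1))"
          using arg_cong[OF det, of even] by auto
      qed
      also have "of_int (b * d + 1) / 2 + (- of_int d * (w / J) - of_int d ^ 2 * \<tau>' / 2) =
          1 / 2 - of_int d * (w / J) - of_int d * (of_int d * \<tau>' - of_int b) / 2"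
        by (simp add: field_simps power2_eq_square)
      also have "\<dots> = 1 / 2 - of_int d * (w / J) - of_int d * (\<tau> / J) / 2" by (simp only: J2)
      also have "\<dots> = of_int c * w * \<tau> / J + of_int c * \<tau>\<^sup>2 / (2 * J) + 1 / 2 - w - \<tau> / 2"
      proof -
        have d: "of_int d = J - of_int c * \<tau>" by (simp add: J_def)
        show ?thesis unfolding d using J by (simp add: field_simps power2_eq_square)
      qed
      finally show ?thesis by (simp add: u2_def)
    qed
  qed
  thus ?thesis by (simp add: f_def g_def \<tau>'_def)
qed

text \<open>As functions of a, the left side and \<open>g a\<close> have the same multipliers and
  the zeros of g are zeros of the left side, so the quotient is a constant, which is 0 by evaluation
  at a = c. The condition on 2b makes the zeros of g simple; those on c + b and c - b give g c
  \<noteq> 0.\<close>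

lemma phi_three_term_generic:
  assumes \<tau>: "Im \<tau> > 0" and nz: "phi (2 * b) \<tau> \<noteq> 0" "phi (c + b) \<tau> \<noteq> 0" "phi (c - b) \<tau> \<noteq> 0"
  shows "phi (a + b) \<tau> * phi (a - b) \<tau> * (phi c \<tau>)\<^sup>2 + phi (b + c) \<tau> * phi (b - c) \<tau> * (phi a \<tau>)\<^sup>2
     + phi (c + a) \<tau> * phi (c - a) \<tau> * (phi b \<tau>)\<^sup>2 = 0"
proof -
  define p where "p z = phi z \<tau>" for z
  define W where "W b a = p (a + b) * p (a - b) * (p c)\<^sup>2 + p (b + c) * p (b - c) * (p a)\<^sup>2
     + p (c + a) * p (c - a) * (p b)\<^sup>2" for a b
  define g where "g a = p (a + b) * p (a - b)" for a
  have odd: "p (- z) = - p z" for z using phi_minus[OF \<tau>] by (simp add: p_def)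
  have odd': "p (x - y) = - p (y - x)" for x y using odd[of "y - x"] by simp
  have zero: "p z = 0 \<longleftrightarrow> (\<exists>m n. z = of_int m * \<tau> + of_int n)" for z
    unfolding p_def by (rule phi_eq_0_iff[OF \<tau>])
  have hol: "p holomorphic_on A" for A unfolding p_def by (rule phi_holomorphic[OF \<tau>])
  have holc: "(\<lambda>a. p (f a)) holomorphic_on UNIV" if "f holomorphic_on UNIV" for f
    using holomorphic_on_compose[OF that hol] by (simp add: o_def)
  \<comment> \<open>If a + b is a lattice point, the first term vanishes, and translation by that
    point turns the other two into opposite multiples of the same product.\<close>
  have W_zero: "W b a = 0" if "a + b = of_int m * \<tau> + of_int n" for a b m n
  proof -
    define L where "L z = e2pi (of_int (m + n) / 2 - of_int m * z - of_int m ^ 2 * \<tau> / 2)" for z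
    have lat: "p (z + (a + b)) = L z * p z" for z
      unfolding p_def L_def that using phi_lattice[OF \<tau>, of z m n] by (simp add: add.assoc)
    have "p (a + b) = 0" using that zero by blast
    moreover have "p a = - (L (- b) * p b)" using lat[of "- b"] by (simp add: odd)
    moreover have "p (c + a) = L (c - b) * p (c - b)" using lat[of "c - b"] by simp
    moreover have "p (c - a) = L (- c - b) * p (c + b)"
    proof -
      have "p (- c - b) = - p (c + b)" using odd[of "c + b"] by simp
      moreover have "- c - b + (a + b) = a - c" by simp
      ultimately show ?thesis using lat[of "- c - b"] odd'[of c a] by simp
    qed
    moreover have "L (c - b) * L (- c - b) = (L (- b))\<^sup>2"
      unfolding L_def power2_eq_square e2pi_add[symmetric] by (simp add: algebra_simps)
    moreover have "p (b - c) = - p (c - b)" by (rule odd')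
    moreover have "p (b + c) = p (c + b)" by (simp add: add.commute)
    ultimately have "W b a = (L (- b))\<^sup>2 * (- (p (c + b) * p (c - b) * (p b)\<^sup>2)) + (L (c - b) * L (- c - b)) * (p (c + b) * p (c - b) * (p b)\<^sup>2)"
      unfolding W_def by (simp add: power_mult_distrib mult_ac)
    thus ?thesis by (simp add: \<open>L (c - b) * L (- c - b) = (L (- b))\<^sup>2\<close>)
  qed
  \<comment> \<open>Evenness in b reduces the zeros of p (a - b) to those of p (a + b).\<close>
  have W_even: "W (- b) a = W b a" for b a
    using odd'[of c b] odd[of "b + c"] odd[of b] unfolding W_def by (simp add: algebra_simps)
  have "\<exists>C. \<forall>a. W b a = C * g a"
  proof (rule elliptic_quotient_constant[OF \<tau>])
    show "(\<lambda>a. W b a) holomorphic_on UNIV" "g holomorphic_on UNIV"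
      unfolding W_def g_def by (intro holomorphic_intros holc)+
    fix a
    show "g a = 0 \<Longrightarrow> W b a = 0 \<and> deriv g a \<noteq> 0"
    proof
      assume ga: "g a = 0"
      then consider "p (a + b) = 0" | "p (a - b) = 0" by (auto simp: g_def)
      thus "W b a = 0"
      proof cases
        case 1
        thus ?thesis using W_zero zero by blast
      next
        case 2
        thus ?thesis using W_zero[of a "- b"] W_even[of b a] zero by (metis add_uminus_conv_diff)
      qed
      have der: "(p has_field_derivative deriv p z) (at z)" for z
        by (rule holomorphic_derivI[OF hol[of UNIV]]) auto
      have d1: "((\<lambda>a. p (a + x)) has_field_derivative deriv p (a + x)) (at a)" for x
      proof -
        have "((\<lambda>a. a + x) has_field_derivative 1) (at a)" by (auto intro!: derivative_eq_intros)
        from DERIV_chain2[OF der this] show ?thesis by simp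
      qed
      have "(g has_field_derivative (deriv p (a + b) * p (a - b) + p (a + b) * deriv p (a - b))) (at a)"
        unfolding g_def using DERIV_mult[OF d1[of b] d1[of "- b"]] by (simp add: algebra_simps)
      moreover have "deriv p (a + b) * p (a - b) + p (a + b) * deriv p (a - b) \<noteq> 0"
      proof -
        have both: "\<not> (p (a + b) = 0 \<and> p (a - b) = 0)"
        proof
          assume "p (a + b) = 0 \<and> p (a - b) = 0"
          then obtain m n m' n' where mn: "a + b = of_int m * \<tau> + of_int n" "a - b = of_int m' * \<tau> + of_int n'"
            unfolding zero by blast
          have "2 * b = (a + b) - (a - b)" by simp
          also have "\<dots> = of_int (m - m') * \<tau> + of_int (n - n')" unfolding mn by (simp add: algebra_simps)
          finally have "p (2 * b) = 0" unfolding zero by blast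
          thus False using nz(1) by (simp add: p_def)
        qed
        have "deriv p z \<noteq> 0" if "p z = 0" for z
          using phi_simple_zero[OF \<tau>, of z] that by (simp add: p_def[abs_def])
        thus ?thesis using both ga by (auto simp: g_def)
      qed
      ultimately show "deriv g a \<noteq> 0" by (simp add: DERIV_imp_deriv)
    qed
    have s1: "p (z + 1) = - p z" for z using phi_add_1[OF \<tau>] by (simp add: p_def)
    have s1': "p (z - 1) = - p z" for z using s1[of "z - 1"] by simp
    have e1: "a + 1 + x = (a + x) + 1" "a + 1 - x = (a - x) + 1" "x + (a + 1) = (x + a) + 1" "x - (a + 1) = (x - a) - 1" for x
      by simp_all
    show "W b (a + 1) = 1 * W b a" "g (a + 1) = 1 * g a"
      unfolding W_def g_def e1 s1 s1' by simp_all
    define u where "u = e2pi (- \<tau> - 2 * a)"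
    show "u \<noteq> 0" by (simp add: u_def)
    have s2: "p (z + \<tau>) = e2pi (1 / 2 - z - \<tau> / 2) * p z" for z using phi_add_tau[OF \<tau>] by (simp add: p_def)
    have k: "p (a + \<tau> + x) * p (a + \<tau> - x) = u * (p (a + x) * p (a - x))" for x
    proof -
      have "p (a + \<tau> + x) * p (a + \<tau> - x) = p ((a + x) + \<tau>) * p ((a - x) + \<tau>)" by (simp add: algebra_simps)
      also have "\<dots> = e2pi ((1 / 2 - (a + x) - \<tau> / 2) + (1 / 2 - (a - x) - \<tau> / 2)) * (p (a + x) * p (a - x))"
        unfolding s2 e2pi_add by simp
      also have "e2pi ((1 / 2 - (a + x) - \<tau> / 2) + (1 / 2 - (a - x) - \<tau> / 2)) = u"
        unfolding u_def by (rule e2pi_cong[of _ _ 1]) simp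
      finally show ?thesis .
    qed
    have k0: "(p (a + \<tau>))\<^sup>2 = u * (p a)\<^sup>2" using k[of 0] by (simp add: power2_eq_square)
    have k2: "p (c + (a + \<tau>)) * p (c - (a + \<tau>)) = u * (p (c + a) * p (c - a))"
      using k[of c] odd'[of c "a + \<tau>"] odd'[of c a] by (simp add: add_ac)
    show "g (a + \<tau>) = (\<lambda>a. e2pi (- \<tau> - 2 * a)) a * g a" unfolding g_def k u_def by simp
    show "W b (a + \<tau>) = (\<lambda>a. e2pi (- \<tau> - 2 * a)) a * W b a"
      unfolding W_def k k0 k2 u_def[symmetric] by (simp add: algebra_simps)
  qed auto
  then obtain C where C: "\<And>a. W b a = C * g a" by blast
  have "W b c = 0"
    using odd'[of c b] by (simp add: W_def p_def[of 0] phi_zero[OF \<tau>] add.commute[of c b])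
  hence "C = 0" using C[of c] nz by (simp add: g_def p_def)
  thus ?thesis using C[of a] by (simp add: W_def p_def)
qed

text \<open>The expression is continuous in b, and the values of b excluded in the generic case form
  a countable set, which contains no disc.\<close>

lemma phi_three_term:
  assumes \<tau>: "Im \<tau> > 0"
  shows "phi (a + b) \<tau> * phi (a - b) \<tau> * (phi c \<tau>)\<^sup>2 + phi (b + c) \<tau> * phi (b - c) \<tau> * (phi a \<tau>)\<^sup>2
     + phi (c + a) \<tau> * phi (c - a) \<tau> * (phi b \<tau>)\<^sup>2 = 0"
proof (rule ccontr)
  define F where "F b = phi (a + b) \<tau> * phi (a - b) \<tau> * (phi c \<tau>)\<^sup>2 + phi (b + c) \<tau> * phi (b - c) \<tau> * (phi a \<tau>)\<^sup>2
     + phi (c + a) \<tau> * phi (c - a) \<tau> * (phi b \<tau>)\<^sup>2" for b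
  assume "phi (a + b) \<tau> * phi (a - b) \<tau> * (phi c \<tau>)\<^sup>2 + phi (b + c) \<tau> * phi (b - c) \<tau> * (phi a \<tau>)\<^sup>2
     + phi (c + a) \<tau> * phi (c - a) \<tau> * (phi b \<tau>)\<^sup>2 \<noteq> 0"
  hence Fb: "b \<in> {b. F b \<noteq> 0}" by (simp add: F_def)
  have cont: "continuous_on UNIV (\<lambda>z. phi z \<tau>)"
    by (rule holomorphic_on_imp_continuous_on[OF phi_holomorphic[OF \<tau>]])
  have "continuous_on UNIV F" unfolding F_def
    by (intro continuous_intros continuous_on_compose2[OF cont]) auto
  hence "open {b. F b \<noteq> 0}" by (intro open_Collect_neq) auto
  then obtain d where d: "d > 0" "ball b d \<subseteq> {b. F b \<noteq> 0}" using Fb openE by blast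
  define \<Lambda> where "\<Lambda> = (\<lambda>(m, n). of_int m * \<tau> + of_int n) ` (UNIV :: (int \<times> int) set)"
  have L: "z \<in> \<Lambda> \<longleftrightarrow> (\<exists>m n. z = of_int m * \<tau> + of_int n)" for z
    by (auto simp: \<Lambda>_def image_iff)
  have "ball b d \<subseteq> (\<lambda>z. z / 2) ` \<Lambda> \<union> (\<lambda>z. z - c) ` \<Lambda> \<union> (\<lambda>z. c - z) ` \<Lambda>"
  proof
    fix x assume "x \<in> ball b d"
    hence "F x \<noteq> 0" using d by auto
    hence "phi (2 * x) \<tau> = 0 \<or> phi (c + x) \<tau> = 0 \<or> phi (c - x) \<tau> = 0"
      using phi_three_term_generic[OF \<tau>, of x c a] by (auto simp: F_def)
    hence "2 * x \<in> \<Lambda> \<or> c + x \<in> \<Lambda> \<or> c - x \<in> \<Lambda>"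
      unfolding phi_eq_0_iff[OF \<tau>] L by blast
    moreover have "x = 2 * x / 2" "x = (c + x) - c" "x = c - (c - x)" by simp_all
    ultimately show "x \<in> (\<lambda>z. z / 2) ` \<Lambda> \<union> (\<lambda>z. z - c) ` \<Lambda> \<union> (\<lambda>z. c - z) ` \<Lambda>"
      by (metis UnI1 UnI2 imageI)
  qed
  moreover have "countable ((\<lambda>z. z / 2) ` \<Lambda> \<union> (\<lambda>z. z - c) ` \<Lambda> \<union> (\<lambda>z. c - z) ` \<Lambda>)"
    unfolding \<Lambda>_def by (intro countable_Un countable_image) auto
  ultimately have "countable (ball b d)" by (rule countable_subset)
  thus False using uncountable_ball[OF d(1), of b] by simp
qed

section \<open>Modular transformation of Siegel functions\<close>

definition torsion_pt :: "nat \<Rightarrow> int \<times> int \<Rightarrow> complex \<Rightarrow> complex" where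
  "torsion_pt N x \<tau> = (of_int (fst x) * \<tau> + of_int (snd x)) / of_nat N"

text \<open>The normalisation of Kubert and Lang: it differs from the Siegel function by a root of unity, the index \<open>x\<close> is not reduced modulo \<open>N\<close>, and the action of \<open>SL\<^sub>2(\<int>)\<close> on the index then needs only one multiplier for all \<open>x\<close>.\<close>

definition siegel_raw :: "nat \<Rightarrow> int \<times> int \<Rightarrow> complex \<Rightarrow> complex" where
  "siegel_raw N x \<tau> = e2pi (of_int (fst x) * torsion_pt N x \<tau> / (2 * of_nat N)) * phi (torsion_pt N x \<tau>) \<tau>"

text \<open>Row vector times matrix: the torsion point x of the transformed lattice is the point
  \<open>row_act x \<gamma>\<close> of the old one divided by c\<tau> + d.\<close>

fun row_act :: "int \<times> int \<Rightarrow> int \<times> int \<times> int \<times> int \<Rightarrow> int \<times> int" where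
  "row_act (x1, x2) (a, b, c, d) = (a * x1 + c * x2, b * x1 + d * x2)"

lemma row_act_add: "row_act (x + y) \<gamma> = row_act x \<gamma> + row_act y \<gamma>" and row_act_diff: "row_act (x - y) \<gamma> = row_act x \<gamma> - row_act y \<gamma>"
  by (cases x; cases y; cases \<gamma>; simp add: algebra_simps)+

lemma torsion_pt_add: "torsion_pt N (x + y) \<tau> = torsion_pt N x \<tau> + torsion_pt N y \<tau>" and torsion_pt_diff: "torsion_pt N (x - y) \<tau> = torsion_pt N x \<tau> - torsion_pt N y \<tau>"
  and torsion_pt_minus: "torsion_pt N (- x) \<tau> = - torsion_pt N x \<tau>"
  by (simp_all add: torsion_pt_def add_divide_distrib diff_divide_distrib algebra_simps)

lemma siegel_raw_minus:
  assumes "Im \<tau> > 0" shows "siegel_raw N (- x) \<tau> = - siegel_raw N x \<tau>"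
  using phi_minus[OF assms] by (simp add: siegel_raw_def torsion_pt_minus)

text \<open>The exponential in \<open>siegel_raw\<close> is chosen so that all terms in \<tau> from
  \<open>phi_lattice\<close> cancel; a root of unity of order dividing 2N remains.\<close>

lemma siegel_raw_shift:
  assumes "Im \<tau> > 0" "N > 0"
  shows "siegel_raw N (x + (int N * m, int N * n)) \<tau> =
     e2pi (of_int (fst x * n - m * snd x) / (2 * of_nat N) + of_int (m * n + m + n) / 2) * siegel_raw N x \<tau>"
proof -
  define z where "z = torsion_pt N x \<tau>"
  have z': "torsion_pt N (x + (int N * m, int N * n)) \<tau> = z + of_int m * \<tau> + of_int n"
    using assms by (simp add: torsion_pt_def z_def field_simps)
  have "siegel_raw N (x + (int N * m, int N * n)) \<tau> =
      e2pi ((of_int (fst x) + of_nat N * of_int m) * (z + of_int m * \<tau> + of_int n) / (2 * of_nat N)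
      + (of_int (m + n) / 2 - of_int m * z - of_int m ^ 2 * \<tau> / 2)) * phi z \<tau>"
    by (simp add: siegel_raw_def z' phi_lattice[OF assms(1)] e2pi_add)
  also have "(of_int (fst x) + of_nat N * of_int m) * (z + of_int m * \<tau> + of_int n) / (2 * of_nat N)
      + (of_int (m + n) / 2 - of_int m * z - of_int m ^ 2 * \<tau> / 2) =
      (of_int (fst x * n - m * snd x) / (2 * of_nat N) + of_int (m * n + m + n) / 2)
       + of_int (fst x) * z / (2 * of_nat N)"
    using assms by (simp add: z_def torsion_pt_def field_simps power2_eq_square)
  finally show ?thesis by (simp add: siegel_raw_def z_def e2pi_add)
qed

lemma siegel_raw_eq_0_iff:
  assumes "Im \<tau> > 0" "N > 0"
  shows "siegel_raw N x \<tau> = 0 \<longleftrightarrow> (\<exists>i j. x = (int N * i, int N * j))"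
proof -
  have "torsion_pt N x \<tau> = of_int m * \<tau> + of_int n \<longleftrightarrow> x = (int N * m, int N * n)" for m n
  proof -
    have "torsion_pt N x \<tau> = of_int m * \<tau> + of_int n \<longleftrightarrow>
       of_int (fst x) * \<tau> + of_int (snd x) = of_int (int N * m) * \<tau> + of_int (int N * n)"
      using assms by (simp add: torsion_pt_def field_simps)
    also have "\<dots> \<longleftrightarrow> x = (int N * m, int N * n)"
    proof
      assume e: "of_int (fst x) * \<tau> + of_int (snd x) = of_int (int N * m) * \<tau> + of_int (int N * n)"
      have "of_int (fst x) * Im \<tau> = of_int (int N * m) * Im \<tau>"
        using arg_cong[OF e, of Im] by simp
      hence 1: "fst x = int N * m" using assms by (simp only: mult_cancel_right of_int_eq_iff) simp
      hence "of_int (snd x) = (of_int (int N * n) :: complex)" using e by simp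
      hence "snd x = int N * n" by (simp only: of_int_eq_iff)
      with 1 show "x = (int N * m, int N * n)" by (simp add: prod_eq_iff)
    qed simp
    finally show ?thesis .
  qed
  thus ?thesis by (simp add: siegel_raw_def phi_eq_0_iff[OF assms(1)])
qed

text \<open>The three values are exponentials times squares of the factors in Euler's identity, and
  the exponents of \<tau> add up to 0. The 2 is the factor 1 - (-1) split off at the point (0,
  1).\<close>

lemma siegel_raw_half_product:
  assumes \<tau>: "Im \<tau> > 0"
  shows "siegel_raw 2 (1, 0) \<tau> * siegel_raw 2 (0, 1) \<tau> * siegel_raw 2 (1, 1) \<tau> = 2 * e2pi (- 3 / 8)"
proof -
  define r where "r = e2pi (\<tau> / 2)"
  have r: "norm r < 1" unfolding r_def using \<tau> by (intro norm_e2pi_less_1) simp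
  have q: "e2pi \<tau> = r\<^sup>2" by (simp add: r_def e2pi_power)
  have half: "e2pi (- (1 / 2)) = - 1" by (simp add: e2pi_minus e2pi_half)
  have r1: "e2pi (\<tau> - \<tau> / 2) = r" by (simp add: r_def)
  have r2: "e2pi ((\<tau> + 1) / 2) = - r" "e2pi (\<tau> - (\<tau> + 1) / 2) = - r" "e2pi (\<tau> - 1 / 2) = - r\<^sup>2"
  proof -
    show "e2pi ((\<tau> + 1) / 2) = - r" by (simp add: add_divide_distrib e2pi_add e2pi_half r_def)
    have "\<tau> - (\<tau> + 1) / 2 = \<tau> / 2 + (- (1 / 2))" by (simp add: field_simps)
    thus "e2pi (\<tau> - (\<tau> + 1) / 2) = - r" by (simp only: e2pi_add half r_def mult_minus1_right)
    show "e2pi (\<tau> - 1 / 2) = - r\<^sup>2" using e2pi_add[of \<tau> "- (1/2)"] by (simp add: half q)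
  qed
  have A: "siegel_raw 2 (1, 0) \<tau> = e2pi (\<tau> / 8) * e2pi (\<tau> / 12 - \<tau> / 4) * (qprod r (r\<^sup>2))\<^sup>2"
    by (simp add: siegel_raw_def torsion_pt_def phi_def q r1 r_def[symmetric] power2_eq_square)
  have D: "siegel_raw 2 (1, 1) \<tau> = e2pi ((\<tau> + 1) / 8) * e2pi (\<tau> / 12 - (\<tau> + 1) / 4) * (qprod (- r) (r\<^sup>2))\<^sup>2"
    by (simp add: siegel_raw_def torsion_pt_def phi_def q r2 power2_eq_square)
  have r2n: "norm (r\<^sup>2) < 1" using r by (simp add: norm_power power_less_one_iff)
  have "qprod (- 1) (r\<^sup>2) = 2 * qprod (- r\<^sup>2) (r\<^sup>2)" using qprod_rec[OF r2n, of "-1"] by simp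
  hence B: "siegel_raw 2 (0, 1) \<tau> = e2pi (\<tau> / 12 - 1 / 4) * 2 * (qprod (- r\<^sup>2) (r\<^sup>2))\<^sup>2"
    by (simp add: siegel_raw_def torsion_pt_def phi_def q r2 e2pi_half power2_eq_square)
  have "siegel_raw 2 (1, 0) \<tau> * siegel_raw 2 (0, 1) \<tau> * siegel_raw 2 (1, 1) \<tau> =
     2 * e2pi ((\<tau> / 8 + (\<tau> / 12 - \<tau> / 4)) + (\<tau> / 12 - 1 / 4) + ((\<tau> + 1) / 8 + (\<tau> / 12 - (\<tau> + 1) / 4))) *
     (qprod r (r\<^sup>2) * qprod (- r) (r\<^sup>2) * qprod (- r\<^sup>2) (r\<^sup>2))\<^sup>2"
    unfolding A B D e2pi_add by (simp add: power_mult_distrib mult_ac)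
  also have "(\<tau> / 8 + (\<tau> / 12 - \<tau> / 4)) + (\<tau> / 12 - 1 / 4) + ((\<tau> + 1) / 8 + (\<tau> / 12 - (\<tau> + 1) / 4)) = - 3 / 8"
    by (simp add: field_simps)
  finally show ?thesis using qprod_euler[OF r] by simp
qed

text \<open>For N = 2 the multiplier of \<open>siegel_raw_shift\<close> has order dividing
  4.\<close>

lemma siegel_raw_two_periodic:
  assumes \<tau>: "Im \<tau> > 0" and "even (fst x - fst y)" "even (snd x - snd y)"
  shows "siegel_raw 2 x \<tau> ^ 4 = siegel_raw 2 y \<tau> ^ 4"
proof -
  obtain m n where "fst x - fst y = 2 * m" "snd x - snd y = 2 * n" using assms(2,3) unfolding dvd_def by blast
  hence x: "x = y + (int 2 * m, int 2 * n)" by (simp add: prod_eq_iff)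
  have "siegel_raw 2 x \<tau> ^ 4 = e2pi (of_nat 4 * (of_int (fst y * n - m * snd y) / (2 * of_nat 2) + of_int (m * n + m + n) / 2)) * siegel_raw 2 y \<tau> ^ 4"
    unfolding x using assms(1) by (subst siegel_raw_shift) (simp_all add: power_mult_distrib e2pi_power)
  also have "of_nat 4 * (of_int (fst y * n - m * snd y) / (2 * of_nat 2) + of_int (m * n + m + n) / 2) =
     (of_int ((fst y * n - m * snd y) + 2 * (m * n + m + n)) :: complex)"
    by (simp add: field_simps)
  finally show ?thesis by (simp only: e2pi_of_int mult_1)
qed

text \<open>The factor C from \<open>phi_modular\<close> depends on neither x nor N, so it can be
  computed at N = 2. There the matrix permutes the three points of order 2 modulo 2, and the fourth
  power of their product gives the exponent 12 = 3 * 4.\<close>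

lemma siegel_raw_modular:
  assumes det: "a * d - b * c = 1" and \<tau>: "Im \<tau> > 0"
  shows "\<exists>C. C ^ 12 = 1 \<and> (\<forall>N>0. \<forall>x. siegel_raw N x (moebius (a, b, c, d) \<tau>) = C * siegel_raw N (row_act x (a, b, c, d)) \<tau>)"
proof -
  define \<tau>' where "\<tau>' = moebius (a, b, c, d) \<tau>"
  define J where "J = of_int c * \<tau> + of_int d"
  have J: "J \<noteq> 0" and \<tau>': "Im \<tau>' > 0"
    using Im_moebius[OF det \<tau>] by (auto simp: J_def \<tau>'_def)
  have det': "of_int a * of_int d - of_int b * of_int c = (1 :: complex)"
    using det by (metis of_int_1 of_int_diff of_int_mult)
  have \<tau>'_eq: "\<tau>' = (of_int a * \<tau> + of_int b) / J" by (simp add: \<tau>'_def J_def)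
  obtain C where C: "\<And>w. phi (w / J) \<tau>' = C * (e2pi (of_int c * w\<^sup>2 / (2 * J)) * phi w \<tau>)"
    using phi_modular[OF det \<tau>] by (auto simp: J_def \<tau>'_def)
  have GC: "siegel_raw N x \<tau>' = C * siegel_raw N (row_act x (a, b, c, d)) \<tau>" if N: "N > 0" for N x
  proof -
    obtain x1 x2 where x: "x = (x1, x2)" by force
    define w where "w = torsion_pt N (row_act x (a, b, c, d)) \<tau>"
    have Nw: "of_nat N * w = of_int (a * x1 + c * x2) * \<tau> + of_int (b * x1 + d * x2)"
      using N by (simp add: w_def x torsion_pt_def)
    have "of_int x1 * (of_int a * \<tau> + of_int b) / J + of_int x2 = of_nat N * w / J"
      unfolding Nw using J by (simp add: field_simps J_def)
    hence zw: "torsion_pt N x \<tau>' = w / J"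
      using N by (simp add: torsion_pt_def x \<tau>'_eq field_simps)
    have id: "of_int x1 + of_int c * (of_nat N * w) = of_int (a * x1 + c * x2) * J"
    proof -
      have "of_int (a * x1 + c * x2) * J - of_int c * (of_nat N * w) =
          (of_int a * of_int d - of_int b * of_int c) * of_int x1"
        unfolding Nw by (simp add: J_def algebra_simps)
      thus ?thesis by (simp add: det' algebra_simps)
    qed
    \<comment> \<open>The quadratic exponent from \<open>phi_modular\<close> is exactly the change
      of the exponent of \<open>siegel_raw\<close> under the matrix.\<close>
    have "of_int x1 * (w / J) / (2 * of_nat N) + of_int c * w\<^sup>2 / (2 * J) =
       (of_int x1 + of_int c * (of_nat N * w)) * w / (2 * of_nat N * J)"
      using N J by (simp add: field_simps power2_eq_square)
    also have "\<dots> = of_int (a * x1 + c * x2) * w / (2 * of_nat N)"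
      unfolding id using J by simp
    finally have ex: "of_int x1 * (w / J) / (2 * of_nat N) + of_int c * w\<^sup>2 / (2 * J) =
       of_int (a * x1 + c * x2) * w / (2 * of_nat N)" .
    have "siegel_raw N x \<tau>' = C * (e2pi (of_int x1 * (w / J) / (2 * of_nat N) + of_int c * w\<^sup>2 / (2 * J)) * phi w \<tau>)"
      unfolding siegel_raw_def zw C e2pi_add by (simp add: x)
    thus ?thesis unfolding ex by (simp add: siegel_raw_def w_def x)
  qed
  define E where "E m n = siegel_raw 2 (m, n) \<tau> ^ 4" for m n
  have E: "E m n = E m' n'" if "even (m - m')" "even (n - n')" for m n m' n'
    unfolding E_def by (rule siegel_raw_two_periodic[OF \<tau>]) (use that in auto)
  define Pi where "Pi \<tau> = siegel_raw 2 (1, 0) \<tau> * siegel_raw 2 (0, 1) \<tau> * siegel_raw 2 (1, 1) \<tau>" for \<tau>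
  have "E a b * E c d * E (a + c) (b + d) = E 1 0 * E 0 1 * E 1 1"
  proof -
    have ed: "even a \<longrightarrow> odd b \<and> odd c" "even d \<longrightarrow> odd b \<and> odd c" "even b \<or> even c \<longrightarrow> odd a \<and> odd d"
      "odd b \<and> odd c \<longrightarrow> even a \<or> even d"
      using arg_cong[OF det, of even] by auto
    \<comment> \<open>The six invertible matrices over the field with two elements.\<close>
    consider "odd a" "even b" "even c" "odd d" | "odd a" "odd b" "even c" "odd d" | "odd a" "even b" "odd c" "odd d"
      | "even a" "odd b" "odd c" "even d" | "odd a" "odd b" "odd c" "even d" | "even a" "odd b" "odd c" "odd d"
      using ed by blast
    thus ?thesis
    proof cases
      case 1
      have "E a b = E 1 0" "E c d = E 0 1" "E (a + c) (b + d) = E 1 1" by (rule E; use 1 in simp)+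
      thus ?thesis by simp
    next
      case 2
      have "E a b = E 1 1" "E c d = E 0 1" "E (a + c) (b + d) = E 1 0" by (rule E; use 2 in simp)+
      thus ?thesis by simp
    next
      case 3
      have "E a b = E 1 0" "E c d = E 1 1" "E (a + c) (b + d) = E 0 1" by (rule E; use 3 in simp)+
      thus ?thesis by simp
    next
      case 4
      have "E a b = E 0 1" "E c d = E 1 0" "E (a + c) (b + d) = E 1 1" by (rule E; use 4 in simp)+
      thus ?thesis by simp
    next
      case 5
      have "E a b = E 1 1" "E c d = E 1 0" "E (a + c) (b + d) = E 0 1" by (rule E; use 5 in simp)+
      thus ?thesis by simp
    next
      case 6
      have "E a b = E 0 1" "E c d = E 1 1" "E (a + c) (b + d) = E 1 0" by (rule E; use 6 in simp)+
      thus ?thesis by simp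
    qed
  qed
  hence "(C ^ 4) ^ 3 * (E a b * E c d * E (a + c) (b + d)) = C ^ 12 * Pi \<tau> ^ 4"
    by (simp add: E_def Pi_def power_mult_distrib power_mult[symmetric])
  moreover have "(C ^ 4) ^ 3 * (E a b * E c d * E (a + c) (b + d)) = Pi \<tau>' ^ 4"
    unfolding Pi_def by (simp add: GC E_def power_mult_distrib power3_eq_cube)
  moreover have "Pi \<tau> = Pi \<tau>'" "Pi \<tau> \<noteq> 0"
    unfolding Pi_def using siegel_raw_half_product[OF \<tau>] siegel_raw_half_product[OF \<tau>'] by simp_all
  ultimately have "C ^ 12 * Pi \<tau> ^ 4 = Pi \<tau> ^ 4" "Pi \<tau> \<noteq> 0" by metis+
  hence "C ^ 12 = 1" by simp
  thus ?thesis using GC by (auto simp: \<tau>'_def)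
qed

text \<open>The exponent L is quadratic in x, so by the parallelogram law all three terms carry the
  same exponential factor.\<close>

lemma siegel_raw_three_term:
  assumes \<tau>: "Im \<tau> > 0" and N: "N > 0"
  shows "siegel_raw N (a + b) \<tau> * siegel_raw N (a - b) \<tau> * (siegel_raw N c \<tau>)\<^sup>2 + siegel_raw N (b + c) \<tau> * siegel_raw N (b - c) \<tau> * (siegel_raw N a \<tau>)\<^sup>2
     + siegel_raw N (c + a) \<tau> * siegel_raw N (c - a) \<tau> * (siegel_raw N b \<tau>)\<^sup>2 = 0"
proof -
  define L where "L x = of_int (fst x) * torsion_pt N x \<tau> / (2 * of_nat N)" for x
  have L: "L (x + y) + L (x - y) = 2 * L x + 2 * L y" for x y
    using N by (simp add: L_def torsion_pt_add torsion_pt_diff field_simps)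
  have G: "siegel_raw N (x + y) \<tau> * siegel_raw N (x - y) \<tau> * (siegel_raw N z \<tau>)\<^sup>2 =
      e2pi (2 * L x + 2 * L y + 2 * L z) *
       (phi (torsion_pt N x \<tau> + torsion_pt N y \<tau>) \<tau> * phi (torsion_pt N x \<tau> - torsion_pt N y \<tau>) \<tau> * (phi (torsion_pt N z \<tau>) \<tau>)\<^sup>2)" for x y z
  proof -
    have "e2pi (2 * L x + 2 * L y + 2 * L z) = e2pi (L (x + y)) * e2pi (L (x - y)) * (e2pi (L z))\<^sup>2"
      unfolding L[symmetric] e2pi_add power2_eq_square by (simp add: e2pi_add[symmetric])
    moreover have "siegel_raw N x \<tau> = e2pi (L x) * phi (torsion_pt N x \<tau>) \<tau>" for x by (simp add: siegel_raw_def L_def)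
    ultimately show ?thesis by (simp add: torsion_pt_add torsion_pt_diff power_mult_distrib)
  qed
  define K where "K = e2pi (2 * L a + 2 * L b + 2 * L c)"
  have K: "e2pi (2 * L b + 2 * L c + 2 * L a) = K" "e2pi (2 * L c + 2 * L a + 2 * L b) = K"
    unfolding K_def by (simp_all add: add_ac)
  show ?thesis
    unfolding G K K_def[symmetric] using phi_three_term[OF \<tau>, of "torsion_pt N a \<tau>" "torsion_pt N b \<tau>" "torsion_pt N c \<tau>"]
    by (simp add: distrib_left[symmetric])
qed

text \<open>Up to a factor independent of \<open>a\<close> and \<open>b\<close>, the difference of the values of \<open>\<wp>\<close> at the torsion points \<open>a\<close> and \<open>b\<close>.\<close>

definition wp_diff where "wp_diff N a b \<tau> = siegel_raw N (a + b) \<tau> * siegel_raw N (a - b) \<tau> / ((siegel_raw N a \<tau>)\<^sup>2 * (siegel_raw N b \<tau>)\<^sup>2)"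

text \<open>Here \<delta> plays the role of (\<gamma> - 1)/N, and each Siegel function acquires the
  multiplier e(Q x), where Q is a quadratic form plus half of an integral linear form. The
  parallelogram law removes the former and leaves an integer from the latter, so the invariance is
  exact.\<close>

lemma wp_diff_periodic:
  assumes \<tau>: "Im \<tau> > 0" and N: "N > 0"
    and lin: "\<And>x. row_act x \<gamma> = x + (int N * fst (row_act x \<delta>), int N * snd (row_act x \<delta>))"
  shows "wp_diff N (row_act a \<gamma>) (row_act b \<gamma>) \<tau> = wp_diff N a b \<tau>"
proof -
  define m n where "m x = fst (row_act x \<delta>)" and "n x = snd (row_act x \<delta>)" for x
  define Q where "Q x = of_int (fst x * n x - m x * snd x) / (2 * of_nat N) + (of_int (m x * n x + m x + n x) / 2 :: complex)" for x
  have G: "siegel_raw N (row_act x \<gamma>) \<tau> = e2pi (Q x) * siegel_raw N x \<tau>" for x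
    unfolding lin siegel_raw_shift[OF \<tau> N] by (simp add: Q_def m_def n_def)
  have mn: "m (x + y) = m x + m y" "m (x - y) = m x - m y" "n (x + y) = n x + n y" "n (x - y) = n x - n y" for x y
    by (simp_all add: m_def n_def row_act_add row_act_diff)
  have "Q (a + b) + Q (a - b) - (2 * Q a + 2 * Q b) = of_int (- m b - n b)"
    using N unfolding Q_def mn by (simp add: field_simps)
  hence "e2pi (Q (a + b) + Q (a - b)) = e2pi (2 * Q a + 2 * Q b)" by (rule e2pi_cong)
  also have "\<dots> = (e2pi (Q a))\<^sup>2 * (e2pi (Q b))\<^sup>2" by (simp add: e2pi_add e2pi_power)
  finally have q: "e2pi (Q (a + b)) * e2pi (Q (a - b)) = (e2pi (Q a))\<^sup>2 * (e2pi (Q b))\<^sup>2" by (simp only: e2pi_add)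
  have "wp_diff N (row_act a \<gamma>) (row_act b \<gamma>) \<tau> = (e2pi (Q (a + b)) * e2pi (Q (a - b))) * (siegel_raw N (a + b) \<tau> * siegel_raw N (a - b) \<tau>) /
     (((e2pi (Q a))\<^sup>2 * (e2pi (Q b))\<^sup>2) * ((siegel_raw N a \<tau>)\<^sup>2 * (siegel_raw N b \<tau>)\<^sup>2))"
    unfolding wp_diff_def row_act_add[symmetric] row_act_diff[symmetric] G by (simp add: power_mult_distrib mult_ac)
  thus ?thesis unfolding q wp_diff_def by simp
qed

section \<open>$q$-expansions\<close>

text \<open>Used twice: with all complex numbers for the expansions at arbitrary cusps, and with the
  cyclotomic field for the expansion at infinity.\<close>

locale coeff_field =
  fixes K :: "complex set"
  assumes one: "1 \<in> K" and diff: "x \<in> K \<Longrightarrow> y \<in> K \<Longrightarrow> x - y \<in> K"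
    and mult: "x \<in> K \<Longrightarrow> y \<in> K \<Longrightarrow> x * y \<in> K" and inverse: "x \<in> K \<Longrightarrow> inverse x \<in> K"
begin

lemma zero: "0 \<in> K" using diff[OF one one] by simp
lemma uminus: "x \<in> K \<Longrightarrow> - x \<in> K" using diff[OF zero, of x] by simp
lemma add: "x \<in> K \<Longrightarrow> y \<in> K \<Longrightarrow> x + y \<in> K" using diff[of x "- y"] uminus by simp
lemma sum: "(\<And>i. i \<in> I \<Longrightarrow> f i \<in> K) \<Longrightarrow> sum f I \<in> K"
  by (induction I rule: infinite_finite_induct) (auto intro: zero add)

definition fps_over where "fps_over F \<longleftrightarrow> (\<forall>n. fps_nth F n \<in> K)"

lemma fps_over_mult: "fps_over F \<Longrightarrow> fps_over G \<Longrightarrow> fps_over (F * G)"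
  unfolding fps_over_def fps_mult_nth by (auto intro!: sum mult)

lemma fps_over_diff: "fps_over F \<Longrightarrow> fps_over G \<Longrightarrow> fps_over (F - G)"
  unfolding fps_over_def by (auto intro!: diff)

lemma fps_over_const: "c \<in> K \<Longrightarrow> fps_over (fps_const c)"
  unfolding fps_over_def by (auto intro: zero)

lemma fps_over_one: "fps_over 1"
  unfolding fps_over_def by (auto intro: zero one)

lemma fps_over_X_power: "fps_over (fps_X ^ n)"
  unfolding fps_over_def by (auto simp: fps_X_power_nth intro: zero one)

lemma fps_over_inverse:
  assumes F: "fps_over F" "fps_nth F 0 \<noteq> 0" shows "fps_over (inverse F)"
  unfolding fps_over_def
proof
  fix n show "fps_nth (inverse F) n \<in> K"
  proof (induction n rule: less_induct)
    case (less n)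
    have i0: "inverse (fps_nth F 0) \<in> K" using F by (auto simp: fps_over_def intro: inverse)
    show ?case
    proof (cases "n = 0")
      case True
      thus ?thesis using i0 by simp
    next
      case False
      have "0 = fps_nth (F * inverse F) n"
        using F(2) False by (simp add: inverse_mult_eq_1')
      also have "\<dots> = fps_nth F 0 * fps_nth (inverse F) n + (\<Sum>i=1..n. fps_nth F i * fps_nth (inverse F) (n - i))"
        unfolding fps_mult_nth by (simp add: sum.atLeast_Suc_atMost)
      finally have "fps_nth (inverse F) n = inverse (fps_nth F 0) * (0 - (\<Sum>i=1..n. fps_nth F i * fps_nth (inverse F) (n - i)))"
        using F(2) by (simp add: field_simps add_eq_0_iff)
      moreover have "(\<Sum>i=1..n. fps_nth F i * fps_nth (inverse F) (n - i)) \<in> K"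
        using F(1) less by (intro sum mult) (auto simp: fps_over_def)
      ultimately show ?thesis using i0 by (auto intro!: uminus mult diff zero)
    qed
  qed
qed

text \<open>Freedom from zeros is included to make the notion stable under inverses.\<close>

definition disc_unit where
  "disc_unit P \<longleftrightarrow> P holomorphic_on ball 0 1 \<and> (\<forall>t\<in>ball 0 1. P t \<noteq> 0) \<and> (\<exists>F. P has_fps_expansion F \<and> fps_over F)"

lemma disc_unit_mult: "disc_unit P \<Longrightarrow> disc_unit Q \<Longrightarrow> disc_unit (\<lambda>t. P t * Q t)"
  unfolding disc_unit_def
  by (auto intro!: holomorphic_intros fps_expansion_intros intro: fps_over_mult
      exI[of _ "_ * _"] conjI)

lemma disc_unit_inverse: assumes "disc_unit P" shows "disc_unit (\<lambda>t. inverse (P t))"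
proof -
  obtain F where F: "P has_fps_expansion F" "fps_over F" using assms by (auto simp: disc_unit_def)
  have "fps_nth F 0 \<noteq> 0"
    using has_fps_expansion_imp_0_eq_fps_nth_0[OF F(1)] assms by (auto simp: disc_unit_def)
  thus ?thesis using assms F fps_over_inverse[OF F(2)]
    by (auto simp: disc_unit_def intro!: holomorphic_intros fps_expansion_intros exI[of _ "inverse F"])
qed

lemma disc_unit_const: "c \<in> K \<Longrightarrow> c \<noteq> 0 \<Longrightarrow> disc_unit (\<lambda>_. c)"
  unfolding disc_unit_def by (auto intro!: exI[of _ "fps_const c"] fps_expansion_intros fps_over_const)

text \<open>The coefficients of the partial products lie in K and become stationary; uniform
  convergence identifies the stationary values with the coefficients of the limit.\<close>

lemma disc_unit_qprod:
  assumes N: "N > 0" and c: "c \<in> K" and nz: "\<And>n t. norm t < 1 \<Longrightarrow> (t ^ N) ^ n * (c * t ^ m) \<noteq> 1"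
  shows "disc_unit (\<lambda>t. qprod (c * t ^ m) (t ^ N))"
  unfolding disc_unit_def
proof (intro conjI ballI)
  let ?P = "\<lambda>t. qprod (c * t ^ m) (t ^ N)"
  have tN: "norm (t ^ N) < 1" if "norm t < 1" for t :: complex
    using that N by (simp add: norm_power power_less_one_iff)
  show hol: "?P holomorphic_on ball 0 1"
    by (intro holomorphic_intros tN) auto
  show "?P t \<noteq> 0" if "t \<in> ball 0 1" for t
    using that tN nz by (intro qprod_nonzero) auto
  define A where "A M t = (\<Prod>n<M. 1 - (t ^ N) ^ n * (c * t ^ m))" for M and t :: complex
  define F where "F M = (\<Prod>n<M. 1 - (fps_X ^ N) ^ n * (fps_const c * fps_X ^ m))" for M
  have AF: "A M has_fps_expansion F M" for M
    unfolding A_def F_def by (intro fps_expansion_intros)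
  have FK: "fps_over (F M)" for M
    by (induction M) (auto simp: F_def power_mult[symmetric] intro!: fps_over_mult fps_over_diff fps_over_one
        fps_over_X_power fps_over_const c)
  have step: "fps_nth (F (Suc M)) k = fps_nth (F M) k" if "M > k" for M k
  proof -
    \<comment> \<open>The new factor is 1 - c X^(NM + m), so coefficients of degree below NM + m do
      not change.\<close>
    have "F (Suc M) = F M - (F M * fps_const c) * fps_X ^ (N * M + m)"
      by (simp add: F_def power_mult[symmetric] power_add algebra_simps)
    moreover have "N * M + m > k" using that N by (metis add.commute le_add2 less_le_trans mult.commute mult_le_mono2 nat_mult_1_right Suc_leI One_nat_def)
    ultimately show ?thesis by (simp add: fps_X_power_mult_right_nth)
  qed
  have stable: "fps_nth (F M) k = fps_nth (F (Suc k)) k" if "M \<ge> Suc k" for M k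
    using that by (induction M rule: dec_induct) (auto simp: step)
  have "?P analytic_on {0}"
    using hol by (auto simp: analytic_at intro!: exI[of _ "ball 0 1"])
  then obtain G where G: "?P has_fps_expansion G" using analytic_at_imp_has_fps_expansion_0 by blast
  have "fps_nth G k = fps_nth (F (Suc k)) k" for k
  proof (rule ccontr)
    assume neq: "fps_nth G k \<noteq> fps_nth (F (Suc k)) k"
    \<comment> \<open>Cauchy's inequality on the disc of radius 1/2 bounds the k-th coefficient of
      the difference by e 2^k, which is half of the supposed discrepancy.\<close>
    define e where "e = norm (fps_nth G k - fps_nth (F (Suc k)) k) / 2 ^ k / 2"
    have e: "e > 0" using neq by (simp add: e_def)
    have "uniform_limit (cball 0 (1/2)) A ?P sequentially"
      unfolding A_def[abs_def] using tN by (intro qprod_uniform_limit continuous_intros) auto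
    hence "\<forall>\<^sub>F M in sequentially. \<forall>t\<in>cball 0 (1/2). dist (A M t) (?P t) < e"
      using e by (auto simp: uniform_limit_iff)
    then obtain M where M: "M \<ge> Suc k" "\<And>t. t \<in> cball 0 (1/2) \<Longrightarrow> dist (A M t) (?P t) < e"
      using eventually_happens'[OF sequentially_bot eventually_conj[OF eventually_ge_at_top[of "Suc k"]]] by blast
    define D where "D t = ?P t - A M t" for t
    have D: "D has_fps_expansion G - F M" unfolding D_def by (intro fps_expansion_intros G AF)
    have Dhol: "D holomorphic_on cball 0 (1/2)"
      unfolding D_def A_def by (intro holomorphic_intros holomorphic_on_subset[OF hol]) auto
    have "norm ((deriv ^^ k) D 0) \<le> fact k * e / (1/2) ^ k"
    proof (rule Cauchy_inequality)
      show "D holomorphic_on ball 0 (1/2)" by (rule holomorphic_on_subset[OF Dhol]) auto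
      show "continuous_on (cball 0 (1/2)) D" by (rule holomorphic_on_imp_continuous_on[OF Dhol])
      show "norm (D x) \<le> e" if "norm (0 - x) = 1 / 2" for x
        using M(2)[of x] that by (simp add: D_def dist_norm norm_minus_commute)
    qed auto
    hence "norm (fps_nth (G - F M) k) \<le> e * 2 ^ k"
      unfolding fps_nth_fps_expansion[OF D] by (simp add: norm_divide field_simps power_divide)
    hence "norm (fps_nth G k - fps_nth (F (Suc k)) k) \<le> e * 2 ^ k" using stable[OF M(1)] by simp
    thus False using neq by (simp add: e_def)
  qed
  hence "fps_over G" using FK by (simp add: fps_over_def)
  thus "\<exists>F. ?P has_fps_expansion F \<and> fps_over F" using G by blast
qed

text \<open>In the local parameter \<open>t = e2pi (\<tau> / N)\<close> the function is \<open>t\<^sup>k P(t)\<close> with \<open>P\<close> without zeros on the unit disc.\<close>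

definition qunit where
  "qunit N f \<longleftrightarrow> (\<exists>k::int. \<exists>P. disc_unit P \<and>
     (\<forall>\<tau>\<in>upper_half_plane. f \<tau> = e2pi (of_int k * \<tau> / of_nat N) * P (e2pi (\<tau> / of_nat N))))"

lemma qunit_cong: "qunit N f \<Longrightarrow> (\<And>\<tau>. Im \<tau> > 0 \<Longrightarrow> g \<tau> = f \<tau>) \<Longrightarrow> qunit N g"
  unfolding qunit_def upper_half_plane_def by force

lemma qunit_mult: assumes "qunit N f" "qunit N g" shows "qunit N (\<lambda>\<tau>. f \<tau> * g \<tau>)"
proof -
  from assms obtain k P l Q where
    *: "disc_unit P" "\<forall>\<tau>\<in>upper_half_plane. f \<tau> = e2pi (of_int k * \<tau> / of_nat N) * P (e2pi (\<tau> / of_nat N))"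
       "disc_unit Q" "\<forall>\<tau>\<in>upper_half_plane. g \<tau> = e2pi (of_int l * \<tau> / of_nat N) * Q (e2pi (\<tau> / of_nat N))"
    unfolding qunit_def by blast
  thus ?thesis unfolding qunit_def
    by (intro exI[of _ "k + l"] exI[of _ "\<lambda>t. P t * Q t"])
       (auto simp: disc_unit_mult add_divide_distrib distrib_right e2pi_add)
qed

lemma qunit_inverse: assumes "qunit N f" shows "qunit N (\<lambda>\<tau>. inverse (f \<tau>))"
proof -
  from assms obtain k P where
    *: "disc_unit P" "\<forall>\<tau>\<in>upper_half_plane. f \<tau> = e2pi (of_int k * \<tau> / of_nat N) * P (e2pi (\<tau> / of_nat N))"
    unfolding qunit_def by blast
  thus ?thesis unfolding qunit_def
    by (intro exI[of _ "- k"] exI[of _ "\<lambda>t. inverse (P t)"])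
       (auto simp: disc_unit_inverse e2pi_minus)
qed

lemma qunit_divide: "qunit N f \<Longrightarrow> qunit N g \<Longrightarrow> qunit N (\<lambda>\<tau>. f \<tau> / g \<tau>)"
  using qunit_mult[OF _ qunit_inverse] by (simp add: divide_inverse)

lemma qunit_const: "c \<in> K \<Longrightarrow> c \<noteq> 0 \<Longrightarrow> qunit N (\<lambda>_. c)"
  unfolding qunit_def by (intro exI[of _ 0] exI[of _ "\<lambda>_. c"]) (auto simp: disc_unit_const)

lemma qunit_power: "qunit N f \<Longrightarrow> qunit N (\<lambda>\<tau>. f \<tau> ^ n)"
  by (induction n) (auto intro: qunit_mult qunit_const one)

lemma qunit_e2pi: "qunit N (\<lambda>\<tau>. e2pi (of_int k * \<tau> / of_nat N))"
  unfolding qunit_def by (intro exI[of _ k] exI[of _ "\<lambda>_. 1"]) (auto simp: disc_unit_const one)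

lemma e2pi_power_int: "e2pi x powi k = e2pi (of_int k * x)"
  by (cases k rule: int_cases2) (simp_all add: e2pi_power power_int_minus e2pi_minus)

lemma norm_t_less_1: "\<tau> \<in> upper_half_plane \<Longrightarrow> N > 0 \<Longrightarrow> norm (e2pi (\<tau> / of_nat N)) < 1"
  by (intro norm_e2pi_less_1) (simp add: upper_half_plane_def)

lemma qunit_q_expansion:
  assumes "qunit N f" "N > 0" shows "\<exists>F. has_q_expansion N f F \<and> (\<forall>k. fls_nth F k \<in> K)"
proof -
  from assms obtain k P F where
    P: "P holomorphic_on ball 0 1" "P has_fps_expansion F" "fps_over F"
      and f: "\<And>\<tau>. \<tau>\<in>upper_half_plane \<Longrightarrow> f \<tau> = e2pi (of_int k * \<tau> / of_nat N) * P (e2pi (\<tau> / of_nat N))"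
    unfolding qunit_def disc_unit_def by blast
  define L where "L = fls_shift (- k) (fps_to_fls F)"
  have r: "fps_conv_radius F \<ge> 1"
    using holomorphic_on_imp_fps_conv_radius_ge[OF P(2), of 1] P(1) by (simp add: one_ereal_def)
  have "f \<tau> = eval_fls L (e2pi (\<tau> / of_nat N))" if \<tau>: "\<tau> \<in> upper_half_plane" for \<tau>
  proof -
    define t where "t = e2pi (\<tau> / of_nat N)"
    have t: "norm t < 1" "t \<noteq> 0" using norm_t_less_1[OF \<tau> assms(2)] by (auto simp: t_def)
    have "ereal (norm t) < fps_conv_radius F" using t r by (metis ereal_less(3) less_le_trans)
    hence "eval_fls L t = eval_fps F t * t powi k"
      unfolding L_def using t by (simp add: eval_fls_shift eval_fps_to_fls)
    also have "eval_fps F t = P t" by (rule has_fps_expansion_imp_eval_fps_eq[OF P(2) t(1) P(1)])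
    finally show ?thesis using f[OF \<tau>] by (simp add: t_def e2pi_power_int)
  qed
  moreover have "fls_conv_radius L \<ge> 1" unfolding L_def using r by simp
  moreover have "fls_nth L j \<in> K" for j using P(3) zero by (auto simp: L_def fps_over_def)
  ultimately show ?thesis unfolding has_q_expansion_def by blast
qed

lemma qunit_holomorphic: assumes "qunit N f" "N > 0" shows "f holomorphic_on upper_half_plane"
proof -
  from assms obtain k P where
    P: "P holomorphic_on ball 0 1"
      and f: "\<And>\<tau>. \<tau>\<in>upper_half_plane \<Longrightarrow> f \<tau> = e2pi (of_int k * \<tau> / of_nat N) * P (e2pi (\<tau> / of_nat N))"
    unfolding qunit_def disc_unit_def by blast
  have "(\<lambda>\<tau>. e2pi (\<tau> / of_nat N)) holomorphic_on upper_half_plane"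
    using assms(2) by (intro holomorphic_intros) auto
  moreover have "(\<lambda>\<tau>. e2pi (\<tau> / of_nat N)) ` upper_half_plane \<subseteq> ball 0 1"
    using norm_t_less_1 assms(2) by auto
  ultimately have "(\<lambda>\<tau>. P (e2pi (\<tau> / of_nat N))) holomorphic_on upper_half_plane"
    using holomorphic_on_compose_gen[OF _ P] by (auto simp: o_def)
  hence "(\<lambda>\<tau>. e2pi (of_int k * \<tau> / of_nat N) * P (e2pi (\<tau> / of_nat N))) holomorphic_on upper_half_plane"
    using assms(2) by (intro holomorphic_intros) auto
  thus ?thesis by (rule holomorphic_transform) (simp add: f)
qed

lemma qunit_nonzero: "qunit N f \<Longrightarrow> N > 0 \<Longrightarrow> \<tau> \<in> upper_half_plane \<Longrightarrow> f \<tau> \<noteq> 0"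
  using norm_t_less_1[of \<tau> N] unfolding qunit_def disc_unit_def by auto

end

section \<open>Expansions with cyclotomic coefficients\<close>

interpretation all_complex: coeff_field UNIV
  by unfold_locales auto

lemma coeff_field_cyclotomic: "coeff_field (cyclotomic_field N)"
proof -
  define R :: "complex ring" where "R = ring_of_type_algebra"
  interpret R: Ring.field R unfolding R_def by (rule field_from_type_algebra)
  have R: "carrier R = UNIV" "x \<otimes>\<^bsub>R\<^esub> y = x * y" "\<one>\<^bsub>R\<^esub> = 1" "x \<oplus>\<^bsub>R\<^esub> y = x + y" "\<zero>\<^bsub>R\<^esub> = 0" for x y
    by (simp_all add: R_def ring_of_type_algebra_def)
  have neg: "\<ominus>\<^bsub>R\<^esub> x = - x" for x
    by (rule R.minus_equality) (simp_all add: R)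
  have inv: "inv\<^bsub>R\<^esub> x = inverse x" if "x \<noteq> 0" for x
    by (rule R.comm_inv_char) (use that in \<open>simp_all add: R\<close>)
  have K: "cyclotomic_field N = generate_field R {e2pi (1 / of_nat N)}" by (simp add: cyclotomic_field_def R_def)
  show ?thesis
  proof
    show one: "1 \<in> cyclotomic_field N" unfolding K using generate_field.one[of R] by (simp add: R)
    show "x - y \<in> cyclotomic_field N" if "x \<in> cyclotomic_field N" "y \<in> cyclotomic_field N" for x y
      using generate_field.eng_add[OF that(1)[unfolded K] generate_field.a_inv[OF that(2)[unfolded K]]]
      by (simp add: R K neg)
    hence zero: "0 \<in> cyclotomic_field N" using one by fastforce
    show "x * y \<in> cyclotomic_field N" if "x \<in> cyclotomic_field N" "y \<in> cyclotomic_field N" for x y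
      using generate_field.eng_mult[OF that(1)[unfolded K] that(2)[unfolded K]] by (simp add: R K)
    show "inverse x \<in> cyclotomic_field N" if "x \<in> cyclotomic_field N" for x
      using generate_field.m_inv[OF that[unfolded K]] zero by (cases "x = 0") (simp_all add: R K inv)
  qed
qed

interpretation cyc: coeff_field "cyclotomic_field N" for N
  by (rule coeff_field_cyclotomic)

lemma zeta_cyclotomic: "e2pi (of_int k / of_nat N) \<in> cyclotomic_field N"
proof -
  have 1: "e2pi (1 / of_nat N) \<in> cyclotomic_field N"
    unfolding cyclotomic_field_def by (rule generate_field.incl) simp
  have 2: "e2pi (1 / of_nat N) ^ n \<in> cyclotomic_field N" for n
    by (induction n) (auto intro: cyc.mult cyc.one 1)
  have "e2pi (of_int k / of_nat N) = (if k \<ge> 0 then e2pi (1 / of_nat N) ^ nat k else inverse (e2pi (1 / of_nat N) ^ nat (- k)))"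
    by (auto simp: e2pi_power e2pi_minus[symmetric])
  thus ?thesis using 2 cyc.inverse by auto
qed

text \<open>The part of \<open>phi\<close> at a torsion point that involves only integral powers of
  t = e(\<tau>/N) and coefficients in Q(zeta_N). The exponential left out has fractional exponents,
  which become integral in 12N-th powers and in ratios of differences.\<close>

definition theta_prod :: "nat \<Rightarrow> int \<times> int \<Rightarrow> complex \<Rightarrow> complex" where
  "theta_prod N x \<tau> = qprod (e2pi (torsion_pt N x \<tau>)) (e2pi \<tau>) * qprod (e2pi (\<tau> - torsion_pt N x \<tau>)) (e2pi \<tau>)"

lemma phi_theta_prod: "phi (torsion_pt N x \<tau>) \<tau> = e2pi (\<tau> / 12 - torsion_pt N x \<tau> / 2) * theta_prod N x \<tau>"
  by (simp add: phi_def theta_prod_def)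

text \<open>For 0 <= x_1 < N both products are series in t without zeros on the disc. The general
  case follows from \<open>phi_lattice\<close>, which contributes an integral power of t and a
  constant of the field.\<close>

lemma qunit_theta_prod:
  assumes N: "N > 0" and x: "\<And>i j. x \<noteq> (int N * i, int N * j)"
  shows "cyc.qunit N N (theta_prod N x)"
proof -
  \<comment> \<open>Only the first coordinate is reduced; the second enters through the root of
    unity \<zeta> alone.\<close>
  define x1 x2 where "x1 = nat (fst x mod int N)" and "x2 = snd x"
  define m where "m = fst x div int N"
  have x1: "x1 < N" using N by (simp add: x1_def nat_less_iff)
  have x: "x = (int x1, x2) + (int N * m, int N * 0)"
    using N by (simp add: x1_def x2_def m_def prod_eq_iff)
  have nz: "\<not> (x1 = 0 \<and> int N dvd x2)"
    using assms(2)[of m "x2 div int N"] x by auto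
  define \<zeta> where "\<zeta> = e2pi (of_int x2 / of_nat N)"
  have norm_\<zeta>: "norm \<zeta> = 1" by (simp add: \<zeta>_def norm_e2pi)
  have \<zeta>K: "\<zeta> \<in> cyclotomic_field N" "inverse \<zeta> \<in> cyclotomic_field N"
    using zeta_cyclotomic cyc.inverse by (auto simp: \<zeta>_def)
  \<comment> \<open>For x1 = 0 the constant term of the first product is 1 - \<zeta>, which must not
    vanish.\<close>
  have \<zeta>1: "\<zeta> \<noteq> 1" if "x1 = 0"
  proof
    assume "\<zeta> = 1"
    then obtain n where "of_int x2 / of_nat N = (of_int n :: complex)" by (auto simp: \<zeta>_def e2pi_eq_1_iff)
    hence "(of_int x2 :: complex) = of_int (n * int N)" using N by (simp add: field_simps)
    hence "x2 = n * int N" by (simp only: of_int_eq_iff)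
    thus False using nz that by simp
  qed
  have small: "(t ^ N) ^ n * (c * t ^ k) \<noteq> 1" if "norm t < 1" "norm c = 1" "N * n + k > 0" for t c :: complex and n k
  proof
    assume "(t ^ N) ^ n * (c * t ^ k) = 1"
    hence "norm (c * t ^ (N * n + k)) = 1" by (simp add: power_add power_mult mult_ac)
    hence "norm t ^ (N * n + k) = 1" using that by (simp add: norm_mult norm_power)
    thus False using that by (metis less_irrefl norm_ge_zero power_less_one_iff)
  qed
  have D1: "cyc.disc_unit N (\<lambda>t. qprod (\<zeta> * t ^ x1) (t ^ N))"
  proof (rule cyc.disc_unit_qprod[OF N \<zeta>K(1)])
    fix n and t :: complex assume t: "norm t < 1"
    show "(t ^ N) ^ n * (\<zeta> * t ^ x1) \<noteq> 1"
    proof (cases "N * n + x1 = 0")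
      case True
      hence "x1 = 0" "n = 0" using N by auto
      thus ?thesis using \<zeta>1 by simp
    next
      case False
      thus ?thesis using small[OF t norm_\<zeta>] by simp
    qed
  qed
  have D2: "cyc.disc_unit N (\<lambda>t. qprod (inverse \<zeta> * t ^ (N - x1)) (t ^ N))"
    by (rule cyc.disc_unit_qprod[OF N \<zeta>K(2)], rule small) (use x1 norm_\<zeta> in \<open>auto simp: norm_inverse\<close>)
  have U: "cyc.qunit N N (theta_prod N (int x1, x2))"
    unfolding cyc.qunit_def
  proof (intro exI[of _ 0] exI conjI ballI)
    show "cyc.disc_unit N (\<lambda>t. qprod (\<zeta> * t ^ x1) (t ^ N) * qprod (inverse \<zeta> * t ^ (N - x1)) (t ^ N))"
      by (rule cyc.disc_unit_mult[OF D1 D2])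
    fix \<tau> :: complex
    define t where "t = e2pi (\<tau> / of_nat N)"
    have q: "e2pi \<tau> = t ^ N" using N by (simp add: t_def e2pi_power)
    have z: "torsion_pt N (int x1, x2) \<tau> = of_nat x1 * (\<tau> / of_nat N) + of_int x2 / of_nat N"
      by (simp add: torsion_pt_def add_divide_distrib)
    have 1: "e2pi (torsion_pt N (int x1, x2) \<tau>) = \<zeta> * t ^ x1"
      unfolding z e2pi_add by (simp add: t_def \<zeta>_def e2pi_power)
    have "\<tau> - torsion_pt N (int x1, x2) \<tau> = of_nat (N - x1) * (\<tau> / of_nat N) + - (of_int x2 / of_nat N)"
      using x1 N by (simp add: z of_nat_diff field_simps)
    hence 2: "e2pi (\<tau> - torsion_pt N (int x1, x2) \<tau>) = inverse \<zeta> * t ^ (N - x1)"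
      by (simp only: e2pi_add) (simp add: t_def \<zeta>_def e2pi_power e2pi_minus)
    show "theta_prod N (int x1, x2) \<tau> = e2pi (of_int 0 * \<tau> / of_nat N) * (qprod (\<zeta> * e2pi (\<tau> / of_nat N) ^ x1) (e2pi (\<tau> / of_nat N) ^ N) *
        qprod (inverse \<zeta> * e2pi (\<tau> / of_nat N) ^ (N - x1)) (e2pi (\<tau> / of_nat N) ^ N))"
      by (simp add: theta_prod_def 1 2 q t_def[symmetric])
  qed
  define s where "s = (- 1 :: complex) ^ nat \<bar>m\<bar>"
  have em: "e2pi (of_int m) = 1" by simp
  have "cyc.qunit N N (\<lambda>\<tau>. (e2pi (of_int m / 2) * e2pi (of_int (- m * x2) / of_nat N)) *
      (e2pi (of_int (int N * ((m - m ^ 2) div 2) - m * int x1) * \<tau> / of_nat N) * theta_prod N (int x1, x2) \<tau>))"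
  proof (intro cyc.qunit_mult cyc.qunit_const cyc.qunit_e2pi U)
    have "e2pi (of_int m / 2) = 1 \<or> e2pi (of_int m / 2) = - 1"
      using em e2pi_power[of "of_int m / 2" 2] by (simp add: power2_eq_1_iff)
    thus "e2pi (of_int m / 2) \<in> cyclotomic_field N" using cyc.one cyc.uminus by metis
    show "e2pi (of_int (- m * x2) / of_nat N) \<in> cyclotomic_field N" by (rule zeta_cyclotomic)
  qed auto
  thus ?thesis
  proof (rule cyc.qunit_cong)
    fix \<tau> :: complex assume \<tau>: "Im \<tau> > 0"
    define z where "z = torsion_pt N (int x1, x2) \<tau>"
    have zx: "torsion_pt N x \<tau> = z + of_int m * \<tau> + of_int 0"
      using N unfolding x z_def by (simp add: torsion_pt_def field_simps)
    \<comment> \<open>\<open>phi_lattice\<close> contributes (m - m^2) \<tau> / 2, which is an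
      integral multiple of \<tau>.\<close>
    have ev: "even (m - m ^ 2)" by simp
    then obtain h where h: "m - m ^ 2 = 2 * h" by blast
    hence h': "(m - m ^ 2) div 2 = h" by simp
    have hc: "of_int m - of_int m ^ 2 = 2 * (of_int h :: complex)"
      using arg_cong[OF h, of "of_int :: int \<Rightarrow> complex"] by simp
    have "theta_prod N x \<tau> = e2pi (- (\<tau> / 12 - torsion_pt N x \<tau> / 2)) * phi (torsion_pt N x \<tau>) \<tau>"
      unfolding phi_theta_prod e2pi_minus by simp
    also have "\<dots> = e2pi (- (\<tau> / 12 - torsion_pt N x \<tau> / 2)) * (e2pi (of_int (m + 0) / 2 - of_int m * z - of_int m ^ 2 * \<tau> / 2) *
        (e2pi (\<tau> / 12 - z / 2) * theta_prod N (int x1, x2) \<tau>))"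
      unfolding zx phi_lattice[OF \<tau>] unfolding z_def phi_theta_prod ..
    also have "\<dots> = e2pi (- (\<tau> / 12 - torsion_pt N x \<tau> / 2) + (of_int m / 2 - of_int m * z - of_int m ^ 2 * \<tau> / 2) +
        (\<tau> / 12 - z / 2)) * theta_prod N (int x1, x2) \<tau>"
      by (simp only: add_0_right e2pi_add mult.assoc)
    also have "- (\<tau> / 12 - torsion_pt N x \<tau> / 2) + (of_int m / 2 - of_int m * z - of_int m ^ 2 * \<tau> / 2) + (\<tau> / 12 - z / 2) =
       of_int m / 2 + (of_int m - of_int m ^ 2) * \<tau> / 2 - of_int m * z"
      unfolding zx by (simp add: field_simps)
    also have "\<dots> = of_int m / 2 + of_int (- m * x2) / of_nat N + of_int (int N * h - m * int x1) * \<tau> / of_nat N"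
      unfolding hc using N by (simp add: z_def torsion_pt_def field_simps)
    finally show "theta_prod N x \<tau> = (e2pi (of_int m / 2) * e2pi (of_int (- m * x2) / of_nat N)) *
      (e2pi (of_int (int N * ((m - m ^ 2) div 2) - m * int x1) * \<tau> / of_nat N) * theta_prod N (int x1, x2) \<tau>)"
      by (simp only: h' e2pi_add mult.assoc)
  qed
qed

section \<open>Units of the modular curve\<close>

lemma moebius_upper_half_plane: "\<gamma> \<in> SL2Z \<Longrightarrow> \<tau> \<in> upper_half_plane \<Longrightarrow> moebius \<gamma> \<tau> \<in> upper_half_plane"
  by (cases \<gamma>) (auto simp: SL2Z_def upper_half_plane_def intro!: Im_moebius(2)[simplified])

lemma Gamma_full_SL2Z: "\<gamma> \<in> Gamma_full N \<Longrightarrow> \<gamma> \<in> SL2Z"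
  by (auto simp: Gamma_full_def)

lemma has_q_expansion_cong:
  "has_q_expansion N f F \<Longrightarrow> (\<And>\<tau>. \<tau> \<in> upper_half_plane \<Longrightarrow> g \<tau> = f \<tau>) \<Longrightarrow> has_q_expansion N g F"
  by (simp add: has_q_expansion_def)

lemma has_q_expansion_ex_cong:
  "has_q_expansion N f F \<Longrightarrow> (\<And>\<tau>. \<tau> \<in> upper_half_plane \<Longrightarrow> g \<tau> = f \<tau>) \<Longrightarrow> \<exists>F. has_q_expansion N g F"
  using has_q_expansion_cong by blast

lemma has_q_expansion_op:
  assumes "has_q_expansion N f F" "has_q_expansion N g G" "N > 0"
  shows "has_q_expansion N (\<lambda>\<tau>. f \<tau> + g \<tau>) (F + G)" "has_q_expansion N (\<lambda>\<tau>. f \<tau> * g \<tau>) (F * G)"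
    "has_q_expansion N (\<lambda>\<tau>. - f \<tau>) (- F)"
proof -
  have r: "fls_conv_radius F \<ge> 1" "fls_conv_radius G \<ge> 1" using assms by (auto simp: has_q_expansion_def)
  have t: "ereal (norm (e2pi (\<tau> / of_nat N))) < fls_conv_radius F" "ereal (norm (e2pi (\<tau> / of_nat N))) < fls_conv_radius G"
    if "\<tau> \<in> upper_half_plane" for \<tau>
    using all_complex.norm_t_less_1[OF that assms(3)] r by (metis ereal_less(3) less_le_trans)+
  show "has_q_expansion N (\<lambda>\<tau>. f \<tau> + g \<tau>) (F + G)" "has_q_expansion N (\<lambda>\<tau>. f \<tau> * g \<tau>) (F * G)"
    "has_q_expansion N (\<lambda>\<tau>. - f \<tau>) (- F)"
    using assms(1,2) r t unfolding has_q_expansion_def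
    by (auto simp: eval_fls_add eval_fls_mult eval_fls_minus intro: fls_conv_radius_add_ge fls_conv_radius_mult_ge)
qed

lemma (in coeff_field) fls_over_mult:
  assumes "\<And>k. fls_nth F k \<in> K" "\<And>k. fls_nth G k \<in> K" shows "fls_nth (F * G) k \<in> K"
  unfolding fls_times_nth(1) by (intro sum mult assms)

lemma has_q_expansion_const: "has_q_expansion N (\<lambda>_. c) (fls_const c)"
  by (simp add: has_q_expansion_def)

lemma Y_carrierI:
  assumes "f \<in> extensional upper_half_plane" "f holomorphic_on upper_half_plane"
    "\<And>\<gamma> \<tau>. \<gamma> \<in> Gamma_full N \<Longrightarrow> \<tau> \<in> upper_half_plane \<Longrightarrow> f (moebius \<gamma> \<tau>) = f \<tau>"
    "\<And>\<gamma>. \<gamma> \<in> SL2Z \<Longrightarrow> \<exists>F. has_q_expansion N (\<lambda>\<tau>. f (moebius \<gamma> \<tau>)) F"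
    "has_q_expansion N f F" "\<And>k. fls_nth F k \<in> cyclotomic_field N"
  shows "f \<in> Y_carrier N"
  using assms unfolding Y_carrier_def by blast

lemma Y_carrier_op:
  assumes f: "f \<in> Y_carrier N" and g: "g \<in> Y_carrier N" and N: "N > 0"
  shows "(\<lambda>\<tau>\<in>upper_half_plane. f \<tau> + g \<tau>) \<in> Y_carrier N" (is ?A)
    "(\<lambda>\<tau>\<in>upper_half_plane. f \<tau> * g \<tau>) \<in> Y_carrier N" (is ?M)
    "(\<lambda>\<tau>\<in>upper_half_plane. - f \<tau>) \<in> Y_carrier N" (is ?U)
proof -
  obtain F G where F: "has_q_expansion N f F" "\<And>k. fls_nth F k \<in> cyclotomic_field N"
    and G: "has_q_expansion N g G" "\<And>k. fls_nth G k \<in> cyclotomic_field N"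
    using f g unfolding Y_carrier_def by blast
  have hol: "f holomorphic_on upper_half_plane" "g holomorphic_on upper_half_plane"
    using f g by (auto simp: Y_carrier_def)
  have inv: "f (moebius \<gamma> \<tau>) = f \<tau>" "g (moebius \<gamma> \<tau>) = g \<tau>"
    if "\<gamma> \<in> Gamma_full N" "\<tau> \<in> upper_half_plane" for \<gamma> \<tau>
    using f g that by (auto simp: Y_carrier_def)
  note H = moebius_upper_half_plane moebius_upper_half_plane[OF Gamma_full_SL2Z]
  have ex: "\<exists>F G. has_q_expansion N (\<lambda>\<tau>. f (moebius \<gamma> \<tau>)) F \<and> has_q_expansion N (\<lambda>\<tau>. g (moebius \<gamma> \<tau>)) G"
    if "\<gamma> \<in> SL2Z" for \<gamma>
    using f g that by (auto simp: Y_carrier_def)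
  show ?A
  proof (rule Y_carrierI)
    show "(\<lambda>\<tau>\<in>upper_half_plane. f \<tau> + g \<tau>) holomorphic_on upper_half_plane"
      by (rule holomorphic_transform[OF holomorphic_on_add[OF hol]]) auto
    show "has_q_expansion N (\<lambda>\<tau>\<in>upper_half_plane. f \<tau> + g \<tau>) (F + G)"
      by (rule has_q_expansion_cong[OF has_q_expansion_op(1)[OF F(1) G(1) N]]) auto
    fix \<gamma> assume \<gamma>: "\<gamma> \<in> SL2Z"
    with ex obtain F' G' where "has_q_expansion N (\<lambda>\<tau>. f (moebius \<gamma> \<tau>)) F'" "has_q_expansion N (\<lambda>\<tau>. g (moebius \<gamma> \<tau>)) G'"
      by blast
    from has_q_expansion_op(1)[OF this N]
    show "\<exists>F. has_q_expansion N (\<lambda>\<tau>. (\<lambda>\<tau>\<in>upper_half_plane. f \<tau> + g \<tau>) (moebius \<gamma> \<tau>)) F"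
      by (rule has_q_expansion_ex_cong) (use H \<gamma> in auto)
  qed (use inv H F G in \<open>auto intro: cyc.add\<close>)
  show ?M
  proof (rule Y_carrierI)
    show "(\<lambda>\<tau>\<in>upper_half_plane. f \<tau> * g \<tau>) holomorphic_on upper_half_plane"
      by (rule holomorphic_transform[OF holomorphic_on_mult[OF hol]]) auto
    show "has_q_expansion N (\<lambda>\<tau>\<in>upper_half_plane. f \<tau> * g \<tau>) (F * G)"
      by (rule has_q_expansion_cong[OF has_q_expansion_op(2)[OF F(1) G(1) N]]) auto
    fix \<gamma> assume \<gamma>: "\<gamma> \<in> SL2Z"
    with ex obtain F' G' where "has_q_expansion N (\<lambda>\<tau>. f (moebius \<gamma> \<tau>)) F'" "has_q_expansion N (\<lambda>\<tau>. g (moebius \<gamma> \<tau>)) G'"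
      by blast
    from has_q_expansion_op(2)[OF this N]
    show "\<exists>F. has_q_expansion N (\<lambda>\<tau>. (\<lambda>\<tau>\<in>upper_half_plane. f \<tau> * g \<tau>) (moebius \<gamma> \<tau>)) F"
      by (rule has_q_expansion_ex_cong) (use H \<gamma> in auto)
  qed (use inv H F G in \<open>auto intro: cyc.fls_over_mult\<close>)
  show ?U
  proof (rule Y_carrierI)
    show "(\<lambda>\<tau>\<in>upper_half_plane. - f \<tau>) holomorphic_on upper_half_plane"
      by (rule holomorphic_transform[OF holomorphic_on_minus[OF hol(1)]]) auto
    show "has_q_expansion N (\<lambda>\<tau>\<in>upper_half_plane. - f \<tau>) (- F)"
      by (rule has_q_expansion_cong[OF has_q_expansion_op(3)[OF F(1) G(1) N]]) auto
    fix \<gamma> assume \<gamma>: "\<gamma> \<in> SL2Z"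
    with ex obtain F' G' where "has_q_expansion N (\<lambda>\<tau>. f (moebius \<gamma> \<tau>)) F'" "has_q_expansion N (\<lambda>\<tau>. g (moebius \<gamma> \<tau>)) G'"
      by blast
    from has_q_expansion_op(3)[OF this N]
    show "\<exists>F. has_q_expansion N (\<lambda>\<tau>. (\<lambda>\<tau>\<in>upper_half_plane. - f \<tau>) (moebius \<gamma> \<tau>)) F"
      by (rule has_q_expansion_ex_cong) (use H \<gamma> in auto)
  qed (use inv H F G in \<open>auto intro: cyc.uminus\<close>)
qed

lemma Y_carrier_const:
  assumes "c \<in> cyclotomic_field N" shows "(\<lambda>\<tau>\<in>upper_half_plane. c) \<in> Y_carrier N"
proof (rule Y_carrierI)
  note H = moebius_upper_half_plane moebius_upper_half_plane[OF Gamma_full_SL2Z]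
  show "(\<lambda>\<tau>\<in>upper_half_plane. c) holomorphic_on upper_half_plane"
    by (rule holomorphic_transform[of "\<lambda>_. c"]) auto
  show "has_q_expansion N (\<lambda>\<tau>\<in>upper_half_plane. c) (fls_const c)"
    by (rule has_q_expansion_cong[OF has_q_expansion_const]) auto
  show "\<exists>F. has_q_expansion N (\<lambda>\<tau>. (\<lambda>\<tau>\<in>upper_half_plane. c) (moebius \<gamma> \<tau>)) F" if "\<gamma> \<in> SL2Z" for \<gamma>
    by (rule has_q_expansion_ex_cong[OF has_q_expansion_const]) (use H that in auto)
  show "(\<lambda>\<tau>\<in>upper_half_plane. c) (moebius \<gamma> \<tau>) = (\<lambda>\<tau>\<in>upper_half_plane. c) \<tau>"
    if "\<gamma> \<in> Gamma_full N" "\<tau> \<in> upper_half_plane" for \<gamma> \<tau>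
    using H that by simp
  show "fls_nth (fls_const c) k \<in> cyclotomic_field N" for k
    using assms cyc.zero by simp
qed auto

lemma Y_ring_simps:
  "carrier (Y_ring N) = Y_carrier N"
  "f \<otimes>\<^bsub>Y_ring N\<^esub> g = (\<lambda>\<tau>\<in>upper_half_plane. f \<tau> * g \<tau>)"
  "f \<oplus>\<^bsub>Y_ring N\<^esub> g = (\<lambda>\<tau>\<in>upper_half_plane. f \<tau> + g \<tau>)"
  "\<one>\<^bsub>Y_ring N\<^esub> = (\<lambda>\<tau>\<in>upper_half_plane. 1)" "\<zero>\<^bsub>Y_ring N\<^esub> = (\<lambda>\<tau>\<in>upper_half_plane. 0)"
  by (simp_all add: Y_ring_def)

lemma Y_eqI:
  assumes "f \<in> extensional upper_half_plane" "g \<in> extensional upper_half_plane"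
    "\<And>\<tau>. Im \<tau> > 0 \<Longrightarrow> f \<tau> = g \<tau>"
  shows "f = g"
  using assms by (intro extensionalityI[of f upper_half_plane g]) (auto simp: upper_half_plane_def)

lemma Y_carrier_ext: "f \<in> Y_carrier N \<Longrightarrow> f \<in> extensional upper_half_plane"
  by (simp add: Y_carrier_def)

lemma Y_ring_cring:
  assumes N: "N > 0" shows "cring (Y_ring N)"
proof (intro cringI abelian_groupI comm_monoidI)
  fix f assume f: "f \<in> carrier (Y_ring N)"
  show "\<exists>g\<in>carrier (Y_ring N). g \<oplus>\<^bsub>Y_ring N\<^esub> f = \<zero>\<^bsub>Y_ring N\<^esub>"
    by (rule bexI[of _ "\<lambda>\<tau>\<in>upper_half_plane. - f \<tau>"])
       (use f Y_carrier_op(3)[OF _ _ N, of f f] in \<open>auto simp: Y_ring_simps fun_eq_iff\<close>)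
  show "\<zero>\<^bsub>Y_ring N\<^esub> \<oplus>\<^bsub>Y_ring N\<^esub> f = f" "\<one>\<^bsub>Y_ring N\<^esub> \<otimes>\<^bsub>Y_ring N\<^esub> f = f"
    using f by (auto simp: Y_ring_simps upper_half_plane_def intro!: Y_eqI dest: Y_carrier_ext)
qed (use Y_carrier_op[OF _ _ N] Y_carrier_const[OF cyc.zero] Y_carrier_const[OF cyc.one] in
     \<open>auto simp: Y_ring_simps fun_eq_iff algebra_simps\<close>)

lemma Y_carrier_qunit:
  assumes N: "N > 0" and ext: "f \<in> extensional upper_half_plane" and q: "cyc.qunit N N f"
    and \<gamma>: "\<And>\<gamma>. \<gamma> \<in> SL2Z \<Longrightarrow> all_complex.qunit N (\<lambda>\<tau>. f (moebius \<gamma> \<tau>))"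
    and inv: "\<And>\<gamma> \<tau>. \<gamma> \<in> Gamma_full N \<Longrightarrow> \<tau> \<in> upper_half_plane \<Longrightarrow> f (moebius \<gamma> \<tau>) = f \<tau>"
  shows "f \<in> Y_carrier N"
proof -
  obtain F where F: "has_q_expansion N f F" "\<And>k. fls_nth F k \<in> cyclotomic_field N"
    using cyc.qunit_q_expansion[OF q N] by blast
  show ?thesis
    by (rule Y_carrierI[OF ext cyc.qunit_holomorphic[OF q N] inv _ F])
       (use all_complex.qunit_q_expansion[OF \<gamma> N] in blast)+
qed

text \<open>The shape t^k P(t) with P free of zeros passes to the inverse, so the conditions for
  membership in the ring hold for the inverse as well.\<close>

lemma Y_unitI:
  assumes N: "N > 0" and ext: "f \<in> extensional upper_half_plane" and q: "cyc.qunit N N f"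
    and \<gamma>: "\<And>\<gamma>. \<gamma> \<in> SL2Z \<Longrightarrow> all_complex.qunit N (\<lambda>\<tau>. f (moebius \<gamma> \<tau>))"
    and inv: "\<And>\<gamma> \<tau>. \<gamma> \<in> Gamma_full N \<Longrightarrow> \<tau> \<in> upper_half_plane \<Longrightarrow> f (moebius \<gamma> \<tau>) = f \<tau>"
  shows "f \<in> Units (Y_ring N)"
proof -
  define g where "g = (\<lambda>\<tau>\<in>upper_half_plane. inverse (f \<tau>))"
  have f: "f \<in> Y_carrier N" by (rule Y_carrier_qunit[OF N ext q \<gamma> inv])
  have g: "g \<in> Y_carrier N"
  proof (rule Y_carrier_qunit[OF N])
    show "cyc.qunit N N g"
      by (rule cyc.qunit_cong[OF cyc.qunit_inverse[OF q]]) (simp add: g_def upper_half_plane_def)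
    show "all_complex.qunit N (\<lambda>\<tau>. g (moebius \<gamma> \<tau>))" if "\<gamma> \<in> SL2Z" for \<gamma>
      by (rule all_complex.qunit_cong[OF all_complex.qunit_inverse[OF \<gamma>[OF that]]])
         (use moebius_upper_half_plane[OF that] in \<open>simp add: g_def upper_half_plane_def\<close>)
    show "g (moebius \<gamma> \<tau>) = g \<tau>" if "\<gamma> \<in> Gamma_full N" "\<tau> \<in> upper_half_plane" for \<gamma> \<tau>
      using inv[OF that] moebius_upper_half_plane[OF Gamma_full_SL2Z[OF that(1)] that(2)] that(2) by (simp add: g_def)
  qed (auto simp: g_def)
  have "f \<tau> * g \<tau> = 1" if "\<tau> \<in> upper_half_plane" for \<tau>
    using cyc.qunit_nonzero[OF q N that] that by (simp add: g_def)
  thus ?thesis using f g unfolding Units_def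
    by (auto simp: Y_ring_simps fun_eq_iff mult.commute intro!: bexI[of _ g])
qed

section \<open>Powers of Siegel functions as units\<close>

definition zero_mod where "zero_mod N x \<longleftrightarrow> (\<exists>i j. x = (int N * i, int N * j))"

text \<open>The exponent 12N kills the multiplier of order dividing 12 under SL_2(Z) and the one of
  order dividing 2N under translations of x. The value 1 is the convention for g_0.\<close>

definition siegel_power :: "nat \<Rightarrow> int \<times> int \<Rightarrow> complex \<Rightarrow> complex" where
  "siegel_power N x = (\<lambda>\<tau>\<in>upper_half_plane. if zero_mod N x then 1 else siegel_raw N x \<tau> ^ (12 * N))"

lemma siegel_raw_theta_prod: "siegel_raw N x \<tau> = e2pi (of_int (fst x) * torsion_pt N x \<tau> / (2 * of_nat N) + \<tau> / 12 - torsion_pt N x \<tau> / 2) * theta_prod N x \<tau>"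
  by (simp add: siegel_raw_def phi_theta_prod e2pi_add[symmetric] mult.assoc[symmetric] add_diff_eq)

text \<open>The exponent of t is 6 N^2 B_2(x_1/N), which is an integer; the integral phase 6 x_2
  drops out.\<close>

lemma siegel_raw_power_theta_prod:
  assumes "N > 0"
  shows "siegel_raw N x \<tau> ^ (12 * N) = e2pi (of_int (6 * fst x * snd x) / of_nat N) *
     (e2pi (of_int (6 * fst x ^ 2 + int N ^ 2 - 6 * int N * fst x) * \<tau> / of_nat N) * theta_prod N x \<tau> ^ (12 * N))"
proof -
  have "of_nat (12 * N) * (of_int (fst x) * torsion_pt N x \<tau> / (2 * of_nat N) + \<tau> / 12 - torsion_pt N x \<tau> / 2) =
     (of_int (6 * fst x * snd x) / of_nat N + of_int (6 * fst x ^ 2 + int N ^ 2 - 6 * int N * fst x) * \<tau> / of_nat N)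
      + of_int (- 6 * snd x)"
    using assms by (simp add: torsion_pt_def field_simps power2_eq_square)
  hence "e2pi (of_nat (12 * N) * (of_int (fst x) * torsion_pt N x \<tau> / (2 * of_nat N) + \<tau> / 12 - torsion_pt N x \<tau> / 2)) =
     e2pi (of_int (6 * fst x * snd x) / of_nat N) * e2pi (of_int (6 * fst x ^ 2 + int N ^ 2 - 6 * int N * fst x) * \<tau> / of_nat N)"
    by (simp only: e2pi_add e2pi_of_int mult_1_right)
  thus ?thesis by (simp only: siegel_raw_theta_prod power_mult_distrib e2pi_power mult.assoc)
qed

lemma zero_mod_qunit: "N > 0 \<Longrightarrow> \<not> zero_mod N x \<Longrightarrow> cyc.qunit N N (theta_prod N x)"
  by (rule qunit_theta_prod) (auto simp: zero_mod_def)

lemma qunit_all: "cyc.qunit N N f \<Longrightarrow> all_complex.qunit N f"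
  unfolding cyc.qunit_def all_complex.qunit_def cyc.disc_unit_def all_complex.disc_unit_def all_complex.fps_over_def
  by blast

lemma qunit_siegel_power: assumes "N > 0" shows "cyc.qunit N N (siegel_power N x)"
proof (cases "zero_mod N x")
  case True
  show ?thesis
    by (rule cyc.qunit_cong[OF cyc.qunit_const[OF cyc.one]]) (use True in \<open>auto simp: siegel_power_def upper_half_plane_def\<close>)
next
  case False
  have "cyc.qunit N N (\<lambda>\<tau>. e2pi (of_int (6 * fst x * snd x) / of_nat N) *
     (e2pi (of_int (6 * fst x ^ 2 + int N ^ 2 - 6 * int N * fst x) * \<tau> / of_nat N) * theta_prod N x \<tau> ^ (12 * N)))"
    by (intro cyc.qunit_mult cyc.qunit_const cyc.qunit_e2pi cyc.qunit_power zero_mod_qunit zeta_cyclotomic assms False) simp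
  thus ?thesis
    by (rule cyc.qunit_cong) (use False in \<open>simp add: siegel_power_def upper_half_plane_def siegel_raw_power_theta_prod[OF assms]\<close>)
qed

lemma zero_mod_siegel_raw: "Im \<tau> > 0 \<Longrightarrow> N > 0 \<Longrightarrow> siegel_raw N x \<tau> = 0 \<longleftrightarrow> zero_mod N x"
  using siegel_raw_eq_0_iff[of \<tau> N x] by (simp add: zero_mod_def)

lemma siegel_raw_modular_SL2Z:
  assumes "\<gamma> \<in> SL2Z" "\<tau> \<in> upper_half_plane"
  obtains C where "C ^ 12 = 1" "\<And>N x. N > 0 \<Longrightarrow> siegel_raw N x (moebius \<gamma> \<tau>) = C * siegel_raw N (row_act x \<gamma>) \<tau>"
  using assms siegel_raw_modular[of "fst \<gamma>" "snd (snd (snd \<gamma>))" "fst (snd \<gamma>)" "fst (snd (snd \<gamma>))" \<tau>]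
  by (auto simp: SL2Z_def upper_half_plane_def)

lemma zero_mod_row_act: assumes "\<gamma> \<in> SL2Z" "N > 0" shows "zero_mod N (row_act x \<gamma>) \<longleftrightarrow> zero_mod N x"
proof -
  \<comment> \<open>Vanishing of \<open>siegel_raw\<close> at the point i detects
    \<open>zero_mod\<close>, which replaces an argument with the inverse matrix.\<close>
  have i: "\<i> \<in> upper_half_plane" by (simp add: upper_half_plane_def)
  obtain C where C: "C ^ 12 = 1" "\<And>N x. N > 0 \<Longrightarrow> siegel_raw N x (moebius \<gamma> \<i>) = C * siegel_raw N (row_act x \<gamma>) \<i>"
    using siegel_raw_modular_SL2Z[OF assms(1) i] by blast
  have "C \<noteq> 0" using C(1) by auto
  thus ?thesis
    using C(2)[OF assms(2), of x] zero_mod_siegel_raw[of \<i> N] zero_mod_siegel_raw[of "moebius \<gamma> \<i>" N x]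
      moebius_upper_half_plane[OF assms(1) i] assms(2) by (auto simp: upper_half_plane_def)
qed

lemma zero_mod_add: "zero_mod N y \<Longrightarrow> zero_mod N (x + y) \<longleftrightarrow> zero_mod N x"
proof -
  assume "zero_mod N y"
  then obtain i j where y: "y = (int N * i, int N * j)" by (auto simp: zero_mod_def)
  show ?thesis
  proof
    assume "zero_mod N (x + y)"
    then obtain k l where "x + y = (int N * k, int N * l)" by (auto simp: zero_mod_def)
    hence "x = (int N * (k - i), int N * (l - j))" by (simp add: y prod_eq_iff algebra_simps)
    thus "zero_mod N x" unfolding zero_mod_def by blast
  next
    assume "zero_mod N x"
    then obtain k l where "x = (int N * k, int N * l)" by (auto simp: zero_mod_def)
    hence "x + y = (int N * (k + i), int N * (l + j))" by (simp add: y algebra_simps)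
    thus "zero_mod N (x + y)" unfolding zero_mod_def by blast
  qed
qed

lemma zero_mod_minus: "zero_mod N (- x) \<longleftrightarrow> zero_mod N x"
proof -
  have "zero_mod N (- x)" if "zero_mod N x" for x
  proof -
    from that obtain k l where "x = (int N * k, int N * l)" by (auto simp: zero_mod_def)
    hence "- x = (int N * (- k), int N * (- l))" by simp
    thus ?thesis unfolding zero_mod_def by blast
  qed
  from this[of x] this[of "- x"] show ?thesis by auto
qed

lemma siegel_power_ext: "siegel_power N x \<in> extensional upper_half_plane" by (simp add: siegel_power_def)

lemma siegel_power_minus: "siegel_power N (- x) = siegel_power N x"
  by (rule Y_eqI[OF siegel_power_ext siegel_power_ext]) (simp add: siegel_power_def upper_half_plane_def zero_mod_minus siegel_raw_minus power_mult)

lemma siegel_power_periodic: assumes "N > 0" shows "siegel_power N (x + (int N * i, int N * j)) = siegel_power N x"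
proof (rule Y_eqI[OF siegel_power_ext siegel_power_ext])
  fix \<tau> :: complex assume \<tau>: "Im \<tau> > 0"
  have l: "zero_mod N (x + (int N * i, int N * j)) \<longleftrightarrow> zero_mod N x" by (rule zero_mod_add) (auto simp: zero_mod_def)
  have "of_nat (12 * N) * (of_int (fst x * j - i * snd x) / (2 * of_nat N) + of_int (i * j + i + j) / 2) =
     (of_int (6 * (fst x * j - i * snd x) + 6 * int N * (i * j + i + j)) :: complex)"
    using assms by (simp add: field_simps)
  hence "e2pi (of_int (fst x * j - i * snd x) / (2 * of_nat N) + of_int (i * j + i + j) / 2) ^ (12 * N) = 1"
    by (simp only: e2pi_power e2pi_of_int)
  thus "siegel_power N (x + (int N * i, int N * j)) \<tau> = siegel_power N x \<tau>"
    using l \<tau> by (simp add: siegel_power_def siegel_raw_shift[OF \<tau> assms] power_mult_distrib upper_half_plane_def)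
qed

lemma siegel_power_moebius:
  assumes "\<gamma> \<in> SL2Z" "\<tau> \<in> upper_half_plane" "N > 0" shows "siegel_power N x (moebius \<gamma> \<tau>) = siegel_power N (row_act x \<gamma>) \<tau>"
proof -
  obtain C where C: "C ^ 12 = 1" "\<And>N x. N > 0 \<Longrightarrow> siegel_raw N x (moebius \<gamma> \<tau>) = C * siegel_raw N (row_act x \<gamma>) \<tau>"
    using siegel_raw_modular_SL2Z[OF assms(1,2)] by blast
  thus ?thesis using assms moebius_upper_half_plane[OF assms(1,2)]
    by (simp add: siegel_power_def zero_mod_row_act power_mult_distrib power_mult)
qed

text \<open>The matrix \<delta> is (\<gamma> - 1)/N, integral by the congruences modulo N.\<close>

lemma Gamma_full_row_act:
  assumes "\<gamma> \<in> Gamma_full N"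
  obtains \<delta> where "\<And>x. row_act x \<gamma> = x + (int N * fst (row_act x \<delta>), int N * snd (row_act x \<delta>))"
proof -
  obtain a b c d where \<gamma>: "\<gamma> = (a, b, c, d)" by (metis prod.exhaust)
  have "int N dvd a - 1" "int N dvd b" "int N dvd c" "int N dvd d - 1"
    using assms by (auto simp: Gamma_full_def \<gamma> cong_iff_dvd_diff)
  then obtain a' b' c' d' where *: "a - 1 = int N * a'" "b = int N * b'" "c = int N * c'" "d - 1 = int N * d'"
    unfolding dvd_def by blast
  hence "a = 1 + int N * a'" "d = 1 + int N * d'" by simp_all
  hence "row_act x \<gamma> = x + (int N * fst (row_act x (a', b', c', d')), int N * snd (row_act x (a', b', c', d')))" for x
    by (cases x) (simp add: \<gamma> * algebra_simps)
  thus ?thesis using that by blast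
qed

lemma siegel_power_unit: assumes "N > 0" shows "siegel_power N x \<in> Units (Y_ring N)"
proof (rule Y_unitI[OF assms siegel_power_ext qunit_siegel_power[OF assms]])
  fix \<gamma> assume \<gamma>: "\<gamma> \<in> SL2Z"
  show "all_complex.qunit N (\<lambda>\<tau>. siegel_power N x (moebius \<gamma> \<tau>))"
    by (rule all_complex.qunit_cong[OF qunit_all[OF qunit_siegel_power[OF assms, of "row_act x \<gamma>"]]])
       (simp add: siegel_power_moebius[OF \<gamma> _ assms] upper_half_plane_def)
next
  fix \<gamma> \<tau> assume \<gamma>: "\<gamma> \<in> Gamma_full N" and \<tau>: "\<tau> \<in> upper_half_plane"
  obtain \<delta> where "\<And>x. row_act x \<gamma> = x + (int N * fst (row_act x \<delta>), int N * snd (row_act x \<delta>))"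
    using Gamma_full_row_act[OF \<gamma>] by blast
  thus "siegel_power N x (moebius \<gamma> \<tau>) = siegel_power N x \<tau>"
    by (simp only: siegel_power_moebius[OF Gamma_full_SL2Z[OF \<gamma>] \<tau> assms] siegel_power_periodic[OF assms])
qed

text \<open>The sign makes two such ratios with common denominator \<open>wp_diff N c a\<close> add
  up to 1. No power is taken, since the factor C^-2 from the modular transformation cancels in the
  ratio.\<close>

definition cross_ratio :: "nat \<Rightarrow> int \<times> int \<Rightarrow> int \<times> int \<Rightarrow> int \<times> int \<Rightarrow> int \<times> int \<Rightarrow> complex \<Rightarrow> complex" where
  "cross_ratio N a b c d = (\<lambda>\<tau>\<in>upper_half_plane. - (wp_diff N a b \<tau> / wp_diff N c d \<tau>))"

definition generic where "generic N a b \<longleftrightarrow> \<not> zero_mod N a \<and> \<not> zero_mod N b \<and> \<not> zero_mod N (a + b) \<and> \<not> zero_mod N (a - b)"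

lemma generic_row_act: "\<gamma> \<in> SL2Z \<Longrightarrow> N > 0 \<Longrightarrow> generic N (row_act a \<gamma>) (row_act b \<gamma>) \<longleftrightarrow> generic N a b"
  by (simp add: generic_def zero_mod_row_act row_act_add[symmetric] row_act_diff[symmetric])

lemma wp_diff_nonzero: "generic N a b \<Longrightarrow> Im \<tau> > 0 \<Longrightarrow> N > 0 \<Longrightarrow> wp_diff N a b \<tau> \<noteq> 0"
  by (simp add: wp_diff_def generic_def zero_mod_siegel_raw)

text \<open>The fractional exponents combine to z_b - \<tau>/6, with z_b the torsion point of b. In
  a ratio \<tau>/6 cancels, and a difference of two torsion points gives an integral power of t
  times an N-th root of unity.\<close>

lemma wp_diff_theta_prod:
  assumes "N > 0"
  shows "wp_diff N a b \<tau> = e2pi (torsion_pt N b \<tau> - \<tau> / 6) * (theta_prod N (a + b) \<tau> * theta_prod N (a - b) \<tau> / (theta_prod N a \<tau> ^ 2 * theta_prod N b \<tau> ^ 2))"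
proof -
  define L where "L x = of_int (fst x) * torsion_pt N x \<tau> / (2 * of_nat N) + \<tau> / 12 - torsion_pt N x \<tau> / 2" for x
  have G: "siegel_raw N x \<tau> = e2pi (L x) * theta_prod N x \<tau>" for x by (simp add: siegel_raw_theta_prod L_def)
  have "L (a + b) + L (a - b) = (2 * L a + 2 * L b) + (torsion_pt N b \<tau> - \<tau> / 6)"
    using assms by (simp add: L_def torsion_pt_add torsion_pt_diff field_simps)
  hence "e2pi (L (a + b)) * e2pi (L (a - b)) = e2pi (L a) ^ 2 * e2pi (L b) ^ 2 * e2pi (torsion_pt N b \<tau> - \<tau> / 6)"
    by (simp only: e2pi_add[symmetric] e2pi_power of_nat_numeral)
  hence "siegel_raw N (a + b) \<tau> * siegel_raw N (a - b) \<tau> =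
     (e2pi (L a) ^ 2 * e2pi (L b) ^ 2) * (e2pi (torsion_pt N b \<tau> - \<tau> / 6) * (theta_prod N (a + b) \<tau> * theta_prod N (a - b) \<tau>))"
    unfolding G by (simp add: mult_ac)
  moreover have "(siegel_raw N a \<tau>)\<^sup>2 * (siegel_raw N b \<tau>)\<^sup>2 = (e2pi (L a) ^ 2 * e2pi (L b) ^ 2) * (theta_prod N a \<tau> ^ 2 * theta_prod N b \<tau> ^ 2)"
    unfolding G by (simp add: power_mult_distrib mult_ac)
  ultimately show ?thesis unfolding wp_diff_def by simp
qed

lemma qunit_cross_ratio:
  assumes N: "N > 0" and g: "generic N a b" "generic N c d"
  shows "cyc.qunit N N (cross_ratio N a b c d)"
proof -
  define P where "P a b \<tau> = theta_prod N (a + b) \<tau> * theta_prod N (a - b) \<tau> / (theta_prod N a \<tau> ^ 2 * theta_prod N b \<tau> ^ 2)" for a b \<tau>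
  have P: "cyc.qunit N N (P a b)" if "generic N a b" for a b
    unfolding P_def[abs_def]
    by (intro cyc.qunit_mult cyc.qunit_divide cyc.qunit_power zero_mod_qunit N) (use that in \<open>auto simp: generic_def\<close>)
  have "cyc.qunit N N (\<lambda>\<tau>. (- 1 * e2pi (of_int (snd b - snd d) / of_nat N)) *
      (e2pi (of_int (fst b - fst d) * \<tau> / of_nat N) * (P a b \<tau> / P c d \<tau>)))"
    by (intro cyc.qunit_mult cyc.qunit_const cyc.qunit_divide cyc.qunit_e2pi P g zeta_cyclotomic cyc.uminus cyc.one) auto
  thus ?thesis
  proof (rule cyc.qunit_cong)
    fix \<tau> :: complex assume \<tau>: "Im \<tau> > 0"
    have "(torsion_pt N b \<tau> - \<tau> / 6) - (torsion_pt N d \<tau> - \<tau> / 6) = of_int (snd b - snd d) / of_nat N + of_int (fst b - fst d) * \<tau> / of_nat N"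
      using N by (simp add: torsion_pt_def field_simps)
    hence "e2pi (torsion_pt N b \<tau> - \<tau> / 6) / e2pi (torsion_pt N d \<tau> - \<tau> / 6) =
       e2pi (of_int (snd b - snd d) / of_nat N) * e2pi (of_int (fst b - fst d) * \<tau> / of_nat N)"
      by (simp only: e2pi_diff[symmetric] e2pi_add[symmetric])
    moreover have "wp_diff N a b \<tau> / wp_diff N c d \<tau> = (e2pi (torsion_pt N b \<tau> - \<tau> / 6) / e2pi (torsion_pt N d \<tau> - \<tau> / 6)) * (P a b \<tau> / P c d \<tau>)"
      unfolding wp_diff_theta_prod[OF N] P_def[symmetric] by simp
    ultimately show "cross_ratio N a b c d \<tau> = (- 1 * e2pi (of_int (snd b - snd d) / of_nat N)) *
      (e2pi (of_int (fst b - fst d) * \<tau> / of_nat N) * (P a b \<tau> / P c d \<tau>))"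
      using \<tau> by (simp add: cross_ratio_def upper_half_plane_def)
  qed
qed

lemma cross_ratio_moebius:
  assumes "\<gamma> \<in> SL2Z" "\<tau> \<in> upper_half_plane" "N > 0"
  shows "cross_ratio N a b c d (moebius \<gamma> \<tau>) = cross_ratio N (row_act a \<gamma>) (row_act b \<gamma>) (row_act c \<gamma>) (row_act d \<gamma>) \<tau>"
proof -
  obtain C where C: "C ^ 12 = 1" "\<And>N x. N > 0 \<Longrightarrow> siegel_raw N x (moebius \<gamma> \<tau>) = C * siegel_raw N (row_act x \<gamma>) \<tau>"
    using siegel_raw_modular_SL2Z[OF assms(1,2)] by blast
  have C0: "C \<noteq> 0" using C(1) by auto
  have "wp_diff N a b (moebius \<gamma> \<tau>) = wp_diff N (row_act a \<gamma>) (row_act b \<gamma>) \<tau> / C ^ 2" for a b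
    unfolding wp_diff_def C(2)[OF assms(3)] row_act_add row_act_diff using C0
    by (simp add: power_mult_distrib power2_eq_square)
  thus ?thesis using C0 assms(2) moebius_upper_half_plane[OF assms(1,2)] by (simp add: cross_ratio_def)
qed

lemma cross_ratio_unit:
  assumes N: "N > 0" and g: "generic N a b" "generic N c d"
  shows "cross_ratio N a b c d \<in> Units (Y_ring N)"
proof (rule Y_unitI[OF N _ qunit_cross_ratio[OF N g]])
  show "cross_ratio N a b c d \<in> extensional upper_half_plane" by (simp add: cross_ratio_def)
  fix \<gamma> assume \<gamma>: "\<gamma> \<in> SL2Z"
  have "cyc.qunit N N (cross_ratio N (row_act a \<gamma>) (row_act b \<gamma>) (row_act c \<gamma>) (row_act d \<gamma>))"
    by (rule qunit_cross_ratio[OF N]) (use g generic_row_act[OF \<gamma> N] in auto)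
  thus "all_complex.qunit N (\<lambda>\<tau>. cross_ratio N a b c d (moebius \<gamma> \<tau>))"
    by (rule all_complex.qunit_cong[OF qunit_all])
       (simp add: cross_ratio_moebius[OF \<gamma> _ N] upper_half_plane_def)
next
  fix \<gamma> \<tau> assume \<gamma>: "\<gamma> \<in> Gamma_full N" and \<tau>: "\<tau> \<in> upper_half_plane"
  obtain \<delta> where \<delta>: "\<And>x. row_act x \<gamma> = x + (int N * fst (row_act x \<delta>), int N * snd (row_act x \<delta>))"
    using Gamma_full_row_act[OF \<gamma>] by blast
  have "wp_diff N (row_act a \<gamma>) (row_act b \<gamma>) \<tau> = wp_diff N a b \<tau>" for a b
    by (rule wp_diff_periodic[OF _ N \<delta>]) (use \<tau> in \<open>simp add: upper_half_plane_def\<close>)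
  thus "cross_ratio N a b c d (moebius \<gamma> \<tau>) = cross_ratio N a b c d \<tau>"
    unfolding cross_ratio_moebius[OF Gamma_full_SL2Z[OF \<gamma>] \<tau> N] using \<tau> by (simp add: cross_ratio_def)
qed

lemma wp_diff_sum:
  assumes "generic N a b" "generic N b c" "generic N c a" "Im \<tau> > 0" "N > 0"
  shows "wp_diff N a b \<tau> + wp_diff N b c \<tau> + wp_diff N c a \<tau> = 0"
proof -
  have nz: "siegel_raw N a \<tau> \<noteq> 0" "siegel_raw N b \<tau> \<noteq> 0" "siegel_raw N c \<tau> \<noteq> 0" using assms by (simp_all add: generic_def zero_mod_siegel_raw)
  have "wp_diff N a b \<tau> + wp_diff N b c \<tau> + wp_diff N c a \<tau> =
     (siegel_raw N (a + b) \<tau> * siegel_raw N (a - b) \<tau> * (siegel_raw N c \<tau>)\<^sup>2 + siegel_raw N (b + c) \<tau> * siegel_raw N (b - c) \<tau> * (siegel_raw N a \<tau>)\<^sup>2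
     + siegel_raw N (c + a) \<tau> * siegel_raw N (c - a) \<tau> * (siegel_raw N b \<tau>)\<^sup>2) / ((siegel_raw N a \<tau>)\<^sup>2 * (siegel_raw N b \<tau>)\<^sup>2 * (siegel_raw N c \<tau>)\<^sup>2)"
    unfolding wp_diff_def using nz by (simp add: field_simps)
  thus ?thesis by (simp add: siegel_raw_three_term[OF assms(4,5)])
qed

section \<open>The three-term relation\<close>

lemma Y_pow:
  assumes "N > 0" "f \<in> Y_carrier N"
  shows "f [^]\<^bsub>Y_ring N\<^esub> (n :: nat) = (\<lambda>\<tau>\<in>upper_half_plane. f \<tau> ^ n)"
proof -
  interpret cring "Y_ring N" by (rule Y_ring_cring[OF assms(1)])
  show ?thesis by (induction n) (auto simp: Y_ring_simps fun_eq_iff)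
qed

lemma Y_inv:
  assumes "N > 0" "f \<in> Units (Y_ring N)" "\<tau> \<in> upper_half_plane"
  shows "(inv\<^bsub>Y_ring N\<^esub> f) \<tau> = inverse (f \<tau>)"
proof -
  interpret cring "Y_ring N" by (rule Y_ring_cring[OF assms(1)])
  have "f \<otimes>\<^bsub>Y_ring N\<^esub> inv\<^bsub>Y_ring N\<^esub> f = \<one>\<^bsub>Y_ring N\<^esub>" by (rule Units_r_inv[OF assms(2)])
  hence "f \<tau> * (inv\<^bsub>Y_ring N\<^esub> f) \<tau> = 1" using assms(3) by (simp add: Y_ring_simps fun_eq_iff) metis
  thus ?thesis by (metis inverse_unique)
qed

definition siegel_unit_fun :: "nat \<Rightarrow> int \<times> int \<Rightarrow> complex \<Rightarrow> complex" where
  "siegel_unit_fun N x = (\<lambda>\<tau>\<in>upper_half_plane. siegel_function N x \<tau> ^ (12 * N))"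

definition zeta_fun :: "nat \<Rightarrow> int \<Rightarrow> complex \<Rightarrow> complex" where
  "zeta_fun N k = (\<lambda>\<tau>\<in>upper_half_plane. e2pi (of_int k / of_nat N))"

lemma zeta_fun_unit: assumes "N > 0" shows "zeta_fun N k \<in> Units (Y_ring N)"
proof (rule Y_unitI[OF assms])
  have q: "cyc.qunit N N (\<lambda>_. e2pi (of_int k / of_nat N))"
    by (intro cyc.qunit_const zeta_cyclotomic) simp
  show "cyc.qunit N N (zeta_fun N k)"
    by (rule cyc.qunit_cong[OF q]) (simp add: zeta_fun_def upper_half_plane_def)
  fix \<gamma> assume \<gamma>: "\<gamma> \<in> SL2Z"
  show "all_complex.qunit N (\<lambda>\<tau>. zeta_fun N k (moebius \<gamma> \<tau>))"
    by (rule all_complex.qunit_cong[OF qunit_all[OF q]])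
       (use moebius_upper_half_plane[OF \<gamma>] in \<open>simp add: zeta_fun_def upper_half_plane_def\<close>)
next
  fix \<gamma> \<tau> assume "\<gamma> \<in> Gamma_full N" "\<tau> \<in> upper_half_plane"
  thus "zeta_fun N k (moebius \<gamma> \<tau>) = zeta_fun N k \<tau>"
    using moebius_upper_half_plane[OF Gamma_full_SL2Z] by (simp add: zeta_fun_def)
qed (simp add: zeta_fun_def)

lemma zeta_fun_pow:
  assumes "N > 0" shows "zeta_fun N k [^]\<^bsub>Y_ring N\<^esub> N = \<one>\<^bsub>Y_ring N\<^esub>"
proof -
  have "zeta_fun N k \<in> Y_carrier N"
    using zeta_fun_unit[OF assms] by (auto simp: Units_def Y_ring_simps)
  thus ?thesis using assms by (simp add: Y_pow Y_ring_simps zeta_fun_def e2pi_power fun_eq_iff)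
qed

text \<open>The Siegel function lacks the phase of \<open>siegel_raw\<close>. For the reduced index
  r its power with exponent 12N is e(6 r_1 r_2 / N) by \<open>siegel_raw_power_theta_prod\<close>,
  an N-th root of unity.\<close>

lemma siegel_siegel_power:
  assumes N: "N > 0" shows "\<exists>k. siegel_unit_fun N x = zeta_fun N k \<otimes>\<^bsub>Y_ring N\<^esub> siegel_power N x"
proof -
  define r where "r = (fst x mod int N, snd x mod int N)"
  have "x = r + (int N * (fst x div int N), int N * (snd x div int N))"
    by (simp add: r_def prod_eq_iff)
  hence A: "siegel_power N x = siegel_power N r" by (metis siegel_power_periodic[OF N])
  have l: "zero_mod N r \<longleftrightarrow> fst r = 0 \<and> snd r = 0"
  proof
    assume "zero_mod N r"
    then obtain i j where "r = (int N * i, int N * j)" by (auto simp: zero_mod_def)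
    moreover have "fst r mod int N = fst r" "snd r mod int N = snd r" by (simp_all add: r_def)
    ultimately show "fst r = 0 \<and> snd r = 0" by simp
  next
    assume "fst r = 0 \<and> snd r = 0"
    hence "r = (int N * 0, int N * 0)" by (simp add: prod_eq_iff)
    thus "zero_mod N r" unfolding zero_mod_def by blast
  qed
  show ?thesis
  proof (cases "zero_mod N r")
    case True
    have "siegel_function N x \<tau> = 1" for \<tau>
      using True unfolding l by (simp add: siegel_function_def r_def)
    hence "siegel_unit_fun N x = zeta_fun N 0 \<otimes>\<^bsub>Y_ring N\<^esub> siegel_power N x"
      using True unfolding A by (auto simp: siegel_unit_fun_def siegel_power_def Y_ring_simps zeta_fun_def fun_eq_iff)
    thus ?thesis by blast
  next
    case False
    have s: "siegel_function N x \<tau> = e2pi (of_real (bernoulli2 (of_int (fst r) / of_nat N) / 2) * \<tau>) * theta_prod N r \<tau>" for \<tau>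
      using False l
      by (simp add: siegel_function_def Let_def r_def theta_prod_def torsion_pt_def qprod_def e2pi_power e2pi_add[symmetric] algebra_simps) auto
    have "siegel_unit_fun N x \<tau> = (zeta_fun N (- (6 * fst r * snd r)) \<otimes>\<^bsub>Y_ring N\<^esub> siegel_power N x) \<tau>" if \<tau>: "Im \<tau> > 0" for \<tau>
    proof -
      have "of_nat (12 * N) * (of_real (bernoulli2 (of_int (fst r) / of_nat N) / 2) * \<tau>) =
          of_int (6 * fst r ^ 2 + int N ^ 2 - 6 * int N * fst r) * \<tau> / of_nat N"
        using N by (simp add: bernoulli2_def field_simps power2_eq_square)
      hence "siegel_unit_fun N x \<tau> = e2pi (of_int (6 * fst r ^ 2 + int N ^ 2 - 6 * int N * fst r) * \<tau> / of_nat N) * theta_prod N r \<tau> ^ (12 * N)"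
        using \<tau> by (simp only: siegel_unit_fun_def restrict_apply upper_half_plane_def mem_Collect_eq if_True s power_mult_distrib e2pi_power)
      moreover have "(zeta_fun N (- (6 * fst r * snd r)) \<otimes>\<^bsub>Y_ring N\<^esub> siegel_power N x) \<tau> =
          e2pi (of_int (- (6 * fst r * snd r)) / of_nat N) * siegel_raw N r \<tau> ^ (12 * N)"
        using \<tau> False unfolding A by (simp add: Y_ring_simps zeta_fun_def siegel_power_def upper_half_plane_def)
      moreover have "e2pi (of_int (- (6 * fst r * snd r)) / of_nat N) * e2pi (of_int (6 * fst r * snd r) / of_nat N) = 1"
        unfolding e2pi_add[symmetric] by simp
      hence "e2pi (of_int (- (6 * fst r * snd r)) / of_nat N) * siegel_raw N r \<tau> ^ (12 * N) =
         e2pi (of_int (6 * fst r ^ 2 + int N ^ 2 - 6 * int N * fst r) * \<tau> / of_nat N) * theta_prod N r \<tau> ^ (12 * N)"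
        unfolding siegel_raw_power_theta_prod[OF N] mult.assoc[symmetric] by (simp only: mult_1)
      ultimately show ?thesis by simp
    qed
    hence "siegel_unit_fun N x = zeta_fun N (- (6 * fst r * snd r)) \<otimes>\<^bsub>Y_ring N\<^esub> siegel_power N x"
      by (intro Y_eqI) (auto simp: siegel_unit_fun_def Y_ring_simps)
    thus ?thesis by blast
  qed
qed

theorem theorem4p1:
  fixes N :: nat and a b c :: "int \<times> int"
  assumes "N \<ge> 1"
    and "[fst a + fst b + fst c = 0] (mod int N)"
    and "[snd a + snd b + snd c = 0] (mod int N)"
  shows "siegel_symbol N a b \<otimes>\<^bsub>K2_Y_inv N\<^esub> siegel_symbol N b c \<otimes>\<^bsub>K2_Y_inv N\<^esub> siegel_symbol N c a
    = \<one>\<^bsub>K2_Y_inv N\<^esub>"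
proof -
  have N: "N > 0" using assms(1) by simp
  define R where "R = Y_ring N"
  define s where "s = (1 / of_nat (12 * N) :: rat)"
  \<comment> \<open>1/(12N) = 3N/(6N)^2.\<close>
  have s: "s \<in> carrier (Z_inv (6 * N))"
    unfolding carrier_Z_inv using N
    by (intro exI[of _ "3 * int N"] exI[of _ 2]) (simp add: s_def power2_eq_square field_simps)
  interpret M: milnor_tensor R "6 * N" "s * s"
    unfolding milnor_tensor_def milnor_tensor_axioms_def steinberg_def R_def
    using Y_ring_cring[OF N] N Z_inv_mult[OF s s] by simp
  have siegel_power: "siegel_power N x \<in> Units R" for x unfolding R_def by (rule siegel_power_unit[OF N])
  have siegel_unit_fun: "siegel_unit_fun N x \<in> Units R" for x
    using siegel_siegel_power[OF N, of x] siegel_power[of x] zeta_fun_unit[OF N] by (auto simp: R_def[symmetric])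
  have sym: "siegel_symbol N x y = tensor_class (K2 R) (Z_inv (6 * N)) (M.symb (siegel_unit_fun N x) (siegel_unit_fun N y))" for x y
    using M.milnor_symbol_inv_pure[OF siegel_unit_fun siegel_unit_fun s s, of x y]
    by (simp add: siegel_symbol_def siegel_unit_def siegel_unit_fun_def[symmetric] R_def[symmetric] s_def[symmetric] M.symb_def del: of_nat_mult)
  \<comment> \<open>The constants \<open>zeta_fun\<close> are N-torsion units, so they do not affect
    the symbols.\<close>
  have CA: "M.symb (siegel_unit_fun N x) (siegel_unit_fun N y) - M.symb (siegel_power N x) (siegel_power N y) \<in> M.KT.H" for x y
  proof -
    obtain k l where kl: "siegel_unit_fun N x = zeta_fun N k \<otimes>\<^bsub>R\<^esub> siegel_power N x" "siegel_unit_fun N y = zeta_fun N l \<otimes>\<^bsub>R\<^esub> siegel_power N y"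
      using siegel_siegel_power[OF N] unfolding R_def by blast
    have z: "zeta_fun N k \<in> Units R" "zeta_fun N k [^]\<^bsub>R\<^esub> N = \<one>\<^bsub>R\<^esub>" for k
      unfolding R_def using zeta_fun_unit[OF N] zeta_fun_pow[OF N] by auto
    have "M.symb (siegel_unit_fun N x) (siegel_unit_fun N y) - M.symb (siegel_power N x) (siegel_unit_fun N y) \<in> M.KT.H"
      unfolding kl(1) by (rule M.symb_torsion(1)[OF siegel_power siegel_unit_fun z]) simp
    moreover have "M.symb (siegel_power N x) (siegel_unit_fun N y) - M.symb (siegel_power N x) (siegel_power N y) \<in> M.KT.H"
      unfolding kl(2) by (rule M.symb_torsion(2)[OF siegel_power siegel_power z]) simp
    ultimately show ?thesis using M.KT.H_add by fastforce
  qed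
  have pw: "siegel_power N x \<tau> = siegel_raw N x \<tau> ^ (12 * N)" if "\<not> zero_mod N x" "\<tau> \<in> upper_half_plane" for x \<tau>
    using that by (simp add: siegel_power_def)
  have Rs: "(f \<otimes>\<^bsub>R\<^esub> g) \<tau> = f \<tau> * g \<tau>" "(f \<oplus>\<^bsub>R\<^esub> g) \<tau> = f \<tau> + g \<tau>" if "\<tau> \<in> upper_half_plane" for f g \<tau>
    using that by (simp_all add: R_def Y_ring_simps)
  have Rinv: "(inv\<^bsub>R\<^esub> f) \<tau> = inverse (f \<tau>)" if "f \<in> Units R" "\<tau> \<in> upper_half_plane" for f \<tau>
    using Y_inv[OF N] that by (simp add: R_def)
  \<comment> \<open>f_ab formed from the powers is the 12N-th power of the difference, which fixes
    the exponent n = 12N of the Steinberg pairs.\<close>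
  have wp_quot: "M.wp_quot (siegel_power N) a b \<tau> = wp_diff N a b \<tau> ^ (12 * N)" if "generic N a b" "\<tau> \<in> upper_half_plane" for a b \<tau>
    using that siegel_power by (simp add: M.wp_quot_def Rs Rinv pw generic_def wp_diff_def power_mult_distrib power_divide power2_eq_square divide_inverse power_inverse mult.assoc)
  have qtU: "M.wp_quot (siegel_power N) a b \<in> Units R" for a b using siegel_power by (simp add: M.wp_quot_def)
  have ext: "f \<in> Units R \<Longrightarrow> f \<in> extensional upper_half_plane" for f
    by (auto simp: Units_def R_def Y_ring_simps dest: Y_carrier_ext)
  have main: "M.symb (siegel_power N a) (siegel_power N b) + M.symb (siegel_power N b) (siegel_power N c) + M.symb (siegel_power N c) (siegel_power N a) \<in> M.KT.H"
  proof -
    have "int N dvd fst a + fst b + fst c" "int N dvd snd a + snd b + snd c"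
      using assms(2,3) by (simp_all add: cong_0_iff)
    then obtain i j where "fst a + fst b + fst c = int N * i" "snd a + snd b + snd c = int N * j"
      unfolding dvd_def by blast
    hence abc: "a + b + c = (int N * i, int N * j)" by (simp add: prod_eq_iff)
    have A0: "siegel_power N 0 = \<one>\<^bsub>R\<^esub>"
    proof -
      have "zero_mod N 0" unfolding zero_mod_def by (intro exI[of _ 0]) (simp add: zero_prod_def)
      thus ?thesis by (simp add: siegel_power_def R_def Y_ring_simps)
    qed
    show ?thesis
    proof (rule M.three_term[OF assms(1) _ _ siegel_power siegel_power_minus siegel_power_periodic[OF N] A0 _ abc])
      fix a b c :: "int \<times> int"
      assume "\<And>i j. (int N * i, int N * j) \<notin> {a, b, c, a + b, a - b, b + c, b - c, c + a, c - a}"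
      hence "x \<in> {a, b, c, a + b, a - b, b + c, b - c, c + a, c - a} \<Longrightarrow> \<not> zero_mod N x" for x
        unfolding zero_mod_def by metis
      hence g: "generic N a b" "generic N b c" "generic N c a"
        by (simp_all add: generic_def)
      let ?u = "cross_ratio N a b c a" and ?v = "cross_ratio N b c c a"
      have uv: "?u \<in> Units R" "?v \<in> Units R"
        unfolding R_def by (rule cross_ratio_unit[OF N]; use g in simp)+
      have "?u \<oplus>\<^bsub>R\<^esub> ?v = \<one>\<^bsub>R\<^esub>"
      proof (rule Y_eqI)
        fix \<tau> :: complex assume \<tau>: "Im \<tau> > 0"
        have "wp_diff N c a \<tau> \<noteq> 0" by (rule wp_diff_nonzero[OF g(3) \<tau> N])
        moreover have "wp_diff N a b \<tau> = - (wp_diff N b c \<tau> + wp_diff N c a \<tau>)"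
          using wp_diff_sum[OF g \<tau> N] by (simp only: eq_neg_iff_add_eq_0 add.assoc)
        ultimately have "- (wp_diff N a b \<tau> / wp_diff N c a \<tau>) + - (wp_diff N b c \<tau> / wp_diff N c a \<tau>) = 1"
          by (simp add: diff_divide_distrib)
        thus "(?u \<oplus>\<^bsub>R\<^esub> ?v) \<tau> = \<one>\<^bsub>R\<^esub> \<tau>"
          using \<tau> by (simp add: R_def Y_ring_simps cross_ratio_def upper_half_plane_def)
      qed (auto simp: R_def Y_ring_simps)
      moreover have "?u [^]\<^bsub>R\<^esub> (12 * N) = M.wp_quot (siegel_power N) a b \<otimes>\<^bsub>R\<^esub> inv\<^bsub>R\<^esub> M.wp_quot (siegel_power N) c a"
        "?v [^]\<^bsub>R\<^esub> (12 * N) = M.wp_quot (siegel_power N) b c \<otimes>\<^bsub>R\<^esub> inv\<^bsub>R\<^esub> M.wp_quot (siegel_power N) c a"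
      proof -
        have *: "cross_ratio N x y c a [^]\<^bsub>R\<^esub> (12 * N) = M.wp_quot (siegel_power N) x y \<otimes>\<^bsub>R\<^esub> inv\<^bsub>R\<^esub> M.wp_quot (siegel_power N) c a"
          if xy: "generic N x y" for x y
        proof (rule Y_eqI)
          have cu: "cross_ratio N x y c a \<in> Units R" unfolding R_def by (rule cross_ratio_unit[OF N xy g(3)])
          show "cross_ratio N x y c a [^]\<^bsub>R\<^esub> (12 * N) \<in> extensional upper_half_plane"
            by (rule ext) (rule M.Units_pow_closed[OF cu])
          show "M.wp_quot (siegel_power N) x y \<otimes>\<^bsub>R\<^esub> inv\<^bsub>R\<^esub> M.wp_quot (siegel_power N) c a \<in> extensional upper_half_plane"
            by (simp add: R_def Y_ring_simps)
          fix \<tau> :: complex assume "Im \<tau> > 0"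
          hence \<tau>: "\<tau> \<in> upper_half_plane" by (simp add: upper_half_plane_def)
          have "cross_ratio N x y c a \<in> Y_carrier N" using cu by (auto simp: Units_def R_def Y_ring_simps)
          \<comment> \<open>The exponent 12N is even, so the sign in \<open>cross_ratio\<close>
            disappears.\<close>
          hence "(cross_ratio N x y c a [^]\<^bsub>R\<^esub> (12 * N)) \<tau> = (wp_diff N x y \<tau> / wp_diff N c a \<tau>) ^ (12 * N)"
            using \<tau> by (simp add: R_def Y_pow[OF N] cross_ratio_def power_mult)
          thus "(cross_ratio N x y c a [^]\<^bsub>R\<^esub> (12 * N)) \<tau> = (M.wp_quot (siegel_power N) x y \<otimes>\<^bsub>R\<^esub> inv\<^bsub>R\<^esub> M.wp_quot (siegel_power N) c a) \<tau>"
            using \<tau> qtU by (simp add: Rs Rinv wp_quot xy g power_mult_distrib power_inverse divide_inverse)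
        qed
        show "?u [^]\<^bsub>R\<^esub> (12 * N) = M.wp_quot (siegel_power N) a b \<otimes>\<^bsub>R\<^esub> inv\<^bsub>R\<^esub> M.wp_quot (siegel_power N) c a"
          "?v [^]\<^bsub>R\<^esub> (12 * N) = M.wp_quot (siegel_power N) b c \<otimes>\<^bsub>R\<^esub> inv\<^bsub>R\<^esub> M.wp_quot (siegel_power N) c a"
          by (rule *; rule g)+
      qed
      ultimately show "\<exists>u\<in>Units R. \<exists>v\<in>Units R. \<exists>n::nat. u \<oplus>\<^bsub>R\<^esub> v = \<one>\<^bsub>R\<^esub> \<and>
          u [^]\<^bsub>R\<^esub> n = M.wp_quot (siegel_power N) a b \<otimes>\<^bsub>R\<^esub> inv\<^bsub>R\<^esub> M.wp_quot (siegel_power N) c a \<and>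
          v [^]\<^bsub>R\<^esub> n = M.wp_quot (siegel_power N) b c \<otimes>\<^bsub>R\<^esub> inv\<^bsub>R\<^esub> M.wp_quot (siegel_power N) c a"
        using uv by blast
    qed simp_all
  qed
  note sum = M.KT.H_add[OF M.KT.H_add[OF M.KT.H_add[OF main CA[of a b]] CA[of b c]] CA[of c a]]
  have "M.symb (siegel_unit_fun N a) (siegel_unit_fun N b) + M.symb (siegel_unit_fun N b) (siegel_unit_fun N c) + M.symb (siegel_unit_fun N c) (siegel_unit_fun N a) \<in> M.KT.H"
    using sum by (simp add: algebra_simps)
  moreover have t: "tfree (K2 R) (Z_inv (6 * N)) (M.symb (siegel_unit_fun N x) (siegel_unit_fun N y))" for x y
    by (rule M.symb_tfree[OF siegel_unit_fun siegel_unit_fun])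
  ultimately show ?thesis
    unfolding sym K2_Y_inv_def R_def[symmetric]
    by (simp add: M.KT.tensor_product_mult tfree_add M.KT.tensor_product_one M.KT.tensor_class_cong)
qed

end
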